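(* Let $p\ge5$ and $\mu>0$. Then there is no nontrivial weak solution $u\in E\cap H^2_{loc}(\mathbb{R}^3)$ of $$-\Delta u+\Big(u^2\star\frac{1}{4\pi|x|}\Big)u=\mu|u|^{p-1}u\quad\text{in }\mathbb{R}^3 .$$
   Context: $E=\{u\in D^{1,2}(\mathbb{R}^3):\int_{\mathbb{R}^3}\int_{\mathbb{R}^3}\frac{u^2(x)u^2(y)}{|x-y|}\,dx\,dy<+\infty\}$ (real-valued functions). For $u\in E$ set $\phi_u=\frac{1}{4\pi|x|}\star u^2$. Weak solution means $\int\nabla u\cdot\nabla\psi+\int\phi_u u\psi=\mu\int|u|^{p-1}u\psi$ for all $\psi\in C_0^\infty(\mathbb{R}^3)$. *)

theory Defs
  imports "HOL-Analysis.Analysis"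
begin

section \<open>Test functions\<close>

definition partial_deriv :: "'n::finite \<Rightarrow> (real^'n \<Rightarrow> real) \<Rightarrow> real^'n \<Rightarrow> real" where
  "partial_deriv i f x = frechet_derivative f (at x) (axis i 1)"

definition grad :: "(real^'n::finite \<Rightarrow> real) \<Rightarrow> real^'n \<Rightarrow> real^'n" where
  "grad f x = (\<chi> i. partial_deriv i f x)"

fun C_k :: "nat \<Rightarrow> (real^'n::finite \<Rightarrow> real) \<Rightarrow> bool" where
  "C_k 0 f \<longleftrightarrow> continuous_on UNIV f"
| "C_k (Suc k) f \<longleftrightarrow> f differentiable_on UNIV \<and> (\<forall>i. C_k k (partial_deriv i f))"

definition test_functions :: "(real^'n::finite \<Rightarrow> real) set" where
  "test_functions = {f. (\<forall>k. C_k k f) \<and> compact (closure {x. f x \<noteq> 0})}"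

section \<open>Lebesgue and Sobolev spaces\<close>

text \<open>
  Elements of all the function spaces below are genuine functions, not classes modulo
  equality almost everywhere; all the notions are invariant under changes on Lebesgue null sets.
\<close>

definition L_space :: "real \<Rightarrow> (real^'n::finite \<Rightarrow> real) set" where
  "L_space q = {u \<in> borel_measurable lebesgue. integrable lebesgue (\<lambda>x. \<bar>u x\<bar> powr q)}"

definition L_loc :: "real \<Rightarrow> (real^'n::finite \<Rightarrow> real) set" where
  "L_loc q = {u \<in> borel_measurable lebesgue.
     \<forall>K. compact K \<longrightarrow> set_integrable lebesgue K (\<lambda>x. \<bar>u x\<bar> powr q)}"

definition weak_partial ::
  "'n::finite \<Rightarrow> (real^'n \<Rightarrow> real) \<Rightarrow> (real^'n \<Rightarrow> real) \<Rightarrow> bool" where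
  "weak_partial i u g \<longleftrightarrow> u \<in> L_loc 1 \<and> g \<in> L_loc 1 \<and>
     (\<forall>\<psi>\<in>test_functions.
        (\<integral>x. u x * partial_deriv i \<psi> x \<partial>lebesgue) = - (\<integral>x. g x * \<psi> x \<partial>lebesgue))"

definition weak_grad :: "(real^'n::finite \<Rightarrow> real) \<Rightarrow> (real^'n \<Rightarrow> real^'n) \<Rightarrow> bool" where
  "weak_grad u G \<longleftrightarrow> (\<forall>i. weak_partial i u (\<lambda>x. G x $ i))"

text \<open>
  The space \<open>D\<^sup>1\<^sup>,\<^sup>2(\<real>\<^sup>3)\<close>, realised as the functions in \<open>L\<^sup>6\<close> (6 being the critical Sobolev
  exponent in dimension 3) whose weak gradient is in \<open>L\<^sup>2\<close>.
\<close>

definition D12 :: "(real^3 \<Rightarrow> real) set" where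
  "D12 = {u \<in> L_space 6. \<exists>G. weak_grad u G \<and> (\<forall>i. (\<lambda>x. G x $ i) \<in> L_space 2)}"

definition H2_loc :: "(real^'n::finite \<Rightarrow> real) set" where
  "H2_loc = {u \<in> L_loc 2. \<exists>G H. weak_grad u G \<and> (\<forall>i. (\<lambda>x. G x $ i) \<in> L_loc 2) \<and>
     (\<forall>i j. weak_partial j (\<lambda>x. G x $ i) (H i j) \<and> H i j \<in> L_loc 2)}"

definition E_space :: "(real^3 \<Rightarrow> real) set" where
  "E_space = {u \<in> D12.
     (\<integral>\<^sup>+y. (\<integral>\<^sup>+x. ennreal ((u x)\<^sup>2 * (u y)\<^sup>2 / norm (x - y)) \<partial>lebesgue) \<partial>lebesgue) < \<infinity>}"

section \<open>The equation\<close>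

definition convolution ::
  "(real^'n::finite \<Rightarrow> real) \<Rightarrow> (real^'n \<Rightarrow> real) \<Rightarrow> real^'n \<Rightarrow> real" where
  "convolution f g x = (\<integral>y. f (x - y) * g y \<partial>lebesgue)"

definition phi :: "(real^3 \<Rightarrow> real) \<Rightarrow> real^3 \<Rightarrow> real" where
  "phi u = convolution (\<lambda>x. 1 / (4 * pi * norm x)) (\<lambda>x. (u x)\<^sup>2)"

text \<open>
  The Bochner integral of a non-integrable function is 0 by convention, so the convergence of
  the three integrals in the weak formulation, implicit in the usual notation, is spelled out.
  It holds automatically for \<open>u\<close> in \<open>E_space \<inter> H2_loc\<close>, since \<open>H\<^sup>2\<close> embeds locally into
  \<open>L\<^sup>\<infinity>\<close> in dimension 3. As the weak gradient is unique up to null sets, the choice of \<open>G\<close>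
  is immaterial.
\<close>

definition weak_solution :: "real \<Rightarrow> real \<Rightarrow> (real^3 \<Rightarrow> real) \<Rightarrow> bool" where
  "weak_solution p \<mu> u \<longleftrightarrow> (\<exists>G. weak_grad u G \<and> (\<forall>\<psi>\<in>test_functions.
     integrable lebesgue (\<lambda>x. G x \<bullet> grad \<psi> x) \<and>
     integrable lebesgue (\<lambda>x. phi u x * u x * \<psi> x) \<and>
     integrable lebesgue (\<lambda>x. \<bar>u x\<bar> powr (p - 1) * u x * \<psi> x) \<and>
     (\<integral>x. G x \<bullet> grad \<psi> x \<partial>lebesgue) + (\<integral>x. phi u x * u x * \<psi> x \<partial>lebesgue)
       = \<mu> * (\<integral>x. \<bar>u x\<bar> powr (p - 1) * u x * \<psi> x \<partial>lebesgue)))"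

end

(* Testing the equation with u and with x . grad u, both cut off, gives the Nehari identity
   A + D = mu B and the Pohozaev identity A/2 + 5D/4 = 3 mu B/(p+1), where A, D and B are the
   integrals of |grad u|^2, phi_u u^2 and |u|^(p+1). As 3/(p+1) <= 1/2 these force D <= 0, so u = 0.

   No Sobolev theory is needed. Weak derivatives enter only as L^2 limits of difference quotients;
   comparing a convex F with its tangents along a translation then gives the chain rule for F(u),
   and polarising F(t) = t^2 gives the product rule. The potential is locally bounded because u is
   in L^6, so the equation itself puts |u|^p in L^2_loc. The cutoff error in the Nehari identity is
   controlled by the energy D, which bounds the integral of u^2 over the R-ball by (2 R D)^(1/2). *)

theory Submission
  imports Defs "HOL-Computational_Algebra.Polynomial"
begin

section \<open>Smooth bump functions\<close>

text \<open>The Coulomb term shapes the argument. In the integral of phi_u u (x . grad u), moving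
  the derivative off u puts it on 1/|x - y|, and the singularity |x - y|^(-2) so produced is not
  controlled by the energy. The kernel is therefore regularised to 1/sqrt(|z|^2 + d^2), the double
  integral is symmetrised in x and y, and only then d tends to 0. The field x, cut off at radius R,
  now enters through its differences, which are Lipschitz with a constant independent of R; so
  majorants that are multiples of u(x)^2 u(y)^2 / |x - y| serve both limits, d -> 0 and R ->
  \<infinity>.

  The divergence 3 of the field contributes 3/2 and the kernel, homogeneous of degree -1, takes off
  1/4; this is the weight 5/4. For the gradient the same count gives 3/2 - 1 = 1/2. At p = 5 the
  gradient terms of the two identities cancel exactly, and the contradiction rests on 5/4 > 1/2 on
  the Coulomb side and on D > 0.

  That |u|^(p+1) is integrable is not known beforehand; it is an outcome of the Nehari limit and is
  required before the Pohozaev limit can be taken.\<close>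

definition smooth_real :: "(real \<Rightarrow> real) \<Rightarrow> bool" where
  "smooth_real f \<longleftrightarrow> (\<forall>k t. (deriv ^^ k) f differentiable (at t))"

text \<open>A coinduction principle: membership in a class of differentiable functions closed under
  \<open>deriv\<close> gives smoothness without any formula for the k-th derivative.\<close>

lemma smooth_real_coinduct:
  assumes "f \<in> S" and "\<And>f t. f \<in> S \<Longrightarrow> f differentiable (at t)" and "\<And>f. f \<in> S \<Longrightarrow> deriv f \<in> S"
  shows "smooth_real f"
proof -
  have "(deriv ^^ k) f \<in> S" for k
    by (induction k) (use assms in auto)
  then show ?thesis
    unfolding smooth_real_def using assms(2) by blast
qed

lemma smooth_real_deriv: "smooth_real f \<Longrightarrow> smooth_real (deriv f)"
  unfolding smooth_real_def by (metis comp_apply funpow_Suc_right)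

lemma smooth_real_has_derivative:
  assumes "smooth_real f" shows "(f has_real_derivative deriv f t) (at t)"
proof -
  have "f differentiable (at t)"
    using assms unfolding smooth_real_def by (metis funpow_0)
  then show ?thesis
    by (simp add: DERIV_deriv_iff_real_differentiable)
qed

text \<open>Products of smooth functions are not visibly closed under \<open>deriv\<close>, but by
  the Leibniz rule finite sums of such products are. This is the class fed to the coinduction in
  \<open>smooth_real_mult\<close>.\<close>

inductive_set prod_closure :: "(real \<Rightarrow> real) set" where
  prod: "smooth_real f \<Longrightarrow> smooth_real g \<Longrightarrow> (\<lambda>t. f t * g t) \<in> prod_closure"
| sum: "f \<in> prod_closure \<Longrightarrow> g \<in> prod_closure \<Longrightarrow> (\<lambda>t. f t + g t) \<in> prod_closure"

lemma prod_closure_deriv: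
  assumes "f \<in> prod_closure"
  shows "(\<forall>t. f differentiable (at t)) \<and> deriv f \<in> prod_closure"
  using assms
proof induction
  case (prod f g)
  have D: "((\<lambda>t. f t * g t) has_real_derivative (deriv f t * g t + f t * deriv g t)) (at t)" for t
    by (rule derivative_eq_intros smooth_real_has_derivative prod refl)+ simp
  then have "deriv (\<lambda>t. f t * g t) = (\<lambda>t. deriv f t * g t + f t * deriv g t)"
    by (intro ext DERIV_imp_deriv)
  with D show ?case
    using prod by (auto simp: real_differentiable_def intro!: prod_closure.intros smooth_real_deriv)
next
  case (sum f g)
  have D: "((\<lambda>t. f t + g t) has_real_derivative (deriv f t + deriv g t)) (at t)" for t
    using sum by (intro derivative_intros) (simp_all add: DERIV_deriv_iff_real_differentiable)
  then have "deriv (\<lambda>t. f t + g t) = (\<lambda>t. deriv f t + deriv g t)"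
    by (intro ext DERIV_imp_deriv)
  with D show ?case
    using sum by (auto simp: real_differentiable_def intro!: prod_closure.intros)
qed

lemma smooth_real_mult: "smooth_real f \<Longrightarrow> smooth_real g \<Longrightarrow> smooth_real (\<lambda>t. f t * g t)"
  by (rule smooth_real_coinduct[of _ prod_closure])
    (use prod_closure_deriv in \<open>auto intro: prod_closure.intros\<close>)

text \<open>The classical exp(-1/t), extended by 0, with a polynomial factor in 1/t. The polynomial
  is carried along because the family is then closed under differentiation.\<close>

definition flat :: "real poly \<Rightarrow> real \<Rightarrow> real" where
  "flat p t = (if t > 0 then poly p (1 / t) * exp (- (1 / t)) else 0)"

lemma poly_exp_decay: "((\<lambda>x. poly p x * exp (- x)) \<longlongrightarrow> 0) at_top" for p :: "real poly"
proof -
  have "((\<lambda>x. \<Sum>i\<le>degree p. coeff p i * (x ^ i / exp x)) \<longlongrightarrow> (\<Sum>i\<le>degree p. coeff p i * 0)) at_top"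
    by (intro tendsto_intros tendsto_power_div_exp_0)
  then show ?thesis
    by (simp add: poly_altdef exp_minus sum_distrib_right divide_inverse mult.assoc)
qed

lemma flat_tendsto_0: "(flat p \<longlongrightarrow> 0) (at 0)"
proof -
  have "((\<lambda>t. poly p (inverse t) * exp (- inverse t)) \<longlongrightarrow> 0) (at_right 0)"
    using filterlim_compose[OF poly_exp_decay filterlim_inverse_at_top_right] .
  then have "(flat p \<longlongrightarrow> 0) (at_right 0)"
    by (rule Lim_transform_eventually)
      (auto simp: flat_def eventually_at_right_less inverse_eq_divide intro!: eventually_at_rightI[of 0 1])
  moreover have "(flat p \<longlongrightarrow> 0) (at_left 0)"
    by (rule tendsto_eventually) (auto simp: flat_def intro!: eventually_at_leftI[of "-1"])
  ultimately show ?thesis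
    by (simp add: filterlim_split_at)
qed

text \<open>With s = 1/t one has ds/dt = -s^2, so p(s) exp(-s) has the derivative s^2 (p(s) - p'(s))
  exp(-s); \<open>[:0, 0, 1:]\<close> is the factor s^2.\<close>

lemma flat_derivative:
  "(flat p has_real_derivative flat ([:0, 0, 1:] * (p - pderiv p)) t) (at t)"
proof -
  consider "t > 0" | "t < 0" | "t = 0" by linarith
  then show ?thesis
  proof cases
    case 1
    have "((\<lambda>t. poly p (1 / t) * exp (- (1 / t))) has_real_derivative
            flat ([:0, 0, 1:] * (p - pderiv p)) t) (at t)"
      using 1 by (auto intro!: derivative_eq_intros DERIV_chain2[OF poly_DERIV]
          simp: flat_def field_simps power2_eq_square)
    then show ?thesis
      by (rule has_field_derivative_transform_within_open[of _ _ _ "{0<..}"])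
        (use 1 in \<open>auto simp: flat_def\<close>)
  next
    case 2
    have "((\<lambda>t. 0) has_real_derivative 0) (at t)" by simp
    then have "(flat p has_real_derivative 0) (at t)"
      by (rule has_field_derivative_transform_within_open[of _ _ _ "{..<0}"])
        (use 2 in \<open>auto simp: flat_def\<close>)
    with 2 show ?thesis by (simp add: flat_def)
  next
    case 3
    \<comment> \<open>For h \<noteq> 0 the quotient \<open>flat p h / h\<close> equals
      \<open>flat ([:0, 1:] * p) h\<close>, since dividing by h multiplies the polynomial by its
      variable 1/h. The derivative at 0 is thus another instance of
      \<open>flat_tendsto_0\<close>.\<close>
    have "((\<lambda>h. (flat p (0 + h) - flat p 0) / h) \<longlongrightarrow> 0) (at 0)"
      by (rule Lim_transform_eventually[OF flat_tendsto_0[of "[:0, 1:] * p"]])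
        (auto simp: flat_def field_simps eventually_at_filter)
    with 3 show ?thesis
      by (simp add: DERIV_def flat_def)
  qed
qed

lemma smooth_flat: "smooth_real (\<lambda>t. flat p (c * t + d))"
proof (rule smooth_real_coinduct[of _ "range (\<lambda>p t. flat p (c * t + d))"])
  have D: "((\<lambda>t. flat p (c * t + d)) has_real_derivative
      flat (smult c ([:0, 0, 1:] * (p - pderiv p))) (c * t + d)) (at t)" for t p
  proof -
    have "((\<lambda>t. c * t + d) has_real_derivative c) (at t)"
      by (auto intro!: derivative_eq_intros)
    moreover have "flat (smult c q) s = flat q s * c" for q s
      by (simp add: flat_def)
    ultimately show ?thesis
      using DERIV_chain2[OF flat_derivative] by metis
  qed
  show "f differentiable at t" if "f \<in> range (\<lambda>p t. flat p (c * t + d))" for f t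
    using that D by (auto simp: real_differentiable_def)
  show "deriv f \<in> range (\<lambda>p t. flat p (c * t + d))" if "f \<in> range (\<lambda>p t. flat p (c * t + d))" for f
  proof -
    from that obtain p where "f = (\<lambda>t. flat p (c * t + d))" by auto
    then have "deriv f = (\<lambda>t. flat (smult c ([:0, 0, 1:] * (p - pderiv p))) (c * t + d))"
      using D by (intro ext DERIV_imp_deriv) auto
    then show ?thesis by blast
  qed
qed auto

text \<open>The arguments are n(t - a) and n(b - t), written in the affine form that
  \<open>smooth_flat\<close> expects. Large n sharpens the bump: exp(-1/(n c)) tends to 1 for c > 0,
  so the pointwise limit is the indicator of the open interval.\<close>

definition bump :: "nat \<Rightarrow> real \<Rightarrow> real \<Rightarrow> real \<Rightarrow> real" where
  "bump n a b t = flat 1 (n * t + (- n * a)) * flat 1 ((- n) * t + n * b)"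

lemma smooth_bump: "smooth_real (bump n a b)"
  unfolding bump_def[abs_def] by (intro smooth_real_mult smooth_flat)

lemma flat_1_bounds: "0 \<le> flat 1 t" "flat 1 t \<le> 1"
  by (auto simp: flat_def)

lemma bump_bounds: "0 \<le> bump n a b t" "bump n a b t \<le> 1"
  unfolding bump_def by (auto intro!: mult_nonneg_nonneg mult_le_one flat_1_bounds)

lemma bump_eq_0:
  assumes "t \<notin> {a<..<b}" shows "bump n a b t = 0"
proof -
  consider "t \<le> a" | "b \<le> t" using assms by fastforce
  then have "n * t + (- n * a) \<le> 0 \<or> (- real n) * t + n * b \<le> 0"
    by cases (auto intro: mult_left_mono)
  then show ?thesis
    unfolding bump_def flat_def by auto
qed

lemma bump_tendsto: "(\<lambda>n. bump n a b t) \<longlonglongrightarrow> indicator {a<..<b} t"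
proof (cases "t \<in> {a<..<b}")
  case True
  have flat_lim: "(\<lambda>n. flat 1 (real n * c)) \<longlonglongrightarrow> 1" if "c > 0" for c
  proof -
    have "(\<lambda>n. 1 / real n) \<longlonglongrightarrow> 0" by (rule lim_1_over_n)
    then have "(\<lambda>n. exp (- (1 / real n / c))) \<longlonglongrightarrow> exp (- (0 / c))"
      using that by (intro tendsto_intros) auto
    then have "(\<lambda>n. exp (- (1 / real n / c))) \<longlonglongrightarrow> 1" by simp
    moreover have "\<forall>\<^sub>F n in sequentially. exp (- (1 / real n / c)) = flat 1 (real n * c)"
      using that by (intro eventually_sequentiallyI[of 1]) (simp add: flat_def)
    ultimately show ?thesis by (rule Lim_transform_eventually)
  qed
  have "(\<lambda>n. flat 1 (real n * (t - a)) * flat 1 (real n * (b - t))) \<longlonglongrightarrow> 1 * 1"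
    using True by (intro tendsto_mult flat_lim) auto
  then show ?thesis
    using True by (simp add: bump_def algebra_simps)
qed (simp add: bump_eq_0)

section \<open>Tensor products of bumps as test functions on \<real>^n\<close>

definition tensor :: "('n::finite \<Rightarrow> real \<Rightarrow> real) \<Rightarrow> real^'n \<Rightarrow> real" where
  "tensor b x = (\<Prod>i\<in>UNIV. b i (x $ i))"

lemma tensor_has_derivative:
  assumes "\<And>i. smooth_real (b i)"
  shows "(tensor b has_derivative
    (\<lambda>y. \<Sum>i\<in>UNIV. (y $ i * deriv (b i) (x $ i)) * (\<Prod>j\<in>UNIV - {i}. b j (x $ j)))) (at x)"
proof -
  have "((\<lambda>x. b i (x $ i)) has_derivative (\<lambda>y. y $ i * deriv (b i) (x $ i))) (at x)" for i
    using DERIV_compose_FDERIV[OF smooth_real_has_derivative[OF assms] bounded_linear_imp_has_derivative[OF bounded_linear_vec_nth]]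
    by blast
  then show ?thesis
    unfolding tensor_def[abs_def] by (intro has_derivative_prod) auto
qed

text \<open>A partial derivative hits a single factor, so tensors of smooth functions are closed
  under \<open>partial_deriv\<close>. Both \<open>C_k\<close> for every k and the commutation of
  partial derivatives reduce to updates of the family \<open>b\<close>.\<close>

lemma partial_deriv_tensor:
  assumes "\<And>i. smooth_real (b i)"
  shows "partial_deriv j (tensor b) = tensor (b(j := deriv (b j)))"
proof
  fix x
  have "partial_deriv j (tensor b) x
      = (\<Sum>i\<in>UNIV. (axis j 1 $ i * deriv (b i) (x $ i)) * (\<Prod>k\<in>UNIV - {i}. b k (x $ k)))"
    unfolding partial_deriv_def frechet_derivative_at[OF tensor_has_derivative[OF assms], symmetric]
    by simp
  also have "\<dots> = (\<Sum>i\<in>UNIV. if i = j then deriv (b j) (x $ j) * (\<Prod>k\<in>UNIV - {j}. b k (x $ k)) else 0)"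
    by (rule sum.cong) (auto simp: axis_def)
  also have "\<dots> = tensor (b(j := deriv (b j))) x"
    by (simp add: tensor_def prod.remove[of UNIV j])
  finally show "partial_deriv j (tensor b) x = tensor (b(j := deriv (b j))) x" .
qed

lemma smooth_real_upd:
  assumes "\<And>i. smooth_real (b i)" shows "smooth_real ((b(j := deriv (b j))) i)"
  using assms smooth_real_deriv by auto

lemma C_k_tensor:
  assumes "\<And>i. smooth_real (b i)" shows "C_k k (tensor b)"
  using assms
proof (induction k arbitrary: b)
  case 0
  then show ?case
    using tensor_has_derivative
    by (auto intro!: continuous_at_imp_continuous_on has_derivative_continuous)
next
  case (Suc k)
  have "C_k k (tensor (b(j := deriv (b j))))" for j
    using Suc.prems by (intro Suc.IH smooth_real_upd)
  moreover have "tensor b differentiable (at x)" for x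
    using tensor_has_derivative[of b x] Suc.prems unfolding differentiable_def by blast
  ultimately show ?case
    by (simp add: partial_deriv_tensor[OF Suc.prems] differentiable_on_def)
qed

text \<open>A family of test functions small enough to compute with and rich enough to approximate
  indicators of boxes. It is stable under translation, and its partial derivatives are again test
  functions and commute by inspection.\<close>

definition box_bumps :: "(real^'n::finite \<Rightarrow> real) set" where
  "box_bumps = {tensor (\<lambda>i. bump n (a $ i) (b $ i)) | n a b. True}"

lemma box_bumps_cases:
  assumes "\<psi> \<in> box_bumps"
  obtains b R where "\<psi> = tensor b" "\<And>i. smooth_real (b i)" "\<And>i t. \<bar>t\<bar> > R \<Longrightarrow> b i t = 0"
proof -
  obtain n a c where \<psi>: "\<psi> = tensor (\<lambda>i. bump n (a $ i) (c $ i))"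
    using assms by (auto simp: box_bumps_def)
  show ?thesis
  proof (rule that[OF \<psi>])
    fix i and t :: real
    assume "\<bar>t\<bar> > norm a + norm c"
    then show "bump n (a $ i) (c $ i) t = 0"
      using component_le_norm_cart[of a i] component_le_norm_cart[of c i]
      by (intro bump_eq_0) auto
  qed (rule smooth_bump)
qed

lemma deriv_eq_0_outside:
  assumes "\<And>t. \<bar>t\<bar> > R \<Longrightarrow> b t = 0" "\<bar>t\<bar> > R" shows "deriv b t = (0::real)"
proof -
  have "open {t::real. \<bar>t\<bar> > R}" by (intro open_Collect_less continuous_intros)
  then have "(b has_real_derivative 0) (at t)"
    using assms has_field_derivative_transform_within_open[of "\<lambda>_. 0" 0 t "{t. \<bar>t\<bar> > R}" b] by auto
  then show ?thesis by (rule DERIV_imp_deriv)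
qed

lemma tensor_eq_0_outside:
  assumes "\<And>i t. \<bar>t\<bar> > R \<Longrightarrow> b i t = 0" and "norm x > sqrt CARD('n) * \<bar>R\<bar>"
  shows "tensor b (x :: real^'n::finite) = 0"
proof -
  have "\<exists>i. \<bar>x $ i\<bar> > R"
  proof (rule ccontr)
    assume "\<not> ?thesis"
    then have "norm (x $ i) \<le> \<bar>R\<bar>" for i by (auto simp: not_less intro: order_trans)
    then have "norm x \<le> L2_set (\<lambda>i. \<bar>R\<bar>) (UNIV :: 'n set)"
      unfolding norm_vec_def by (intro L2_set_mono) auto
    also have "\<dots> = sqrt CARD('n) * \<bar>R\<bar>"
      by (simp add: L2_set_def real_sqrt_mult)
    finally show False using assms(2) by simp
  qed
  then show ?thesis
    unfolding tensor_def using assms(1) by (auto intro!: prod_zero)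
qed

lemma tensor_test:
  assumes "\<And>i. smooth_real (b i)" "\<And>i t. \<bar>t\<bar> > R \<Longrightarrow> b i t = 0"
  shows "tensor b \<in> test_functions"
proof -
  have "{x. tensor b x \<noteq> 0} \<subseteq> cball 0 (sqrt CARD('a) * \<bar>R\<bar>)"
    using tensor_eq_0_outside[OF assms(2)] by (force simp: not_less)
  then have "compact (closure {x. tensor b x \<noteq> 0})"
    by (meson bounded_cball bounded_subset compact_closure)
  then show ?thesis
    using C_k_tensor[OF assms(1)] by (auto simp: test_functions_def)
qed

lemma box_bumps_test: "\<psi> \<in> box_bumps \<Longrightarrow> \<psi> \<in> test_functions"
  by (erule box_bumps_cases) (auto intro: tensor_test)

lemma partial_deriv_box_bump_test:
  assumes "\<psi> \<in> box_bumps" shows "partial_deriv i \<psi> \<in> test_functions"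
proof -
  obtain b R where b: "\<psi> = tensor b" "\<And>i. smooth_real (b i)" "\<And>i t. \<bar>t\<bar> > R \<Longrightarrow> b i t = 0"
    using box_bumps_cases[OF assms] by metis
  show ?thesis
    unfolding b(1) partial_deriv_tensor[OF b(2)]
    by (rule tensor_test[of _ R]) (use b(2,3) deriv_eq_0_outside[OF b(3)] smooth_real_deriv in auto)
qed

lemma partial_deriv_box_bump_commute:
  assumes "\<psi> \<in> box_bumps"
  shows "partial_deriv i (partial_deriv j \<psi>) = partial_deriv j (partial_deriv i \<psi>)"
proof -
  obtain b R where b: "\<psi> = tensor b" "\<And>i. smooth_real (b i)" "\<And>i t. \<bar>t\<bar> > R \<Longrightarrow> b i t = 0"
    using box_bumps_cases[OF assms] by metis
  show ?thesis
    unfolding b(1) partial_deriv_tensor[OF b(2)] 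
    by (cases "i = j") (simp_all add: partial_deriv_tensor b(2) smooth_real_deriv fun_upd_twist)
qed

lemma test_function_continuous:
  assumes "\<psi> \<in> test_functions" shows "continuous_on UNIV \<psi>"
proof -
  have "C_k 0 \<psi>" using assms by (simp only: test_functions_def mem_Collect_eq)
  then show ?thesis by simp
qed

lemma test_function_bounded_support:
  assumes "\<psi> \<in> test_functions"
  obtains R where "R > 0" "\<And>x. norm x > R \<Longrightarrow> \<psi> x = 0"
proof -
  have "bounded {x. \<psi> x \<noteq> 0}"
    using assms bounded_subset[OF compact_imp_bounded closure_subset] by (auto simp: test_functions_def)
  then obtain R where "R > 0" "{x. \<psi> x \<noteq> 0} \<subseteq> cball 0 R"
    using bounded_subset_ballD[of _ 0] ball_subset_cball by (metis order_trans)
  then show ?thesis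
    by (intro that[of R]) auto
qed

section \<open>The fundamental lemma of the calculus of variations\<close>

lemma box_bump_tendsto:
  "(\<lambda>n. tensor (\<lambda>i. bump n (a $ i) (b $ i)) x) \<longlonglongrightarrow> indicator (box a b) (x :: real^'n::finite)"
proof -
  have "(\<lambda>n. tensor (\<lambda>i. bump n (a $ i) (b $ i)) x)
      \<longlonglongrightarrow> (\<Prod>i\<in>UNIV. indicator {a $ i<..<b $ i} (x $ i))"
    unfolding tensor_def by (intro tendsto_prod bump_tendsto)
  also have "(\<Prod>i\<in>UNIV. indicator {a $ i<..<b $ i} (x $ i)) = (indicator (box a b) x :: real)"
    by (auto simp: indicator_def mem_box_cart)
  finally show ?thesis .
qed

lemma box_bump_bounds:
  "0 \<le> tensor (\<lambda>i. bump n (a $ i) (b $ i)) x" 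
  "tensor (\<lambda>i. bump n (a $ i) (b $ i)) x \<le> indicator (cbox a b) (x :: real^'n::finite)"
proof -
  show "0 \<le> tensor (\<lambda>i. bump n (a $ i) (b $ i)) x"
    unfolding tensor_def by (intro prod_nonneg ballI bump_bounds)
  show "tensor (\<lambda>i. bump n (a $ i) (b $ i)) x \<le> indicator (cbox a b) x"
  proof (cases "x \<in> cbox a b")
    case True
    then show ?thesis
      unfolding tensor_def by (auto intro!: prod_le_1 bump_bounds)
  next
    case False
    then obtain i where "x $ i \<notin> {a $ i<..<b $ i}"
      unfolding mem_box_cart by (meson greaterThanLessThan_iff less_imp_le)
    then have "tensor (\<lambda>i. bump n (a $ i) (b $ i)) x = 0"
      unfolding tensor_def by (auto intro!: prod_zero bump_eq_0)
    with False show ?thesis by simp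
  qed
qed

text \<open>The positive and negative parts of \<open>f\<close> are the densities of two measures
  that agree on open boxes. Open boxes form an intersection-stable generator of the Borel sets, so
  the measures coincide, and densities with respect to a sigma-finite measure are unique almost
  everywhere.\<close>

lemma AE_zero_if_box_integrals_zero:
  fixes f :: "'a::euclidean_space \<Rightarrow> real"
  assumes f [measurable]: "f \<in> borel_measurable borel"
    and int: "\<And>a b. set_integrable lborel (cbox a b) f"
    and zero: "\<And>a b. (\<integral>x\<in>box a b. f x \<partial>lborel) = 0"
  shows "AE x in lborel. f x = 0"
proof -
  define P N where "P x = ennreal (f x)" and "N x = ennreal (- f x)" for x
  have [measurable]: "P \<in> borel_measurable borel" "N \<in> borel_measurable borel"
    unfolding P_def N_def by measurable
  have intb: "set_integrable lborel (box a b) f" for a b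
    by (rule set_integrable_subset[OF int[of a b]]) (auto simp: box_subset_cbox)
  have eq: "emeasure (density lborel P) (box a b) = ennreal (\<integral>x\<in>box a b. max 0 (f x) \<partial>lborel)"
    "emeasure (density lborel N) (box a b) = ennreal (\<integral>x\<in>box a b. max 0 (- f x) \<partial>lborel)"
    and pm: "(\<integral>x\<in>box a b. max 0 (f x) \<partial>lborel) = (\<integral>x\<in>box a b. max 0 (- f x) \<partial>lborel)" for a b
  proof -
    have i: "set_integrable lborel (box a b) (\<lambda>x. max 0 (f x))"
      "set_integrable lborel (box a b) (\<lambda>x. max 0 (- f x))"
      by (rule set_integrable_bound[OF intb[of a b]]; force simp: set_borel_measurable_def)+
    show "emeasure (density lborel P) (box a b) = ennreal (\<integral>x\<in>box a b. max 0 (f x) \<partial>lborel)"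
      "emeasure (density lborel N) (box a b) = ennreal (\<integral>x\<in>box a b. max 0 (- f x) \<partial>lborel)"
      using i unfolding set_integrable_def set_lebesgue_integral_def
      by (subst emeasure_density nn_integral_eq_integral[symmetric];
          auto intro!: nn_integral_cong simp: P_def N_def indicator_def max_def ennreal_neg)+
    have "(\<integral>x\<in>box a b. max 0 (f x) \<partial>lborel) - (\<integral>x\<in>box a b. max 0 (- f x) \<partial>lborel)
        = (\<integral>x\<in>box a b. max 0 (f x) - max 0 (- f x) \<partial>lborel)"
      using set_integral_diff(2)[OF i] by simp
    also have "(\<lambda>x. max 0 (f x) - max 0 (- f x)) = f" by auto
    finally show "(\<integral>x\<in>box a b. max 0 (f x) \<partial>lborel) = (\<integral>x\<in>box a b. max 0 (- f x) \<partial>lborel)"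
      using zero by simp
  qed
  have "density lborel P = density lborel N"
  proof (rule measure_eqI_generator_eq[where E = "range (\<lambda>(a, b). box a b)" and \<Omega> = UNIV
        and A = "\<lambda>n. box (- (real n *\<^sub>R One)) (real n *\<^sub>R One)"])
    show "Int_stable (range (\<lambda>(a::'a, b). box a b))"
      by (auto simp: Int_stable_def box_Int_box)
    show "sets (density lborel P) = sigma_sets UNIV (range (\<lambda>(a, b). box a b))"
      "sets (density lborel N) = sigma_sets UNIV (range (\<lambda>(a, b). box a b))"
      by (simp_all add: borel_eq_box)
    show "(\<Union>n. box (- (real n *\<^sub>R One)) (real n *\<^sub>R One)) = (UNIV :: 'a set)"
      using UN_box_eq_UNIV by blast
  qed (auto simp: eq pm)
  then have "AE x in lborel. P x = N x"
    by (intro sigma_finite_measure.density_unique sigma_finite_lborel) auto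
  then show ?thesis
  proof (eventually_elim)
    fix x assume "P x = N x"
    then show "f x = 0"
      unfolding P_def N_def by (cases "f x \<ge> 0") (auto simp: ennreal_neg ennreal_eq_0_iff)
  qed
qed

text \<open>Box bumps increase in sharpness to the indicator of an open box and stay below that of
  the closed box, so |f| on the closed box dominates and the integrals of \<open>f\<close> over open
  boxes vanish.\<close>

lemma fundamental_lemma:
  fixes f :: "real^'n::finite \<Rightarrow> real"
  assumes f [measurable]: "f \<in> borel_measurable borel"
    and int: "\<And>K. compact K \<Longrightarrow> set_integrable lborel K f"
    and zero: "\<And>\<psi>. \<psi> \<in> box_bumps \<Longrightarrow> (LBINT x. f x * \<psi> x) = 0"
  shows "AE x in lborel. f x = 0"
proof (rule AE_zero_if_box_integrals_zero[OF f])
  fix a b :: "real^'n"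
  let ?\<psi> = "\<lambda>n. tensor (\<lambda>i. bump n (a $ i) (b $ i))"
  have [measurable]: "?\<psi> n \<in> borel_measurable borel" for n
    by (intro borel_measurable_continuous_onI test_function_continuous box_bumps_test)
      (auto simp: box_bumps_def)
  have "(\<lambda>n. LBINT x. f x * ?\<psi> n x) \<longlonglongrightarrow> (LBINT x. f x * indicator (box a b) x)"
  proof (rule integral_dominated_convergence)
    show "integrable lborel (\<lambda>x. \<bar>indicator (cbox a b) x * f x\<bar>)"
      using int[of "cbox a b"] by (auto simp: set_integrable_def)
    show "AE x in lborel. (\<lambda>n. f x * ?\<psi> n x) \<longlonglongrightarrow> f x * indicator (box a b) x"
      by (intro AE_I2 tendsto_intros box_bump_tendsto)
    show "AE x in lborel. norm (f x * ?\<psi> n x) \<le> \<bar>indicator (cbox a b) x * f x\<bar>" for n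
      using box_bump_bounds[of n a b]
      by (auto intro!: AE_I2 mult_left_mono simp: abs_mult mult.commute[of _ "\<bar>f _\<bar>"])
  qed measurable
  moreover have "(LBINT x. f x * ?\<psi> n x) = 0" for n
    by (intro zero) (auto simp: box_bumps_def)
  ultimately show "(\<integral>x\<in>box a b. f x \<partial>lborel) = 0"
    by (simp add: LIMSEQ_const_iff set_lebesgue_integral_def mult.commute)
qed (simp add: int)

section \<open>Locally square integrable functions and translations\<close>

definition bounded_support :: "('a::euclidean_space \<Rightarrow> real) \<Rightarrow> bool" where
  "bounded_support f \<longleftrightarrow> bounded {x. f x \<noteq> 0}"

definition locally_bounded :: "('a::euclidean_space \<Rightarrow> real) \<Rightarrow> bool" where
  "locally_bounded f \<longleftrightarrow> (\<forall>R. \<exists>M. \<forall>x\<in>cball 0 R. \<bar>f x\<bar> \<le> M)"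

text \<open>The analysis runs on Borel functions and \<open>lborel\<close>, where Fubini and
  translation invariance apply directly; the spaces over \<open>lebesgue\<close> are connected to it
  at the end through Borel representatives. Balls about 0 suffice as compact sets.\<close>

definition L2loc :: "('a::euclidean_space \<Rightarrow> real) \<Rightarrow> bool" where
  "L2loc f \<longleftrightarrow> f \<in> borel_measurable borel \<and>
     (\<forall>R. integrable lborel (\<lambda>x. indicator (cball 0 R) x * (f x)\<^sup>2))"

lemma cball_borel [measurable]: "cball a R \<in> sets borel"
  by (simp add: borel_closed)

lemma bounded_supportE:
  assumes "bounded_support f"
  obtains R where "R > 0" "\<And>x. norm x > R \<Longrightarrow> f x = 0"
proof -
  obtain R where "R > 0" "{x. f x \<noteq> 0} \<subseteq> ball 0 R"
    using assms bounded_subset_ballD[of _ 0] unfolding bounded_support_def by blast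
  then show ?thesis by (intro that[of R]) auto
qed

lemma bounded_supportI:
  assumes "\<And>x. norm x > R \<Longrightarrow> f x = 0" shows "bounded_support f"
  unfolding bounded_support_def
  by (rule bounded_subset[OF bounded_cball[of 0 R]]) (use assms in force)

lemma bounded_support_mult:
  "bounded_support f \<Longrightarrow> bounded_support (\<lambda>x. f x * g x)"
  "bounded_support f \<Longrightarrow> bounded_support (\<lambda>x. g x * f x)"
  unfolding bounded_support_def by (erule bounded_subset; force)+

lemma bounded_support_shift:
  fixes f :: "'a::euclidean_space \<Rightarrow> real"
  assumes "bounded_support f" shows "bounded_support (\<lambda>x. f (x + a))"
proof -
  obtain R where R: "\<And>x. norm x > R \<Longrightarrow> f x = 0"
    using bounded_supportE[OF assms] by blast
  show ?thesis
  proof (rule bounded_supportI)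
    fix x :: 'a assume "norm x > R + norm a"
    then show "f (x + a) = 0"
      using norm_diff_ineq[of x a] by (intro R) auto
  qed
qed

lemma locally_bounded_continuous:
  assumes "continuous_on UNIV f" shows "locally_bounded f"
  unfolding locally_bounded_def
proof
  fix R
  have "bounded (f ` cball 0 R)"
    using assms by (intro compact_imp_bounded compact_continuous_image) (auto intro: continuous_on_subset)
  then show "\<exists>M. \<forall>x\<in>cball 0 R. \<bar>f x\<bar> \<le> M"
    by (auto simp: bounded_iff)
qed

lemma bounded_support_locally_bounded:
  assumes "bounded_support f" "locally_bounded f"
  obtains M where "\<And>x. \<bar>f x\<bar> \<le> M"
proof -
  obtain R where R: "\<And>x. norm x > R \<Longrightarrow> f x = 0"
    using bounded_supportE[OF assms(1)] by blast
  obtain M where M: "\<forall>x\<in>cball 0 R. \<bar>f x\<bar> \<le> M"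
    using assms(2) by (auto simp: locally_bounded_def)
  show ?thesis
  proof (rule that[of "max M 0"])
    fix x show "\<bar>f x\<bar> \<le> max M 0"
      using M R[of x] by (cases "norm x > R") (auto simp: not_less le_max_iff_disj)
  qed
qed

lemma L2loc_measurable: "L2loc f \<Longrightarrow> f \<in> borel_measurable borel"
  by (simp add: L2loc_def)

lemma integrable_indicator_cball: "integrable lborel (indicator (cball a R) :: 'a::euclidean_space \<Rightarrow> real)"
  using emeasure_lborel_cball_finite[of a R] by (auto simp: integrable_indicator_iff)

lemma L2loc_mult_locally_bounded:
  assumes f: "L2loc f" and \<psi>: "\<psi> \<in> borel_measurable borel" "locally_bounded \<psi>"
  shows "L2loc (\<lambda>x. f x * \<psi> x)" "L2loc (\<lambda>x. \<psi> x * f x)"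
proof -
  note [measurable] = L2loc_measurable[OF f] \<psi>(1)
  show "L2loc (\<lambda>x. f x * \<psi> x)"
    unfolding L2loc_def
  proof (intro conjI allI)
    fix R
    obtain M where M: "\<forall>x\<in>cball 0 R. \<bar>\<psi> x\<bar> \<le> M"
      using \<psi>(2) by (auto simp: locally_bounded_def)
    have "integrable lborel (\<lambda>x. M\<^sup>2 * (indicator (cball 0 R) x * (f x)\<^sup>2))"
      using f by (intro integrable_mult_right) (auto simp: L2loc_def)
    then show "integrable lborel (\<lambda>x. indicator (cball 0 R) x * (f x * \<psi> x)\<^sup>2)"
    proof (rule Bochner_Integration.integrable_bound)
      have "(f x * \<psi> x)\<^sup>2 \<le> M\<^sup>2 * (f x)\<^sup>2" if "x \<in> cball 0 R" for x
      proof -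
        have "(\<psi> x)\<^sup>2 \<le> M\<^sup>2" using M that by (metis abs_ge_zero abs_le_square_iff abs_of_nonneg order_trans)
        then show ?thesis by (simp add: power_mult_distrib mult.commute mult_right_mono)
      qed
      then show "AE x in lborel. norm (indicator (cball 0 R) x * (f x * \<psi> x)\<^sup>2)
          \<le> norm (M\<^sup>2 * (indicator (cball 0 R) x * (f x)\<^sup>2))"
        by (intro AE_I2) (auto simp: indicator_def)
    qed measurable
  qed measurable
  then show "L2loc (\<lambda>x. \<psi> x * f x)" by (simp add: mult.commute)
qed

lemma L2loc_add:
  assumes "L2loc f" "L2loc g" shows "L2loc (\<lambda>x. f x + g x)"
proof -
  note [measurable] = assms[THEN L2loc_measurable]
  show ?thesis
    unfolding L2loc_def
  proof (intro conjI allI)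
    fix R
    have "integrable lborel (\<lambda>x. 2 * (indicator (cball 0 R) x * (f x)\<^sup>2) + 2 * (indicator (cball 0 R) x * (g x)\<^sup>2))"
      using assms by (intro Bochner_Integration.integrable_add integrable_mult_right) (auto simp: L2loc_def)
    then show "integrable lborel (\<lambda>x. indicator (cball 0 R) x * (f x + g x)\<^sup>2)"
    proof (rule Bochner_Integration.integrable_bound)
      have "(a + b)\<^sup>2 \<le> 2 * a\<^sup>2 + 2 * b\<^sup>2" for a b :: real
        using sum_squares_bound[of a b] by (simp add: power2_sum)
      then show "AE x in lborel. norm (indicator (cball 0 R) x * (f x + g x)\<^sup>2)
        \<le> norm (2 * (indicator (cball 0 R) x * (f x)\<^sup>2) + 2 * (indicator (cball 0 R) x * (g x)\<^sup>2))"
        by (intro AE_I2) (auto simp: indicator_def)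
    qed measurable
  qed measurable
qed

lemma L2loc_locally_bounded:
  assumes "f \<in> borel_measurable borel" "locally_bounded f" shows "L2loc f"
proof -
  have "L2loc (\<lambda>x. 1)"
    using integrable_indicator_cball by (auto simp: L2loc_def)
  from L2loc_mult_locally_bounded(1)[OF this assms] show ?thesis by simp
qed

lemma L2loc_continuous: "continuous_on UNIV f \<Longrightarrow> L2loc f"
  by (intro L2loc_locally_bounded locally_bounded_continuous borel_measurable_continuous_onI)

lemma L2loc_cmult: "L2loc f \<Longrightarrow> L2loc (\<lambda>x. c * f x)"
  by (rule L2loc_mult_locally_bounded(2)) (auto intro: locally_bounded_continuous)

lemma L2loc_diff: "L2loc f \<Longrightarrow> L2loc g \<Longrightarrow> L2loc (\<lambda>x. f x - g x)"
  using L2loc_add[of f "\<lambda>x. (-1) * g x"] L2loc_cmult[of g "-1"] by simp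

lemma L2loc_sum: "(\<And>i. i \<in> I \<Longrightarrow> L2loc (f i)) \<Longrightarrow> L2loc (\<lambda>x. \<Sum>i\<in>I. f i x)"
proof (induction I rule: infinite_finite_induct)
  case (insert i I)
  then show ?case using L2loc_add[of "f i" "\<lambda>x. \<Sum>i\<in>I. f i x"] by simp
qed (auto intro: L2loc_continuous)

lemma L2loc_AE_eq:
  assumes "L2loc f" "g \<in> borel_measurable borel" "AE x in lborel. f x = g x"
  shows "L2loc g"
proof -
  note [measurable] = L2loc_measurable[OF assms(1)] assms(2)
  have "integrable lborel (\<lambda>x. indicator (cball 0 R) x * (g x)\<^sup>2)" for R
  proof (subst integrable_cong_AE)
    show "AE x in lborel. indicator (cball 0 R) x * (g x)\<^sup>2 = indicator (cball 0 R) x * (f x)\<^sup>2"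
      using assms(3) by eventually_elim simp
    show "integrable lborel (\<lambda>x. indicator (cball 0 R) x * (f x)\<^sup>2)"
      using assms(1) by (simp add: L2loc_def)
  qed measurable
  then show ?thesis by (simp add: L2loc_def assms(2))
qed

lemma integrable_L2loc_mult:
  assumes f: "L2loc f" and g: "L2loc g" "bounded_support g"
  shows "integrable lborel (\<lambda>x. f x * g x)"
proof -
  note [measurable] = f[THEN L2loc_measurable] g(1)[THEN L2loc_measurable]
  obtain R where R: "\<And>x. norm x > R \<Longrightarrow> g x = 0"
    using bounded_supportE[OF g(2)] by blast
  have "integrable lborel (\<lambda>x. indicator (cball 0 R) x * (f x)\<^sup>2 + indicator (cball 0 R) x * (g x)\<^sup>2)"
    using f g by (intro Bochner_Integration.integrable_add) (auto simp: L2loc_def)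
  then show ?thesis
  proof (rule Bochner_Integration.integrable_bound)
    have "\<bar>a * b\<bar> \<le> a\<^sup>2 + b\<^sup>2" for a b :: real
      using sum_squares_bound[of "\<bar>a\<bar>" "\<bar>b\<bar>"] abs_ge_zero[of "a * b"]
      unfolding abs_mult power2_abs by linarith
    then have "\<bar>f x * g x\<bar> \<le> indicator (cball 0 R) x * (f x)\<^sup>2 + indicator (cball 0 R) x * (g x)\<^sup>2" for x
      using R[of x] by (cases "norm x > R") auto
    then show "AE x in lborel. norm (f x * g x)
        \<le> norm (indicator (cball 0 R) x * (f x)\<^sup>2 + indicator (cball 0 R) x * (g x)\<^sup>2)"
      by (intro AE_I2) (auto intro: order_trans)
  qed measurable
qed

lemma L2loc_integrable_square:
  "L2loc f \<Longrightarrow> bounded_support f \<Longrightarrow> integrable lborel (\<lambda>x. (f x)\<^sup>2)"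
  using integrable_L2loc_mult[of f f] by (simp add: power2_eq_square)

lemma locally_bounded_indicator: "locally_bounded (indicator A)"
  by (auto simp: locally_bounded_def indicator_def intro: exI[of _ 1])

lemma L2loc_set_integrable:
  assumes "L2loc f" "compact K" shows "set_integrable lborel K f"
proof -
  have "integrable lborel (\<lambda>x. f x * indicator K x)"
  proof (rule integrable_L2loc_mult[OF assms(1)])
    show "L2loc (indicator K)"
      using assms(2) by (intro L2loc_locally_bounded locally_bounded_indicator borel_measurable_indicator)
        (simp add: borel_compact)
    show "bounded_support (indicator K)"
      using assms(2) by (auto simp: bounded_support_def indicator_def compact_imp_bounded)
  qed
  then show ?thesis by (simp add: set_integrable_def mult.commute)
qed

lemma lborel_integral_shift:
  fixes f :: "'a::euclidean_space \<Rightarrow> real"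
  assumes "f \<in> borel_measurable borel"
  shows "(LBINT x. f (x + a)) = (LBINT x. f x)"
  using integral_distr[of "(+) a" lborel borel f] assms lborel_distr_plus[of a]
  by (simp add: add.commute)

lemma lborel_integrable_shift:
  fixes f :: "'a::euclidean_space \<Rightarrow> real"
  assumes "f \<in> borel_measurable borel"
  shows "integrable lborel (\<lambda>x. f (x + a)) \<longleftrightarrow> integrable lborel f"
  using integrable_distr_eq[of "(+) a" lborel borel f] assms lborel_distr_plus[of a]
  by (simp add: add.commute)

lemma L2loc_shift:
  assumes "L2loc f" shows "L2loc (\<lambda>x. f (x + a))"
proof -
  note [measurable] = L2loc_measurable[OF assms]
  show ?thesis
    unfolding L2loc_def
  proof (intro conjI allI)
    fix R
    have "integrable lborel (\<lambda>x. indicator (cball 0 (R + norm a)) x * (f x)\<^sup>2)"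
      using assms by (simp add: L2loc_def)
    then have "integrable lborel (\<lambda>x. indicator (cball 0 (R + norm a)) (x + a) * (f (x + a))\<^sup>2)"
      by (subst lborel_integrable_shift[of "\<lambda>x. indicator (cball 0 (R + norm a)) x * (f x)\<^sup>2" a]) measurable
    then show "integrable lborel (\<lambda>x. indicator (cball 0 R) x * (f (x + a))\<^sup>2)"
      by (rule Bochner_Integration.integrable_bound)
        (auto simp: indicator_def intro!: AE_I2 order_trans[OF norm_triangle_ineq])
  qed measurable
qed

text \<open>One bound serves all translations of length at most \<open>B\<close>; this uniformity
  supplies the majorants whenever a translation tends to 0.\<close>

lemma L2loc_shift_bound:
  assumes "L2loc f" and "norm a \<le> B"
  shows "(LBINT x. indicator (cball 0 R) x * (f (x + a))\<^sup>2)
    \<le> (LBINT x. indicator (cball 0 (R + B)) x * (f x)\<^sup>2)"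
proof -
  note [measurable] = L2loc_measurable[OF assms(1)]
  let ?F = "\<lambda>x. indicator (cball 0 (R + B)) x * (f x)\<^sup>2"
  have i: "integrable lborel ?F" using assms by (simp add: L2loc_def)
  have "(LBINT x. indicator (cball 0 R) x * (f (x + a))\<^sup>2) \<le> (LBINT x. ?F (x + a))"
  proof (rule integral_mono)
    show "integrable lborel (\<lambda>x. indicator (cball 0 R) x * (f (x + a))\<^sup>2)"
      using L2loc_shift[OF assms(1)] by (simp add: L2loc_def)
    show "integrable lborel (\<lambda>x. ?F (x + a))"
      using i by (subst lborel_integrable_shift[of ?F a]) measurable
    show "indicator (cball 0 R) x * (f (x + a))\<^sup>2 \<le> ?F (x + a)" for x
    proof (cases "x \<in> cball 0 R")
      case True
      then have "norm (x + a) \<le> R + B"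
        using assms(2) norm_triangle_ineq[of x a] by simp
      with True show ?thesis by simp
    qed simp
  qed
  also have "\<dots> = (LBINT x. ?F x)"
    by (rule lborel_integral_shift) measurable
  finally show ?thesis .
qed

section \<open>L^2 estimates, approximation by continuous functions, continuity of
  translations\<close>

lemma abs_mult_weighted_bound:
  fixes a b d :: real assumes "d > 0" shows "\<bar>a * b\<bar> \<le> d * a\<^sup>2 + b\<^sup>2 / d"
proof -
  have "2 * (sqrt d * \<bar>a\<bar>) * (\<bar>b\<bar> / sqrt d) \<le> (sqrt d * \<bar>a\<bar>)\<^sup>2 + (\<bar>b\<bar> / sqrt d)\<^sup>2"
    by (rule sum_squares_bound)
  then have "2 * \<bar>a * b\<bar> \<le> d * a\<^sup>2 + b\<^sup>2 / d"
    using assms by (simp add: power_mult_distrib power_divide abs_mult)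
  then show ?thesis using abs_ge_zero[of "a * b"] by linarith
qed

text \<open>Weighted Young inequality in the role of Cauchy-Schwarz. The free weight
  \<open>d\<close> makes the term in \<open>f\<close> small, at the price of 1/d on a term in
  \<open>g\<close> that is smaller still; both later uses choose it in this way.\<close>

lemma L2_integral_bound:
  assumes f: "L2loc f" and g: "L2loc g" "\<And>x. norm x > R \<Longrightarrow> g x = 0" and "d > 0"
  shows "\<bar>LBINT x. f x * g x\<bar>
    \<le> d * (LBINT x. indicator (cball 0 R) x * (f x)\<^sup>2) + (LBINT x. (g x)\<^sup>2) / d"
proof -
  have gs: "bounded_support g" using g(2) by (rule bounded_supportI)
  have i: "integrable lborel (\<lambda>x. indicator (cball 0 R) x * (f x)\<^sup>2)" "integrable lborel (\<lambda>x. (g x)\<^sup>2)"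
    using f L2loc_integrable_square[OF g(1) gs] by (auto simp: L2loc_def)
  have "\<bar>LBINT x. f x * g x\<bar> \<le> (LBINT x. \<bar>f x * g x\<bar>)"
    by (rule integral_abs_bound)
  also have "\<dots> \<le> (LBINT x. d * (indicator (cball 0 R) x * (f x)\<^sup>2) + (g x)\<^sup>2 / d)"
  proof (rule integral_mono)
    show "integrable lborel (\<lambda>x. \<bar>f x * g x\<bar>)"
      using integrable_L2loc_mult[OF f g(1) gs] by simp
    show "\<bar>f x * g x\<bar> \<le> d * (indicator (cball 0 R) x * (f x)\<^sup>2) + (g x)\<^sup>2 / d" for x
      using abs_mult_weighted_bound[OF \<open>d > 0\<close>, of "f x" "g x"] g(2)[of x]
      by (cases "norm x > R") auto
  qed (use i in auto)
  also have "\<dots> = d * (LBINT x. indicator (cball 0 R) x * (f x)\<^sup>2) + (LBINT x. (g x)\<^sup>2) / d"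
    using i by simp
  finally show ?thesis .
qed

text \<open>Two reductions by dominated convergence: first the values are truncated at level k, with
  majorant w^2; then the truncated function, bounded and of bounded support, is approximated almost
  everywhere by continuous functions, which are truncated and cut off likewise so that a constant on
  a ball is a majorant.\<close>

lemma L2_approx_continuous:
  fixes w :: "'a::euclidean_space \<Rightarrow> real"
  assumes w: "L2loc w" "\<And>x. norm x > R \<Longrightarrow> w x = 0" and "e > 0"
  obtains h where "continuous_on UNIV h" "\<And>x. norm x > R + 1 \<Longrightarrow> h x = 0"
    "(LBINT x. (w x - h x)\<^sup>2) < e"
proof -
  note [measurable] = L2loc_measurable[OF w(1)]
  define clamp where "clamp k t = max (- real k) (min (real k) t)" for k t
  define cut where "cut x = max 0 (min 1 (R + 1 - norm x))" for x :: 'a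
  have w2: "integrable lborel (\<lambda>x. (w x)\<^sup>2)"
    using w by (intro L2loc_integrable_square bounded_supportI)
  have clamp_meas [measurable]: "clamp k \<in> borel_measurable borel" for k
    unfolding clamp_def[abs_def] by measurable
  have "(\<lambda>k. LBINT x. (w x - clamp k (w x))\<^sup>2) \<longlonglongrightarrow> (\<integral>x. 0 \<partial>(lborel :: 'a measure))"
  proof (rule integral_dominated_convergence)
    show "integrable lborel (\<lambda>x. (w x)\<^sup>2)" by (rule w2)
    have "(\<lambda>k. (w x - clamp k (w x))\<^sup>2) \<longlonglongrightarrow> 0" for x
    proof (rule tendsto_eventually)
      obtain N where "\<bar>w x\<bar> \<le> real N" using real_arch_simple by blast
      then show "\<forall>\<^sub>F k in sequentially. (w x - clamp k (w x))\<^sup>2 = 0"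
        by (intro eventually_sequentiallyI[of N]) (auto simp: clamp_def)
    qed
    then show "AE x in lborel. (\<lambda>k. (w x - clamp k (w x))\<^sup>2) \<longlonglongrightarrow> 0" by simp
    have "\<bar>t - clamp k t\<bar> \<le> \<bar>t\<bar>" for k t by (auto simp: clamp_def)
    then show "AE x in lborel. norm ((w x - clamp k (w x))\<^sup>2) \<le> (w x)\<^sup>2" for k
      by (auto intro!: AE_I2 simp: abs_le_square_iff[symmetric])
  qed measurable
  then have "\<forall>\<^sub>F k in sequentially. (LBINT x. (w x - clamp k (w x))\<^sup>2) < e / 4"
    using \<open>e > 0\<close> by (intro order_tendstoD(2)) auto
  then obtain k where k: "(LBINT x. (w x - clamp k (w x))\<^sup>2) < e / 4"
    by (auto simp: eventually_sequentially)
  \<comment> \<open>\<open>measurable_on\<close> describes a measurable function as a pointwise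
    limit of continuous functions off a negligible set; it is the source of the approximants
    \<open>g n\<close>.\<close>
  have "w \<in> borel_measurable lebesgue" by (simp add: measurable_completion)
  then have "w measurable_on UNIV"
    by (subst measurable_on_iff_borel_measurable) (auto simp: lebesgue_on_UNIV_eq)
  then obtain N g where N: "negligible N" and g: "\<And>n. continuous_on UNIV (g n)"
    and lim: "\<And>x. x \<notin> N \<Longrightarrow> (\<lambda>n. g n x) \<longlonglongrightarrow> w x"
    by (auto simp: measurable_on_def)
  define h where "h n x = cut x * clamp k (g n x)" for n x
  have clamp_cont: "isCont (clamp k) t" for t
    unfolding clamp_def by (intro continuous_intros)
  have h_cont: "continuous_on UNIV (h n)" for n
    unfolding h_def cut_def clamp_def by (intro continuous_intros g)
  have h_meas [measurable]: "h n \<in> borel_measurable borel" for n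
    using h_cont by (rule borel_measurable_continuous_onI)
  have cut01: "0 \<le> cut x" "cut x \<le> 1" for x by (auto simp: cut_def)
  have cw: "clamp k (w x) = cut x * clamp k (w x)" for x
  proof (cases "norm x > R")
    case True
    then have "clamp k (w x) = 0" using w(2) by (simp add: clamp_def)
    then show ?thesis by simp
  qed (simp add: cut_def)
  have hb: "(clamp k (w x) - h n x)\<^sup>2 \<le> (2 * real k)\<^sup>2 * indicator (cball 0 (R + 1)) x" for n x
  proof (cases "norm x > R + 1")
    case True
    then show ?thesis by (subst cw) (simp add: h_def cut_def)
  next
    case False
    have "\<bar>clamp k s - clamp k t\<bar> \<le> 2 * real k" for s t by (auto simp: clamp_def)
    then have "cut x * \<bar>clamp k (w x) - clamp k (g n x)\<bar> \<le> 1 * (2 * real k)"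
      using cut01 by (intro mult_mono) auto
    then have "\<bar>clamp k (w x) - h n x\<bar> \<le> \<bar>2 * real k\<bar>"
      by (subst cw) (simp add: h_def right_diff_distrib[symmetric] abs_mult cut01)
    then have "(clamp k (w x) - h n x)\<^sup>2 \<le> (2 * real k)\<^sup>2"
      by (simp only: abs_le_square_iff)
    then show ?thesis using False by simp
  qed
  have "(\<lambda>n. LBINT x. (clamp k (w x) - h n x)\<^sup>2) \<longlonglongrightarrow> (\<integral>x. 0 \<partial>(lborel :: 'a measure))"
  proof (rule integral_dominated_convergence)
    show "integrable lborel (\<lambda>x. (2 * real k)\<^sup>2 * indicator (cball 0 (R + 1)) x)"
      by (intro integrable_mult_right integrable_indicator_cball)
    have "(\<lambda>n. (clamp k (w x) - h n x)\<^sup>2) \<longlonglongrightarrow> 0" if "x \<notin> N" for x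
    proof -
      have "(\<lambda>n. (clamp k (w x) - h n x)\<^sup>2) \<longlonglongrightarrow> (clamp k (w x) - cut x * clamp k (w x))\<^sup>2"
        unfolding h_def
        by (intro tendsto_intros isCont_tendsto_compose[OF clamp_cont] lim that)
      then show ?thesis by (simp only: cw[symmetric]) simp
    qed
    then have "AE x in lebesgue. (\<lambda>n. (clamp k (w x) - h n x)\<^sup>2) \<longlonglongrightarrow> 0"
      using N by (intro AE_I'[of N]) (auto simp: negligible_iff_null_sets)
    then show "AE x in lborel. (\<lambda>n. (clamp k (w x) - h n x)\<^sup>2) \<longlonglongrightarrow> 0"
      by (simp add: AE_completion_iff)
    show "AE x in lborel. norm ((clamp k (w x) - h n x)\<^sup>2) \<le> (2 * real k)\<^sup>2 * indicator (cball 0 (R + 1)) x" for n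
      using hb by auto
  qed measurable
  then have "\<forall>\<^sub>F n in sequentially. (LBINT x. (clamp k (w x) - h n x)\<^sup>2) < e / 4"
    using \<open>e > 0\<close> by (intro order_tendstoD(2)) auto
  then obtain n where n: "(LBINT x. (clamp k (w x) - h n x)\<^sup>2) < e / 4"
    by (auto simp: eventually_sequentially)
  show ?thesis
  proof (rule that[OF h_cont[of n]])
    show h0: "h n x = 0" if "norm x > R + 1" for x
      using that by (simp add: h_def cut_def)
    have i1: "integrable lborel (\<lambda>x. (w x - clamp k (w x))\<^sup>2)"
      by (rule Bochner_Integration.integrable_bound[OF w2])
        (auto intro!: AE_I2 simp: clamp_def abs_le_square_iff[symmetric])
    have i2: "integrable lborel (\<lambda>x. (clamp k (w x) - h n x)\<^sup>2)"
      by (rule Bochner_Integration.integrable_bound[OF integrable_mult_right[OF integrable_indicator_cball[of 0 "R+1"], of "(2 * real k)\<^sup>2"]])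
        (use hb in auto)
    \<comment> \<open>The factors 2 explain the tolerances e/4 above: 2 (e/4) + 2 (e/4) = e.\<close>
    have ab: "(a - c)\<^sup>2 \<le> 2 * (a - b)\<^sup>2 + 2 * (b - c)\<^sup>2" for a b c :: real
    proof -
      have "(a - c)\<^sup>2 = ((a - b) + (b - c))\<^sup>2" by simp
      also have "\<dots> \<le> 2 * (a - b)\<^sup>2 + 2 * (b - c)\<^sup>2"
        using sum_squares_bound[of "a - b" "b - c"] by (simp only: power2_sum)
      finally show ?thesis .
    qed
    have "(LBINT x. (w x - h n x)\<^sup>2)
        \<le> (LBINT x. 2 * (w x - clamp k (w x))\<^sup>2 + 2 * (clamp k (w x) - h n x)\<^sup>2)"
      using i1 i2 ab
      by (intro integral_mono' Bochner_Integration.integrable_add integrable_mult_right) auto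
    also have "\<dots> = 2 * (LBINT x. (w x - clamp k (w x))\<^sup>2) + 2 * (LBINT x. (clamp k (w x) - h n x)\<^sup>2)"
      using i1 i2 by simp
    finally show "(LBINT x. (w x - h n x)\<^sup>2) < e" using k n by linarith
  qed
qed

text \<open>Replacing \<open>w\<close> by a continuous \<open>h\<close> costs an error uniform over
  the bounded translations; for \<open>h\<close> the translation is moved from \<open>g\<close> to
  \<open>h\<close>, where pointwise continuity allows dominated convergence.\<close>

lemma translation_continuous:
  fixes g w :: "'a::euclidean_space \<Rightarrow> real"
  assumes g: "L2loc g" and w: "L2loc w" "bounded_support w" and X: "X \<longlonglongrightarrow> 0"
  shows "(\<lambda>n. LBINT x. g (x + X n) * w x) \<longlonglongrightarrow> (LBINT x. g x * w x)"
proof (rule LIMSEQ_I)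
  fix e :: real assume "e > 0"
  note [measurable] = L2loc_measurable[OF g] L2loc_measurable[OF w(1)]
  obtain R where R: "R > 0" "\<And>x. norm x > R \<Longrightarrow> w x = 0"
    using bounded_supportE[OF w(2)] by blast
  obtain B where B: "B > 0" "\<And>n. norm (X n) \<le> B"
    using convergent_imp_Bseq[OF convergentI[OF X]] by (auto elim: BseqE)
  define A where "A = (LBINT x. indicator (cball 0 (R + 1 + B)) x * (g x)\<^sup>2)"
  have "A \<ge> 0" unfolding A_def by (intro integral_nonneg_AE) auto
  \<comment> \<open>Chosen so that \<open>d * A\<close> is at most e/8, with \<open>A + 1\<close>
    guarding against A = 0. As \<open>h\<close> is then taken within d (e/8), both terms of
    \<open>L2_integral_bound\<close> are at most e/8.\<close>
  define d where "d = e / (8 * (A + 1))"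
  have "d > 0" "d * A \<le> e / 8"
    using \<open>e > 0\<close> \<open>A \<ge> 0\<close> by (auto simp: d_def field_simps)
  obtain h where h: "continuous_on UNIV h" "\<And>x. norm x > R + 1 \<Longrightarrow> h x = 0"
    "(LBINT x. (w x - h x)\<^sup>2) < d * (e / 8)"
  proof -
    have "d * (e / 8) > 0" using \<open>d > 0\<close> \<open>e > 0\<close> by simp
    from L2_approx_continuous[OF w(1) R(2) this] that show thesis by blast
  qed
  have hL: "L2loc h" and hs: "bounded_support h"
    using h(1,2) by (auto intro: L2loc_continuous bounded_supportI)
  note [measurable] = L2loc_measurable[OF hL]
  have close: "\<bar>(LBINT x. g (x + a) * w x) - (LBINT x. g (x + a) * h x)\<bar> \<le> e / 4"
    if "norm a \<le> B" for a
  proof -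
    have "(LBINT x. g (x + a) * w x) - (LBINT x. g (x + a) * h x)
        = (LBINT x. g (x + a) * (w x - h x))"
      using integrable_L2loc_mult[OF L2loc_shift[OF g] w] integrable_L2loc_mult[OF L2loc_shift[OF g] hL hs]
      by (simp add: right_diff_distrib)
    also have "\<bar>\<dots>\<bar> \<le> d * (LBINT x. indicator (cball 0 (R + 1)) x * (g (x + a))\<^sup>2)
        + (LBINT x. (w x - h x)\<^sup>2) / d"
      using R(2) h(2) \<open>d > 0\<close> by (intro L2_integral_bound L2loc_shift g L2loc_diff w hL) auto
    also have "\<dots> \<le> d * A + (d * (e / 8)) / d"
      unfolding A_def using h(3) \<open>d > 0\<close> L2loc_shift_bound[OF g that]
      by (intro add_mono mult_left_mono divide_right_mono) auto
    also have "\<dots> \<le> e / 4" using \<open>d > 0\<close> \<open>d * A \<le> e / 8\<close> by simp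
    finally show ?thesis .
  qed
  obtain M where M: "\<And>x. \<bar>h x\<bar> \<le> M"
    using bounded_support_locally_bounded[OF hs locally_bounded_continuous[OF h(1)]] by blast
  have "(\<lambda>n. LBINT x. g x * h (x + - X n)) \<longlonglongrightarrow> (LBINT x. g x * h x)"
  proof (rule integral_dominated_convergence)
    show "integrable lborel (\<lambda>x. M * \<bar>indicator (cball 0 (R + 1 + B)) x * g x\<bar>)"
      using L2loc_set_integrable[OF g compact_cball[of 0 "R + 1 + B"]]
      unfolding set_integrable_def by (intro integrable_mult_right integrable_abs) simp
    have "(\<lambda>n. h (x + - X n)) \<longlonglongrightarrow> h (x + - 0)" for x
      using h(1) by (intro isCont_tendsto_compose[of _ h] tendsto_intros X)
        (simp add: continuous_on_eq_continuous_at)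
    then show "AE x in lborel. (\<lambda>n. g x * h (x + - X n)) \<longlonglongrightarrow> g x * h x"
      by (intro AE_I2 tendsto_mult tendsto_const) simp
    fix n
    have "\<bar>g x * h (x + - X n)\<bar> \<le> M * \<bar>indicator (cball 0 (R + 1 + B)) x * g x\<bar>" for x
    proof (cases "norm x > R + 1 + B")
      case True
      then have "norm (x + - X n) > R + 1" using B(2)[of n] norm_diff_ineq[of x "- X n"] by simp
      then show ?thesis using h(2) True by simp
    next
      case False
      then show ?thesis using M[of "x + - X n"] by (simp add: abs_mult mult.commute[of M] mult_left_mono)
    qed
    then show "AE x in lborel. norm (g x * h (x + - X n)) \<le> M * \<bar>indicator (cball 0 (R + 1 + B)) x * g x\<bar>"
      by simp
  qed measurable
  also have "(\<lambda>n. LBINT x. g x * h (x + - X n)) = (\<lambda>n. LBINT x. g (x + X n) * h x)"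
  proof
    fix n show "(LBINT x. g x * h (x + - X n)) = (LBINT x. g (x + X n) * h x)"
      using lborel_integral_shift[of "\<lambda>x. g x * h (x + - X n)" "X n"] by simp
  qed
  finally obtain N where N: "\<And>n. n \<ge> N \<Longrightarrow>
      norm ((LBINT x. g (x + X n) * h x) - (LBINT x. g x * h x)) < e / 4"
    using LIMSEQ_D[of _ _ "e / 4"] \<open>e > 0\<close> by force
  show "\<exists>N. \<forall>n\<ge>N. norm ((LBINT x. g (x + X n) * w x) - (LBINT x. g x * w x)) < e"
  proof (intro exI[of _ N] allI impI)
    fix n assume "n \<ge> N"
    have combine: "\<bar>d - b\<bar> < e" if "\<bar>c - a\<bar> < e / 4" "\<bar>d - c\<bar> \<le> e / 4" "\<bar>b - a\<bar> \<le> e / 4" for a b c d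
      using that \<open>e > 0\<close> by linarith
    show "norm ((LBINT x. g (x + X n) * w x) - (LBINT x. g x * w x)) < e"
      using combine[OF N[OF \<open>n \<ge> N\<close>, unfolded real_norm_def] close[OF B(2)[of n]]] close[of 0] B(1)
      by simp
  qed
qed

section \<open>Weak derivatives as limits of difference quotients\<close>

abbreviation lborel2 :: "('a::euclidean_space \<times> 'b::euclidean_space) measure" where
  "lborel2 \<equiv> lborel \<Otimes>\<^sub>M lborel"

text \<open>The mean of \<open>g\<close> over the segment from x to x + a. If \<open>g\<close> is
  the derivative of v along e, the fundamental theorem of calculus reads v(x + h e) - v(x) = h *
  \<open>line_avg g (h *\<^sub>R e) x\<close>; this integrated form survives for weak derivatives
  almost everywhere.\<close>

definition line_avg :: "('a::euclidean_space \<Rightarrow> real) \<Rightarrow> 'a \<Rightarrow> 'a \<Rightarrow> real" where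
  "line_avg g a x = (LBINT s. g (x + s *\<^sub>R a) * indicator {0..1} s)"

lemma line_avg_measurable [measurable]:
  assumes [measurable]: "g \<in> borel_measurable borel"
  shows "line_avg g a \<in> borel_measurable borel"
  unfolding line_avg_def[abs_def] by measurable

lemma integrable_shift_product:
  fixes g w :: "'a::euclidean_space \<Rightarrow> real"
  assumes g: "L2loc g" and w: "L2loc w" "bounded_support w"
  shows "integrable lborel2 (\<lambda>(x, s). g (x + s *\<^sub>R e) * w x * indicator {0..1::real} s)"
proof (rule integrableI_bounded)
  note [measurable] = L2loc_measurable[OF g] L2loc_measurable[OF w(1)]
  show [measurable]: "(\<lambda>(x, s). g (x + s *\<^sub>R e) * w x * indicator {0..1::real} s)
      \<in> borel_measurable lborel2"
    by measurable
  obtain R where R: "\<And>x. norm x > R \<Longrightarrow> w x = 0"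
    using bounded_supportE[OF w(2)] by blast
  define K where "K = (LBINT x. indicator (cball 0 (R + norm e)) x * (g x)\<^sup>2) + (LBINT x. (w x)\<^sup>2)"
  have le: "(\<integral>\<^sup>+x. ennreal \<bar>g (x + s *\<^sub>R e) * w x\<bar> \<partial>lborel) \<le> ennreal K" if "s \<in> {0..1}" for s
  proof -
    have "norm (s *\<^sub>R e) \<le> norm e" using that by (auto simp: mult_left_le_one_le)
    note b = L2loc_shift_bound[OF g this, of R]
    have i: "integrable lborel (\<lambda>x. indicator (cball 0 R) x * (g (x + s *\<^sub>R e))\<^sup>2)"
      using L2loc_shift[OF g] by (auto simp: L2loc_def)
    have j: "integrable lborel (\<lambda>x. (w x)\<^sup>2)"
      by (rule L2loc_integrable_square[OF w])
    have "(\<integral>\<^sup>+x. ennreal \<bar>g (x + s *\<^sub>R e) * w x\<bar> \<partial>lborel)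
        \<le> (\<integral>\<^sup>+x. ennreal (indicator (cball 0 R) x * (g (x + s *\<^sub>R e))\<^sup>2 + (w x)\<^sup>2) \<partial>lborel)"
    proof (intro nn_integral_mono ennreal_leI)
      show "\<bar>g (x + s *\<^sub>R e) * w x\<bar> \<le> indicator (cball 0 R) x * (g (x + s *\<^sub>R e))\<^sup>2 + (w x)\<^sup>2" for x
        using R[of x] abs_mult_weighted_bound[of 1 "g (x + s *\<^sub>R e)" "w x"]
        by (cases "norm x > R") auto
    qed
    also have "\<dots> = ennreal (LBINT x. indicator (cball 0 R) x * (g (x + s *\<^sub>R e))\<^sup>2 + (w x)\<^sup>2)"
      using i j by (intro nn_integral_eq_integral) auto
    also have "\<dots> \<le> ennreal K"
      unfolding K_def using i j b by (intro ennreal_leI) simp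
    finally show ?thesis .
  qed
  have "(\<integral>\<^sup>+z. ennreal (norm (case z of (x, s) \<Rightarrow> g (x + s *\<^sub>R e) * w x * indicator {0..1} s)) \<partial>lborel2)
    = (\<integral>\<^sup>+s. \<integral>\<^sup>+x. ennreal \<bar>g (x + s *\<^sub>R e) * w x * indicator {0..1} s\<bar> \<partial>lborel \<partial>lborel)"
    by (subst lborel_pair.nn_integral_snd[symmetric]) auto
  also have "\<dots> \<le> (\<integral>\<^sup>+s. ennreal K * indicator {0..1} s \<partial>(lborel :: real measure))"
    using le by (intro nn_integral_mono) (auto simp: indicator_def)
  also have "\<dots> < \<infinity>"
    by (simp add: nn_integral_cmult_indicator ennreal_mult_less_top)
  finally show "(\<integral>\<^sup>+z. ennreal (norm (case z of (x, s) \<Rightarrow> g (x + s *\<^sub>R e) * w x * indicator {0..1} s))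
      \<partial>lborel2) < \<infinity>" .
qed

lemma shift_product_swap:
  fixes g w :: "'a::euclidean_space \<Rightarrow> real"
  assumes g: "L2loc g" and w: "L2loc w" "bounded_support w"
  shows "(LBINT x. line_avg g e x * w x)
    = (LBINT s. (LBINT x. g (x + s *\<^sub>R e) * w x) * indicator {0..1::real} s)"
    and "integrable lborel (\<lambda>x. line_avg g e x * w x)"
proof -
  note i = integrable_shift_product[OF assms, of e]
  have eq: "(LBINT s. g (x + s *\<^sub>R e) * w x * indicator {0..1} s)
      = line_avg g e x * w x" for x
    unfolding line_avg_def by (subst integral_mult_left_zero[symmetric]) (simp add: mult_ac)
  show "(LBINT x. line_avg g e x * w x)
    = (LBINT s. (LBINT x. g (x + s *\<^sub>R e) * w x) * indicator {0..1::real} s)"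
    using lborel_pair.Fubini_integral[OF i] by (simp add: eq)
  show "integrable lborel (\<lambda>x. line_avg g e x * w x)"
    using lborel_pair.integrable_fst[OF i] by (simp add: eq)
qed

text \<open>Weak convergence of the difference quotients, tested against every locally square
  integrable \<open>w\<close> of bounded support and not only against smooth functions. The chain
  rule needs this, since its test function is f(v) times a cutoff, as rough as v itself.\<close>

definition weak_dir_deriv :: "'a::euclidean_space \<Rightarrow> ('a \<Rightarrow> real) \<Rightarrow> ('a \<Rightarrow> real) \<Rightarrow> bool" where
  "weak_dir_deriv e v g \<longleftrightarrow> L2loc v \<and> L2loc g \<and>
     (\<forall>w X. L2loc w \<longrightarrow> bounded_support w \<longrightarrow> X \<longlonglongrightarrow> 0 \<longrightarrow> (\<forall>n. X n \<noteq> 0) \<longrightarrow>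
        (\<lambda>n. LBINT x. (v (x + X n *\<^sub>R e) - v x) / X n * w x) \<longlonglongrightarrow> (LBINT x. g x * w x))"

lemma weak_dir_deriv_add:
  assumes "weak_dir_deriv e v g" "weak_dir_deriv e v' g'"
  shows "weak_dir_deriv e (\<lambda>x. v x + v' x) (\<lambda>x. g x + g' x)"
  unfolding weak_dir_deriv_def
proof (intro conjI allI impI)
  have L: "L2loc v" "L2loc g" "L2loc v'" "L2loc g'"
    using assms by (auto simp: weak_dir_deriv_def)
  show "L2loc (\<lambda>x. v x + v' x)" "L2loc (\<lambda>x. g x + g' x)"
    using L by (auto intro: L2loc_add)
  fix w :: "'a \<Rightarrow> real" and X :: "nat \<Rightarrow> real"
  assume w: "L2loc w" "bounded_support w" and X: "X \<longlonglongrightarrow> 0" "\<forall>n. X n \<noteq> 0"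
  have i: "integrable lborel (\<lambda>x. (f (x + X n *\<^sub>R e) - f x) / X n * w x)" if "L2loc f" for f n
    using L2loc_cmult[OF L2loc_diff[OF L2loc_shift[OF that] that], of "1 / X n"]
    by (intro integrable_L2loc_mult w) simp
  have "(\<lambda>n. (LBINT x. (v (x + X n *\<^sub>R e) - v x) / X n * w x)
      + (LBINT x. (v' (x + X n *\<^sub>R e) - v' x) / X n * w x))
    \<longlonglongrightarrow> (LBINT x. g x * w x) + (LBINT x. g' x * w x)"
    using assms w X by (intro tendsto_add) (auto simp: weak_dir_deriv_def)
  also have "(LBINT x. g x * w x) + (LBINT x. g' x * w x) = (LBINT x. (g x + g' x) * w x)"
    using integrable_L2loc_mult[OF L(2) w] integrable_L2loc_mult[OF L(4) w] by (simp add: distrib_right)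
  also have "(\<lambda>n. (LBINT x. (v (x + X n *\<^sub>R e) - v x) / X n * w x)
      + (LBINT x. (v' (x + X n *\<^sub>R e) - v' x) / X n * w x))
    = (\<lambda>n. LBINT x. (v (x + X n *\<^sub>R e) + v' (x + X n *\<^sub>R e) - (v x + v' x)) / X n * w x)"
    unfolding Bochner_Integration.integral_add[OF i[OF L(1)] i[OF L(3)], symmetric]
    by (simp add: distrib_right[symmetric] add_divide_distrib[symmetric] add_diff_add)
  finally show "(\<lambda>n. LBINT x. (v (x + X n *\<^sub>R e) + v' (x + X n *\<^sub>R e) - (v x + v' x)) / X n * w x)
      \<longlonglongrightarrow> (LBINT x. (g x + g' x) * w x)" .
qed

text \<open>Fubini turns the tested quotient into the mean over s in [0, 1] of the pairing of
  \<open>w\<close> with \<open>g\<close> translated by s X n e; by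
  \<open>translation_continuous\<close> each such pairing converges to the untranslated one, and a
  common bound dominates.\<close>

lemma weak_dir_deriv_if_difference:
  assumes v: "L2loc v" and g: "L2loc g"
    and eq: "\<And>h. AE x in lborel. v (x + h *\<^sub>R e) - v x
       = h * line_avg g (h *\<^sub>R e) x"
  shows "weak_dir_deriv e v g"
  unfolding weak_dir_deriv_def
proof (intro conjI v g allI impI)
  fix w :: "'a \<Rightarrow> real" and X :: "nat \<Rightarrow> real"
  assume w: "L2loc w" "bounded_support w" and X: "X \<longlonglongrightarrow> 0" "\<forall>n. X n \<noteq> 0"
  note [measurable] = v[THEN L2loc_measurable] g[THEN L2loc_measurable] w(1)[THEN L2loc_measurable]
  define C where "C a = (LBINT x. g (x + a) * w x)" for a
  have quot: "(LBINT x. (v (x + X n *\<^sub>R e) - v x) / X n * w x)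
      = (LBINT s. C (s *\<^sub>R (X n *\<^sub>R e)) * indicator {0..1} s)" for n
  proof -
    have "(LBINT x. (v (x + X n *\<^sub>R e) - v x) / X n * w x)
      = (LBINT x. line_avg g (X n *\<^sub>R e) x * w x)"
    proof (rule integral_cong_AE)
      show "AE x in lborel. (v (x + X n *\<^sub>R e) - v x) / X n * w x
        = line_avg g (X n *\<^sub>R e) x * w x"
        using eq[of "X n"] by eventually_elim (use X in simp)
    qed measurable
    also have "\<dots> = (LBINT s. C (s *\<^sub>R (X n *\<^sub>R e)) * indicator {0..1} s)"
      unfolding C_def by (rule shift_product_swap[OF g w])
    finally show ?thesis .
  qed
  obtain R where R: "\<And>x. norm x > R \<Longrightarrow> w x = 0"
    using bounded_supportE[OF w(2)] by blast
  obtain B where B: "B > 0" "\<And>n. norm (X n) \<le> B"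
    using convergent_imp_Bseq[OF convergentI[OF X(1)]] by (auto elim: BseqE)
  define K where "K = 1 * (LBINT x. indicator (cball 0 (R + B * norm e)) x * (g x)\<^sup>2) + (LBINT x. (w x)\<^sup>2) / 1"
  have C_bound: "\<bar>C (s *\<^sub>R (X n *\<^sub>R e))\<bar> \<le> K" if "s \<in> {0..1}" for s n
  proof -
    have "\<bar>s\<bar> * \<bar>X n\<bar> * norm e \<le> 1 * B * norm e"
      using that B(2)[of n] by (intro mult_mono) auto
    then have "norm (s *\<^sub>R (X n *\<^sub>R e)) \<le> B * norm e" by (simp add: mult.assoc abs_mult)
    note b = L2loc_shift_bound[OF g this, of R]
    have "\<bar>C (s *\<^sub>R (X n *\<^sub>R e))\<bar>
        \<le> 1 * (LBINT x. indicator (cball 0 R) x * (g (x + s *\<^sub>R (X n *\<^sub>R e)))\<^sup>2) + (LBINT x. (w x)\<^sup>2) / 1"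
      unfolding C_def by (rule L2_integral_bound[OF L2loc_shift[OF g] w(1)]) (use R in auto)
    also have "\<dots> \<le> K" unfolding K_def using b by simp
    finally show ?thesis .
  qed
  have C_meas [measurable]: "(\<lambda>s. C (s *\<^sub>R a)) \<in> borel_measurable borel" for a
    unfolding C_def by measurable
  have "(\<lambda>n. LBINT s. C (s *\<^sub>R (X n *\<^sub>R e)) * indicator {0..1} s)
      \<longlonglongrightarrow> (LBINT s. C 0 * indicator {0..1::real} s)"
  proof (rule integral_dominated_convergence)
    show "integrable lborel (\<lambda>s. K * indicator {0..1::real} s)"
      by (intro integrable_mult_right) (simp add: integrable_indicator_iff)
    show "AE s in lborel. norm (C (s *\<^sub>R (X n *\<^sub>R e)) * indicator {0..1} s) \<le> K * indicator {0..1} s" for n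
      using C_bound by (auto simp: indicator_def)
    have "(\<lambda>n. C (s *\<^sub>R (X n *\<^sub>R e))) \<longlonglongrightarrow> (LBINT x. g x * w x)" for s
      unfolding C_def
      by (rule translation_continuous[OF g w])
        (use X(1) in \<open>auto intro!: tendsto_eq_intros\<close>)
    then show "AE s in lborel. (\<lambda>n. C (s *\<^sub>R (X n *\<^sub>R e)) * indicator {0..1} s) \<longlonglongrightarrow> C 0 * indicator {0..1} s"
      by (intro AE_I2 tendsto_mult tendsto_const) (simp add: C_def)
  qed measurable
  then show "(\<lambda>n. LBINT x. (v (x + X n *\<^sub>R e) - v x) / X n * w x) \<longlonglongrightarrow> (LBINT x. g x * w x)"
    unfolding quot by (simp add: C_def)
qed

lemma tensor_differentiable:
  "(\<And>i. smooth_real (b i)) \<Longrightarrow> tensor b differentiable (at x)"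
  using tensor_has_derivative unfolding differentiable_def by blast

lemma box_bump_shift:
  assumes "\<psi> \<in> box_bumps" shows "(\<lambda>x. \<psi> (x + a)) \<in> box_bumps"
proof -
  obtain n b c where \<psi>: "\<psi> = tensor (\<lambda>i. bump n (b $ i) (c $ i))"
    using assms by (auto simp: box_bumps_def)
  have "bump n (b $ i) (c $ i) (x $ i + a $ i) = bump n ((b - a) $ i) ((c - a) $ i) (x $ i)" for i and x :: "real^'a"
    by (simp add: bump_def algebra_simps)
  then have "(\<lambda>x. \<psi> (x + a)) = tensor (\<lambda>i. bump n ((b - a) $ i) ((c - a) $ i))"
    unfolding \<psi> by (auto simp: tensor_def)
  then show ?thesis unfolding box_bumps_def by blast
qed

lemma has_derivative_partial_deriv:
  assumes "f differentiable (at (x :: real^'n::finite))"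
  shows "((\<lambda>s. f (x + s *\<^sub>R axis i 1)) has_real_derivative partial_deriv i f x) (at 0)"
proof -
  have "(f has_derivative frechet_derivative f (at x)) (at (x + 0 *\<^sub>R axis i 1))"
    using assms by (simp add: frechet_derivative_works)
  then have "((\<lambda>s. f (x + s *\<^sub>R axis i 1)) has_derivative (\<lambda>s. frechet_derivative f (at x) (s *\<^sub>R axis i 1))) (at 0)"
    by (rule has_derivative_compose[rotated]) (auto intro!: derivative_eq_intros)
  moreover have "frechet_derivative f (at x) (s *\<^sub>R axis i 1) = partial_deriv i f x * s" for s
    using linear_cmul[OF linear_frechet_derivative[OF assms]] by (simp add: partial_deriv_def)
  ultimately show ?thesis by (simp add: has_field_derivative_def)
qed

lemma has_derivative_partial_deriv_line:
  assumes "\<And>x. f differentiable (at (x :: real^'n::finite))"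
  shows "((\<lambda>s. f (x + s *\<^sub>R axis i 1)) has_real_derivative partial_deriv i f (x + s *\<^sub>R axis i 1)) (at s)"
proof -
  have "((\<lambda>r. f (x + s *\<^sub>R axis i 1 + r *\<^sub>R axis i 1)) has_real_derivative
      partial_deriv i f (x + s *\<^sub>R axis i 1)) (at (s + - s))"
    using has_derivative_partial_deriv[OF assms] by simp
  then show ?thesis
    unfolding DERIV_shift by (simp add: algebra_simps)
qed

lemma partial_deriv_shift:
  assumes "\<And>x. f differentiable (at (x :: real^'n::finite))"
  shows "partial_deriv i (\<lambda>x. f (x + a)) x = partial_deriv i f (x + a)"
proof -
  have "((\<lambda>x. f (x + a)) has_derivative frechet_derivative f (at (x + a))) (at x)"
    by (rule has_derivative_compose[of "\<lambda>x. x + a" "\<lambda>x. x", simplified])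
      (use assms in \<open>auto simp: frechet_derivative_works intro!: derivative_eq_intros\<close>)
  from frechet_derivative_at[OF this] show ?thesis by (simp add: partial_deriv_def)
qed

text \<open>The integrated form of the derivative is verified by testing. The translation of v is
  moved to the box bump, where the fundamental theorem of calculus holds along lines; the weak
  identity applied to each translated bump turns the derivative into \<open>g\<close>, and the
  fundamental lemma removes the test function.\<close>

lemma weak_dir_derivI:
  fixes v g :: "real^'n::finite \<Rightarrow> real"
  assumes v: "L2loc v" and g: "L2loc g"
    and weak: "\<And>\<psi>. \<psi> \<in> box_bumps \<Longrightarrow>
      (LBINT x. v x * partial_deriv i \<psi> x) = - (LBINT x. g x * \<psi> x)"
  shows "weak_dir_deriv (axis i 1) v g"
proof (rule weak_dir_deriv_if_difference[OF v g])
  fix h :: real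
  let ?e = "axis i 1 :: real^'n"
  note [measurable] = v[THEN L2loc_measurable] g[THEN L2loc_measurable]
  define G where "G = line_avg g (h *\<^sub>R ?e)"
  have [measurable]: "G \<in> borel_measurable borel" unfolding G_def by measurable
  have Gi: "set_integrable lborel K G" if "compact K" for K
  proof -
    have "L2loc (indicator K)" "bounded_support (indicator K)"
      using that by (auto intro!: L2loc_locally_bounded locally_bounded_indicator borel_measurable_indicator
          simp: borel_compact bounded_support_def indicator_def compact_imp_bounded)
    from shift_product_swap(2)[OF g this, of "h *\<^sub>R ?e"] show ?thesis
      by (simp add: G_def set_integrable_def mult.commute)
  qed
  have "AE x in lborel. v (x + h *\<^sub>R ?e) - v x - h * G x = 0"
  proof (rule fundamental_lemma)
    show "set_integrable lborel K (\<lambda>x. v (x + h *\<^sub>R ?e) - v x - h * G x)" if "compact K" for K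
      using that by (intro set_integral_diff Gi L2loc_set_integrable L2loc_shift v set_integrable_mult_right)
    fix \<psi> :: "real^'n \<Rightarrow> real" assume \<psi>: "\<psi> \<in> box_bumps"
    obtain b R where b: "\<psi> = tensor b" "\<And>i. smooth_real (b i)"
      using box_bumps_cases[OF \<psi>] by metis
    have diff: "\<psi> differentiable (at x)" for x
      unfolding b(1) by (rule tensor_differentiable) (rule b)
    have bs: "bounded_support f" if "f \<in> test_functions" for f :: "real^'n \<Rightarrow> real"
      using test_function_bounded_support[OF that] bounded_supportI by metis
    note test = box_bumps_test[OF \<psi>] partial_deriv_box_bump_test[OF \<psi>, of i]
    have \<psi>L: "L2loc \<psi>" "bounded_support \<psi>" and dL: "L2loc (partial_deriv i \<psi>)" "bounded_support (partial_deriv i \<psi>)"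
      using test by (auto intro: L2loc_continuous test_function_continuous bs)
    note [measurable] = \<psi>L(1)[THEN L2loc_measurable] dL(1)[THEN L2loc_measurable]
    have dcont: "isCont (partial_deriv i \<psi>) x" for x
      using test_function_continuous[OF test(2)] by (simp add: continuous_on_eq_continuous_at)
    have shifted: "(LBINT x. v x * partial_deriv i \<psi> (x + a)) = - (LBINT x. g x * \<psi> (x + a))" for a
      using weak[OF box_bump_shift[OF \<psi>]] by (simp add: partial_deriv_shift[OF diff])
    define A where "A = line_avg (partial_deriv i \<psi>) (- h *\<^sub>R ?e)"
    have FTC: "A x * (- h) = \<psi> (x + - h *\<^sub>R ?e) - \<psi> x" for x
    proof -
      have d: "((\<lambda>s. \<psi> (x + s *\<^sub>R (- h *\<^sub>R ?e))) has_real_derivative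
          partial_deriv i \<psi> (x + s *\<^sub>R (- h *\<^sub>R ?e)) * (- h)) (at s)" for s
      proof -
        have "((\<lambda>s. s * (- h)) has_real_derivative - h) (at s)"
          by (auto intro!: derivative_eq_intros)
        from DERIV_chain2[where f = "\<lambda>r. \<psi> (x + r *\<^sub>R ?e)" and g = "\<lambda>s. s * (- h)",
            OF has_derivative_partial_deriv_line[OF diff] this]
        show ?thesis by simp
      qed
      have "(LBINT s. (partial_deriv i \<psi> (x + s *\<^sub>R (- h *\<^sub>R ?e)) * (- h)) * indicator {0..1} s)
          = \<psi> (x + 1 *\<^sub>R (- h *\<^sub>R ?e)) - \<psi> (x + 0 *\<^sub>R (- h *\<^sub>R ?e))"
        by (rule integral_FTC_Icc_real[OF _ d])
          (auto intro!: continuous_intros isCont_o2[OF _ dcont])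
      then show ?thesis
        unfolding A_def line_avg_def by (subst integral_mult_left_zero[symmetric]) (simp add: mult_ac)
    qed
    have "(LBINT x. v (x + h *\<^sub>R ?e) * \<psi> x) = (LBINT x. v x * \<psi> (x + - h *\<^sub>R ?e))"
      using lborel_integral_shift[of "\<lambda>x. v (x + h *\<^sub>R ?e) * \<psi> x" "- h *\<^sub>R ?e"] by simp
    moreover have "(LBINT x. v x * \<psi> (x + - h *\<^sub>R ?e)) - (LBINT x. v x * \<psi> x)
        = (LBINT x. v x * (A x * (- h)))"
      unfolding FTC
      using integrable_L2loc_mult[OF v \<psi>L]
        integrable_L2loc_mult[OF v L2loc_shift[OF \<psi>L(1)] bounded_support_shift[OF \<psi>L(2)], of "- h *\<^sub>R ?e"]
      by (simp add: right_diff_distrib)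
    moreover have "\<dots> = (- h) * (LBINT x. A x * v x)"
      by (subst integral_mult_right_zero[symmetric]) (simp add: mult_ac)
    moreover have "(LBINT x. A x * v x)
        = - (LBINT x. G x * \<psi> x)"
    proof -
      obtain R where R: "\<And>x. norm x > R \<Longrightarrow> partial_deriv i \<psi> x = 0"
        using bounded_supportE[OF dL(2)] by blast
      \<comment> \<open>\<open>shift_product_swap\<close> wants bounded support in the untranslated
        factor. The radius R + |h| covers the supports of all translates of the derivative of the
        bump by s h e with s in [0, 1], so cutting v off there changes no integral.\<close>
      define w where "w x = v x * indicator (cball 0 (R + \<bar>h\<bar>)) x" for x
      have w: "L2loc w" "bounded_support w"
        unfolding w_def[abs_def]
        by (intro L2loc_mult_locally_bounded v locally_bounded_indicator borel_measurable_indicator cball_borel)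
          (auto intro: bounded_supportI[of "R + \<bar>h\<bar>"])
      have wv: "partial_deriv i \<psi> (x + s *\<^sub>R (- h *\<^sub>R ?e)) * w x = partial_deriv i \<psi> (x + s *\<^sub>R (- h *\<^sub>R ?e)) * v x"
        if "s \<in> {0..1}" for x s
      proof (cases "norm x \<le> R + \<bar>h\<bar>")
        case False
        have "norm (s *\<^sub>R (- h *\<^sub>R ?e)) \<le> \<bar>h\<bar>"
          using that by (auto simp: norm_axis_1 mult_left_le_one_le abs_mult)
        then have "norm (x + s *\<^sub>R (- h *\<^sub>R ?e)) > R"
          using False norm_diff_ineq[of x "s *\<^sub>R (- h *\<^sub>R ?e)"] by linarith
        then show ?thesis using R by simp
      qed (simp add: w_def)
      have "(LBINT x. A x * v x)
        = (LBINT x. A x * w x)"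
      proof (rule Bochner_Integration.integral_cong[OF refl])
        fix x
        show "A x * v x
          = A x * w x"
          unfolding A_def line_avg_def by (subst (1 2) integral_mult_left_zero[symmetric], rule Bochner_Integration.integral_cong)
            (use wv[of _ x] in \<open>auto simp: indicator_def mult_ac simp del: scaleR_minus_left scaleR_minus_right scaleR_scaleR\<close>)
      qed
      also have "\<dots> = (LBINT s. (LBINT x. partial_deriv i \<psi> (x + s *\<^sub>R (- h *\<^sub>R ?e)) * w x) * indicator {0..1::real} s)"
        unfolding A_def by (rule shift_product_swap(1)[OF dL(1) w])
      also have "\<dots> = (LBINT s. - ((LBINT x. g (x + s *\<^sub>R (h *\<^sub>R ?e)) * \<psi> x) * indicator {0..1::real} s))"
      proof (rule Bochner_Integration.integral_cong[OF refl])
        fix s :: real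
        have "(LBINT x. partial_deriv i \<psi> (x + s *\<^sub>R (- h *\<^sub>R ?e)) * w x)
          = - (LBINT x. g (x + s *\<^sub>R (h *\<^sub>R ?e)) * \<psi> x)" if "s \<in> {0..1}"
        proof -
          have "(LBINT x. partial_deriv i \<psi> (x + s *\<^sub>R (- h *\<^sub>R ?e)) * w x)
            = (LBINT x. v x * partial_deriv i \<psi> (x + s *\<^sub>R (- h *\<^sub>R ?e)))"
            using wv[OF that] by (intro Bochner_Integration.integral_cong) (auto simp: mult.commute)
          also have "\<dots> = - (LBINT x. g x * \<psi> (x + s *\<^sub>R (- h *\<^sub>R ?e)))" by (rule shifted)
          also have "(LBINT x. g x * \<psi> (x + s *\<^sub>R (- h *\<^sub>R ?e))) = (LBINT x. g (x + s *\<^sub>R (h *\<^sub>R ?e)) * \<psi> x)"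
            using lborel_integral_shift[of "\<lambda>x. g x * \<psi> (x + s *\<^sub>R (- h *\<^sub>R ?e))" "s *\<^sub>R (h *\<^sub>R ?e)"] by simp
          finally show ?thesis .
        qed
        then show "(LBINT x. partial_deriv i \<psi> (x + s *\<^sub>R (- h *\<^sub>R ?e)) * w x) * indicator {0..1} s
          = - ((LBINT x. g (x + s *\<^sub>R (h *\<^sub>R ?e)) * \<psi> x) * indicator {0..1} s)"
          by (auto simp: indicator_def)
      qed
      also have "\<dots> = - (LBINT x. G x * \<psi> x)"
        unfolding G_def shift_product_swap(1)[OF g \<psi>L] by simp
      finally show ?thesis .
    qed
    moreover have "(LBINT x. (v (x + h *\<^sub>R ?e) - v x - h * G x) * \<psi> x)
        = (LBINT x. v (x + h *\<^sub>R ?e) * \<psi> x) - (LBINT x. v x * \<psi> x) - h * (LBINT x. G x * \<psi> x)"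
      using integrable_L2loc_mult[OF v \<psi>L] integrable_L2loc_mult[OF L2loc_shift[OF v] \<psi>L]
        shift_product_swap(2)[OF g \<psi>L, of "h *\<^sub>R ?e", folded G_def]
      by (simp add: left_diff_distrib mult.assoc)
    ultimately show "(LBINT x. (v (x + h *\<^sub>R ?e) - v x - h * G x) * \<psi> x) = 0"
      by simp
  qed measurable
  then show "AE x in lborel. v (x + h *\<^sub>R ?e) - v x
      = h * line_avg g (h *\<^sub>R ?e) x"
    by eventually_elim (simp add: G_def)
qed

section \<open>Chain rule and product rule\<close>

definition L1loc :: "('a::euclidean_space \<Rightarrow> real) \<Rightarrow> bool" where
  "L1loc f \<longleftrightarrow> f \<in> borel_measurable borel \<and>
     (\<forall>R. integrable lborel (\<lambda>x. indicator (cball 0 R) x * f x))"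

lemma L2loc_mult_L1loc:
  assumes "L2loc f" "L2loc g" shows "L1loc (\<lambda>x. f x * g x)"
  unfolding L1loc_def
proof (intro conjI allI)
  note [measurable] = assms[THEN L2loc_measurable]
  show "(\<lambda>x. f x * g x) \<in> borel_measurable borel" by measurable
  fix R
  have "L2loc (\<lambda>x. g x * indicator (cball 0 R) x)"
    by (intro L2loc_mult_locally_bounded assms locally_bounded_indicator borel_measurable_indicator cball_borel)
  moreover have "bounded_support (\<lambda>x. g x * indicator (cball 0 R) x)"
    by (rule bounded_supportI[of R]) auto
  ultimately have "integrable lborel (\<lambda>x. f x * (g x * indicator (cball 0 R) x))"
    by (rule integrable_L2loc_mult[OF assms(1)])
  then show "integrable lborel (\<lambda>x. indicator (cball 0 R) x * (f x * g x))"
    by (simp add: mult_ac)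
qed

lemma integrable_L1loc_mult:
  assumes f: "L1loc f" and \<psi>: "\<psi> \<in> borel_measurable borel" "bounded_support \<psi>" "locally_bounded \<psi>"
  shows "integrable lborel (\<lambda>x. f x * \<psi> x)"
proof -
  have [measurable]: "f \<in> borel_measurable borel" using f by (simp add: L1loc_def)
  note [measurable] = \<psi>(1)
  obtain R where R: "\<And>x. norm x > R \<Longrightarrow> \<psi> x = 0"
    using bounded_supportE[OF \<psi>(2)] by blast
  obtain M where M: "\<And>x. \<bar>\<psi> x\<bar> \<le> M"
    using bounded_support_locally_bounded[OF \<psi>(2,3)] by blast
  have "integrable lborel (\<lambda>x. M * (indicator (cball 0 R) x * f x))"
    using f by (intro integrable_mult_right) (simp add: L1loc_def)
  then show ?thesis
  proof (rule Bochner_Integration.integrable_bound)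
    have "\<bar>f x * \<psi> x\<bar> \<le> \<bar>M * (indicator (cball 0 R) x * f x)\<bar>" for x
    proof (cases "norm x > R")
      case False
      have "\<bar>\<psi> x\<bar> \<le> \<bar>M\<bar>" using M[of x] by simp
      then show ?thesis using False by (simp add: abs_mult mult.commute[of "\<bar>f x\<bar>"] mult_right_mono)
    qed (simp add: R)
    then show "AE x in lborel. norm (f x * \<psi> x) \<le> norm (M * (indicator (cball 0 R) x * f x))"
      by simp
  qed measurable
qed

text \<open>Differentiability is asked along the single direction \<open>e\<close> and once only, so
  that the explicit radial cutoffs below qualify, although their second derivatives jump at radius
  R.\<close>

definition test_pair :: "'a::euclidean_space \<Rightarrow> ('a \<Rightarrow> real) \<Rightarrow> ('a \<Rightarrow> real) \<Rightarrow> bool" where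
  "test_pair e \<zeta> \<zeta>' \<longleftrightarrow> continuous_on UNIV \<zeta> \<and> continuous_on UNIV \<zeta>' \<and>
     bounded_support \<zeta> \<and> bounded_support \<zeta>' \<and>
     (\<forall>x s. ((\<lambda>s. \<zeta> (x + s *\<^sub>R e)) has_real_derivative \<zeta>' (x + s *\<^sub>R e)) (at s))"

lemma bounded_support_add:
  assumes "bounded_support f" "bounded_support g" shows "bounded_support (\<lambda>x. f x + g x)"
proof -
  have "{x. f x + g x \<noteq> 0} \<subseteq> {x. f x \<noteq> 0} \<union> {x. g x \<noteq> 0}" by auto
  then show ?thesis
    using assms unfolding bounded_support_def by (meson bounded_Un bounded_subset)
qed

lemma test_pair_add:
  "test_pair e f f' \<Longrightarrow> test_pair e g g' \<Longrightarrow> test_pair e (\<lambda>x. f x + g x) (\<lambda>x. f' x + g' x)"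
  unfolding test_pair_def by (auto intro: continuous_on_add bounded_support_add DERIV_add)

lemma test_pair_cmult:
  "test_pair e f f' \<Longrightarrow> test_pair e (\<lambda>x. c * f x) (\<lambda>x. c * f' x)"
  unfolding test_pair_def by (auto intro: continuous_on_mult_left bounded_support_mult DERIV_cmult)

text \<open>Comparing \<open>F (v (x + h e)) - F (v x)\<close> with its tangent bound for both signs of \<open>h\<close>
  gives the two inequalities, so that only weak convergence of the difference quotients is needed.\<close>

lemma convex_chain_rule_nonneg:
  fixes v :: "'a::euclidean_space \<Rightarrow> real"
  assumes v: "weak_dir_deriv e v g"
    and conv: "\<And>a b. F b - F a \<ge> f a * (b - a)"
    and fv: "L2loc (\<lambda>x. f (v x))" and Fv: "L1loc (\<lambda>x. F (v x))"
    and \<zeta>: "test_pair e \<zeta> \<zeta>'" and pos: "\<And>x. \<zeta> x \<ge> 0"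
  shows "(LBINT x. F (v x) * \<zeta>' x) = - (LBINT x. g x * (f (v x) * \<zeta> x))"
proof -
  have vL: "L2loc v" using v by (simp add: weak_dir_deriv_def)
  have cont: "continuous_on UNIV \<zeta>" "continuous_on UNIV \<zeta>'" and bs: "bounded_support \<zeta>" "bounded_support \<zeta>'"
    and D: "\<And>x s. ((\<lambda>s. \<zeta> (x + s *\<^sub>R e)) has_real_derivative \<zeta>' (x + s *\<^sub>R e)) (at s)"
    using \<zeta> by (auto simp: test_pair_def)
  have [measurable]: "(\<lambda>x. F (v x)) \<in> borel_measurable borel" using Fv by (simp add: L1loc_def)
  have [measurable]: "\<zeta> \<in> borel_measurable borel" "\<zeta>' \<in> borel_measurable borel"
    using cont by (auto intro: borel_measurable_continuous_onI)
  note [measurable] = vL[THEN L2loc_measurable] fv[THEN L2loc_measurable]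
  have w: "L2loc (\<lambda>x. f (v x) * \<zeta> x)" "bounded_support (\<lambda>x. f (v x) * \<zeta> x)"
    using cont by (auto intro: L2loc_mult_locally_bounded fv locally_bounded_continuous bounded_support_mult bs)
  define Q where "Q h = (LBINT x. (v (x + h *\<^sub>R e) - v x) / h * (f (v x) * \<zeta> x))" for h
  \<comment> \<open>The increment of F(v) with the translation moved to the test function: the
    argument is shifted by - h but the division is by h, hence the limit carries - \<zeta>'.\<close>
  define E where "E h = (LBINT x. F (v x) * ((\<zeta> (x + - h *\<^sub>R e) - \<zeta> x) / h))" for h
  have Q_lim: "(\<lambda>n. Q (X n)) \<longlonglongrightarrow> (LBINT x. g x * (f (v x) * \<zeta> x))"
    if "X \<longlonglongrightarrow> 0" "\<And>n. X n \<noteq> 0" for X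
    unfolding Q_def using v w that by (auto simp: weak_dir_deriv_def)
  have E_lim: "(\<lambda>n. E (X n)) \<longlonglongrightarrow> (LBINT x. F (v x) * (- \<zeta>' x))"
    if X: "X \<longlonglongrightarrow> 0" "\<And>n. X n \<noteq> 0" for X
  proof -
    obtain R where R: "\<And>x. norm x > R \<Longrightarrow> \<zeta> x = 0"
      using bounded_supportE[OF bs(1)] by blast
    obtain M where M: "\<And>x. \<bar>\<zeta>' x\<bar> \<le> M"
      using bounded_support_locally_bounded[OF bs(2) locally_bounded_continuous[OF cont(2)]] by blast
    obtain B where B: "B > 0" "\<And>n. norm (X n) \<le> B"
      using convergent_imp_Bseq[OF convergentI[OF X(1)]] by (auto elim: BseqE)
    let ?r = "R + B * norm e"
    show ?thesis
      unfolding E_def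
    proof (rule integral_dominated_convergence)
      show "integrable lborel (\<lambda>x. M * \<bar>indicator (cball 0 ?r) x * F (v x)\<bar>)"
        using Fv by (intro integrable_mult_right integrable_abs) (simp add: L1loc_def)
      have "(\<lambda>n. (\<zeta> (x + - X n *\<^sub>R e) - \<zeta> x) / X n) \<longlonglongrightarrow> - \<zeta>' x" for x
      proof -
        have "(\<lambda>h. (\<zeta> (x + h *\<^sub>R e) - \<zeta> x) / h) \<midarrow>0\<rightarrow> \<zeta>' x"
          using D[of x 0] by (simp add: DERIV_def)
        then have "((\<lambda>h. (\<zeta> (x + h *\<^sub>R e) - \<zeta> x) / h) \<circ> (\<lambda>n. - X n)) \<longlonglongrightarrow> \<zeta>' x"
          unfolding tendsto_at_iff_sequentially using X tendsto_minus[OF X(1)] by auto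
        from tendsto_minus[OF this] show ?thesis by (simp add: o_def)
      qed
      then show "AE x in lborel. (\<lambda>n. F (v x) * ((\<zeta> (x + - X n *\<^sub>R e) - \<zeta> x) / X n)) \<longlonglongrightarrow> F (v x) * (- \<zeta>' x)"
        by (intro AE_I2 tendsto_mult tendsto_const)
      fix n
      have "\<bar>F (v x) * ((\<zeta> (x + - X n *\<^sub>R e) - \<zeta> x) / X n)\<bar> \<le> M * \<bar>indicator (cball 0 ?r) x * F (v x)\<bar>" for x
      proof (cases "norm x > ?r")
        case True
        have "\<bar>X n\<bar> * norm e \<le> B * norm e" using B(2)[of n] by (intro mult_right_mono) auto
        then have "norm (x + - X n *\<^sub>R e) > R" "norm x > R"
          using True norm_diff_ineq[of x "- X n *\<^sub>R e"] mult_nonneg_nonneg[OF less_imp_le[OF B(1)], of "norm e"]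
          by auto
        then show ?thesis using True R by simp
      next
        case False
        have "\<bar>\<zeta> (x + - X n *\<^sub>R e) - \<zeta> (x + 0 *\<^sub>R e)\<bar> \<le> M * \<bar>- X n - 0\<bar>"
          using field_differentiable_bound[of UNIV "\<lambda>s. \<zeta> (x + s *\<^sub>R e)" "\<lambda>s. \<zeta>' (x + s *\<^sub>R e)" M 0 "- X n"] D M
          by auto
        then have "\<bar>(\<zeta> (x + - X n *\<^sub>R e) - \<zeta> x) / X n\<bar> \<le> M"
          using X(2)[of n] by (simp add: divide_le_eq)
        then have "\<bar>F (v x)\<bar> * \<bar>(\<zeta> (x + - X n *\<^sub>R e) - \<zeta> x) / X n\<bar> \<le> \<bar>F (v x)\<bar> * M"
          by (rule mult_left_mono) simp
        then show ?thesis using False by (simp add: abs_mult mult.commute)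
      qed
      then show "AE x in lborel. norm (F (v x) * ((\<zeta> (x + - X n *\<^sub>R e) - \<zeta> x) / X n))
          \<le> M * \<bar>indicator (cball 0 ?r) x * F (v x)\<bar>"
        by simp
    qed measurable
  qed
  have compare: "h * Q h \<le> h * E h" if "h \<noteq> 0" for h
  proof -
    have iQ: "integrable lborel (\<lambda>x. (v (x + h *\<^sub>R e) - v x) * (f (v x) * \<zeta> x))"
      by (intro integrable_L2loc_mult w L2loc_diff L2loc_shift vL)
    have i1: "integrable lborel (\<lambda>x. F (v x) * \<zeta> (x + a))" for a
    proof (rule integrable_L1loc_mult[OF Fv])
      show "bounded_support (\<lambda>x. \<zeta> (x + a))" by (rule bounded_support_shift[OF bs(1)])
      have "continuous_on UNIV (\<lambda>x. \<zeta> (x + a))"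
        by (rule continuous_on_compose2[OF cont(1)]) (auto intro: continuous_intros)
      then show "locally_bounded (\<lambda>x. \<zeta> (x + a))" by (rule locally_bounded_continuous)
    qed measurable
    have i0: "integrable lborel (\<lambda>x. F (v x) * \<zeta> x)" using i1[of 0] by simp
    have sh: "(LBINT x. F (v (x + h *\<^sub>R e)) * \<zeta> x) = (LBINT x. F (v x) * \<zeta> (x + - h *\<^sub>R e))"
      using lborel_integral_shift[of "\<lambda>x. F (v x) * \<zeta> (x + - h *\<^sub>R e)" "h *\<^sub>R e"] by simp
    have i2: "integrable lborel (\<lambda>x. F (v (x + h *\<^sub>R e)) * \<zeta> x)"
      using lborel_integrable_shift[of "\<lambda>x. F (v x) * \<zeta> (x + - h *\<^sub>R e)" "h *\<^sub>R e"] i1[of "- h *\<^sub>R e"] by simp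
    have "h * Q h = (LBINT x. (v (x + h *\<^sub>R e) - v x) * (f (v x) * \<zeta> x))"
      unfolding Q_def using that by (subst integral_mult_right_zero[symmetric]) simp
    also have "\<dots> \<le> (LBINT x. F (v (x + h *\<^sub>R e)) * \<zeta> x - F (v x) * \<zeta> x)"
    proof (rule integral_mono[OF iQ])
      show "integrable lborel (\<lambda>x. F (v (x + h *\<^sub>R e)) * \<zeta> x - F (v x) * \<zeta> x)"
        using i0 i2 by simp
      show "(v (x + h *\<^sub>R e) - v x) * (f (v x) * \<zeta> x) \<le> F (v (x + h *\<^sub>R e)) * \<zeta> x - F (v x) * \<zeta> x" for x
        using mult_right_mono[OF conv[of "v x" "v (x + h *\<^sub>R e)"] pos[of x]] by (simp add: algebra_simps)
    qed
    also have "\<dots> = (LBINT x. F (v x) * \<zeta> (x + - h *\<^sub>R e)) - (LBINT x. F (v x) * \<zeta> x)"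
      using i0 i2 sh by simp
    also have "\<dots> = (LBINT x. F (v x) * \<zeta> (x + - h *\<^sub>R e) - F (v x) * \<zeta> x)"
      by (rule Bochner_Integration.integral_diff[symmetric]) (rule i1 i0)+
    also have "\<dots> = h * E h"
    proof -
      have "F (v x) * \<zeta> (x + - h *\<^sub>R e) - F (v x) * \<zeta> x = h * (F (v x) * ((\<zeta> (x + - h *\<^sub>R e) - \<zeta> x) / h))" for x
        using that by (simp add: right_diff_distrib diff_divide_distrib)
      then show ?thesis unfolding E_def by simp
    qed
    finally show ?thesis .
  qed
  define X where "X n = inverse (real (Suc n))" for n
  have X: "X \<longlonglongrightarrow> 0" "\<And>n. X n > 0" unfolding X_def using LIMSEQ_inverse_real_of_nat by auto
  have "Q (X n) \<le> E (X n)" for n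
    using compare[of "X n"] X(2)[of n] by simp
  then have 1: "(LBINT x. g x * (f (v x) * \<zeta> x)) \<le> (LBINT x. F (v x) * (- \<zeta>' x))"
    using X by (intro LIMSEQ_le[OF Q_lim E_lim]) (auto simp: less_imp_neq[symmetric])
  have X': "(\<lambda>n. - X n) \<longlonglongrightarrow> 0" "\<And>n. - X n \<noteq> 0"
    using tendsto_minus[OF X(1)] X(2) by (auto simp: less_imp_neq[symmetric])
  have "E (- X n) \<le> Q (- X n)" for n
    using compare[of "- X n"] X(2)[of n] by simp
  then have 2: "(LBINT x. F (v x) * (- \<zeta>' x)) \<le> (LBINT x. g x * (f (v x) * \<zeta> x))"
    by (intro LIMSEQ_le[OF E_lim[OF X'] Q_lim[OF X']]) auto
  from 1 2 show ?thesis by simp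
qed

section \<open>Radial cutoffs of class C^1\<close>

definition cutoff :: "real \<Rightarrow> 'a::euclidean_space \<Rightarrow> real" where
  "cutoff R x = (max 0 (1 - (norm x)\<^sup>2 / R\<^sup>2))\<^sup>2"

definition cutoff_deriv :: "real \<Rightarrow> 'a::euclidean_space \<Rightarrow> 'a \<Rightarrow> real" where
  "cutoff_deriv R e x = - 4 * (x \<bullet> e) / R\<^sup>2 * max 0 (1 - (norm x)\<^sup>2 / R\<^sup>2)"

text \<open>Squaring removes the kink of the positive part at 0; this is why \<open>cutoff\<close>
  is a square.\<close>

lemma max_0_square_has_derivative: "((\<lambda>t::real. (max 0 t)\<^sup>2) has_real_derivative 2 * max 0 t) (at t)"
proof -
  consider "t > 0" | "t < 0" | "t = 0" by linarith
  then show ?thesis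
  proof cases
    case 1
    have "((\<lambda>t. t\<^sup>2) has_real_derivative 2 * max 0 t) (at t)"
      using 1 by (auto intro!: derivative_eq_intros)
    then show ?thesis
      by (rule has_field_derivative_transform_within_open[of _ _ _ "{0<..}"]) (use 1 in auto)
  next
    case 2
    have "((\<lambda>t. 0) has_real_derivative 2 * max 0 t) (at t)" using 2 by simp
    then show ?thesis
      by (rule has_field_derivative_transform_within_open[of _ _ _ "{..<0}"]) (use 2 in auto)
  next
    case 3
    have "((\<lambda>h::real. max 0 h) \<longlongrightarrow> 0) (at 0)"
      using tendsto_max[OF tendsto_const tendsto_ident_at, of 0 0] by simp
    then have "((\<lambda>h::real. ((max 0 (0 + h))\<^sup>2 - (max 0 0)\<^sup>2) / h) \<longlongrightarrow> 0) (at 0)"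
      by (rule Lim_transform_eventually)
        (auto simp: eventually_at_filter max_def power2_eq_square)
    with 3 show ?thesis by (simp add: DERIV_def)
  qed
qed

lemma cutoff_has_derivative:
  "((\<lambda>s. cutoff R (x + s *\<^sub>R e)) has_real_derivative cutoff_deriv R e (x + s *\<^sub>R e)) (at s)"
proof -
  have "((\<lambda>s. x \<bullet> x + 2 * s * (x \<bullet> e) + s * s * (e \<bullet> e)) has_real_derivative
      2 * ((x + s *\<^sub>R e) \<bullet> e)) (at s)"
    by (auto intro!: derivative_eq_intros simp: inner_add_left algebra_simps)
  moreover have "x \<bullet> x + 2 * s * (x \<bullet> e) + s * s * (e \<bullet> e) = (x + s *\<^sub>R e) \<bullet> (x + s *\<^sub>R e)" for s
    by (simp add: inner_add_left inner_add_right inner_commute)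
  ultimately have "((\<lambda>s. (x + s *\<^sub>R e) \<bullet> (x + s *\<^sub>R e)) has_real_derivative 2 * ((x + s *\<^sub>R e) \<bullet> e)) (at s)"
    by simp
  from DERIV_diff[OF DERIV_const[of 1] DERIV_cdivide[OF this, of "R\<^sup>2"]]
  have "((\<lambda>s. 1 - ((x + s *\<^sub>R e) \<bullet> (x + s *\<^sub>R e)) / R\<^sup>2) has_real_derivative
      - (2 * ((x + s *\<^sub>R e) \<bullet> e)) / R\<^sup>2) (at s)"
    by simp
  from DERIV_chain2[OF max_0_square_has_derivative this] show ?thesis
    by (simp add: cutoff_def cutoff_deriv_def power2_norm_eq_inner mult_ac)
qed

lemma cutoff_eq_0: "R > 0 \<Longrightarrow> norm x \<ge> R \<Longrightarrow> cutoff R x = 0" "R > 0 \<Longrightarrow> norm x \<ge> R \<Longrightarrow> cutoff_deriv R e x = 0"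
  by (auto simp: cutoff_def cutoff_deriv_def max_def divide_simps dest: power_mono[of R "norm x" 2])

lemma cutoff_test_pair:
  assumes "R > 0" shows "test_pair e (cutoff R) (cutoff_deriv R e)"
  unfolding test_pair_def
proof (intro conjI allI)
  show "continuous_on UNIV (cutoff R)" "continuous_on UNIV (cutoff_deriv R e)"
    using assms unfolding cutoff_def cutoff_deriv_def by (auto intro!: continuous_intros)
  show "bounded_support (cutoff R)" "bounded_support (cutoff_deriv R e)"
    by (auto intro!: bounded_supportI[of R] cutoff_eq_0[OF assms])
  show "((\<lambda>s. cutoff R (x + s *\<^sub>R e)) has_real_derivative cutoff_deriv R e (x + s *\<^sub>R e)) (at s)" for x s
    by (rule cutoff_has_derivative)
qed

lemma cutoff_bounds: "0 \<le> cutoff R x" "cutoff R x \<le> 1"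
  by (auto simp: cutoff_def power_le_one)

text \<open>Lets the sign condition be dropped from the chain rule: \<zeta> = (\<zeta> + c) - c is a
  difference of nonnegative test functions. With \<zeta> supported in the R-ball and bounded by M,
  the choice is 4 M \<open>cutoff (2 * R)\<close>, because that cutoff is at least 1/4 on the
  R-ball.\<close>

lemma test_pair_dominated:
  assumes "test_pair e \<zeta> \<zeta>'"
  obtains c c' where "test_pair e c c'" "\<And>x. c x \<ge> 0" "\<And>x. \<zeta> x + c x \<ge> 0"
proof -
  have \<zeta>: "bounded_support \<zeta>" "continuous_on UNIV \<zeta>" using assms by (auto simp: test_pair_def)
  obtain R where R: "R > 0" "\<And>x. norm x > R \<Longrightarrow> \<zeta> x = 0"
    using bounded_supportE[OF \<zeta>(1)] by blast
  obtain M where M: "\<And>x. \<bar>\<zeta> x\<bar> \<le> M"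
    using bounded_support_locally_bounded[OF \<zeta>(1) locally_bounded_continuous[OF \<zeta>(2)]] by blast
  have "M \<ge> 0" using M[of 0] by simp
  let ?c = "\<lambda>x. (4 * M) * cutoff (2 * R) x"
  show ?thesis
  proof (rule that)
    show "test_pair e ?c (\<lambda>x. (4 * M) * cutoff_deriv (2 * R) e x)"
      using R(1) by (intro test_pair_cmult cutoff_test_pair) simp
    show "?c x \<ge> 0" for x
      using mult_nonneg_nonneg[OF \<open>M \<ge> 0\<close> cutoff_bounds(1)[of "2 * R" x]] by simp
    show "\<zeta> x + ?c x \<ge> 0" for x
    proof (cases "norm x > R")
      case True
      then show ?thesis
        using R(2) mult_nonneg_nonneg[OF \<open>M \<ge> 0\<close> cutoff_bounds(1)[of "2 * R" x]] by simp
    next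
      case False
      then have "(norm x)\<^sup>2 \<le> R\<^sup>2" by (intro power_mono) auto
      then have "(norm x)\<^sup>2 / (2 * R)\<^sup>2 \<le> 1 / 4" using R(1) by (simp add: field_simps)
      then have "(1 / 2)\<^sup>2 \<le> cutoff (2 * R) x"
        unfolding cutoff_def by (intro power_mono) auto
      then have "M * (1 / 4) \<le> M * cutoff (2 * R) x"
        using \<open>M \<ge> 0\<close> by (intro mult_left_mono) (auto simp: power_divide)
      then show ?thesis using M[of x] by (auto simp: abs_le_iff)
    qed
  qed
qed

lemma integrable_L2loc_mult_test:
  assumes "L2loc f" "L2loc g" "continuous_on UNIV \<zeta>" "bounded_support \<zeta>"
  shows "integrable lborel (\<lambda>x. f x * (g x * \<zeta> x))"
  using assms by (intro integrable_L2loc_mult L2loc_mult_locally_bounded bounded_support_mult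
      locally_bounded_continuous borel_measurable_continuous_onI)

lemma convex_chain_rule:
  fixes v :: "'a::euclidean_space \<Rightarrow> real"
  assumes v: "weak_dir_deriv e v g"
    and conv: "\<And>a b. F b - F a \<ge> f a * (b - a)"
    and fv: "L2loc (\<lambda>x. f (v x))" and Fv: "L1loc (\<lambda>x. F (v x))"
    and \<zeta>: "test_pair e \<zeta> \<zeta>'"
  shows "(LBINT x. F (v x) * \<zeta>' x) = - (LBINT x. g x * (f (v x) * \<zeta> x))"
proof -
  obtain c c' where c: "test_pair e c c'" "\<And>x. c x \<ge> 0" "\<And>x. \<zeta> x + c x \<ge> 0"
    using test_pair_dominated[OF \<zeta>] by blast
  have gL: "L2loc g" using v by (simp add: weak_dir_deriv_def)
  have i: "integrable lborel (\<lambda>x. F (v x) * \<xi>' x)" "integrable lborel (\<lambda>x. g x * (f (v x) * \<xi> x))"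
    if "test_pair e \<xi> \<xi>'" for \<xi> \<xi>'
    using that unfolding test_pair_def
    by (auto intro!: integrable_L1loc_mult integrable_L2loc_mult_test Fv gL fv
        locally_bounded_continuous borel_measurable_continuous_onI)
  note rule = convex_chain_rule_nonneg[OF v conv fv Fv]
  show ?thesis
    using rule[OF c(1,2)] rule[OF test_pair_add[OF \<zeta> c(1)] c(3)] i[OF \<zeta>] i[OF c(1)]
    by (simp add: distrib_left)
qed

text \<open>The chain rule for t^2, applied to v, w and v + w, and subtracted. The product v w is in
  general only in \<open>L1loc\<close>, so the rule is stated in tested form.\<close>

lemma product_rule:
  assumes v: "weak_dir_deriv e v g" and w: "weak_dir_deriv e w k" and \<zeta>: "test_pair e \<zeta> \<zeta>'"
  shows "(LBINT x. v x * (w x * \<zeta>' x))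
    = - (LBINT x. g x * (w x * \<zeta> x)) - (LBINT x. k x * (v x * \<zeta> x))"
proof -
  have L: "L2loc v" "L2loc g" "L2loc w" "L2loc k"
    using v w by (auto simp: weak_dir_deriv_def)
  have sq: "(LBINT x. (u x)\<^sup>2 * \<zeta>' x) = - (LBINT x. j x * ((2 * u x) * \<zeta> x))"
    if "weak_dir_deriv e u j" for u j
  proof (rule convex_chain_rule[OF that _ _ _ \<zeta>, where F = "\<lambda>t. t\<^sup>2" and f = "\<lambda>t. 2 * t"])
    show "2 * a * (b - a) \<le> b\<^sup>2 - a\<^sup>2" for a b :: real
      using sum_squares_bound[of a b] by (simp add: algebra_simps power2_eq_square)
    have "L2loc u" using that by (simp add: weak_dir_deriv_def)
    then show "L2loc (\<lambda>x. 2 * u x)" "L1loc (\<lambda>x. (u x)\<^sup>2)"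
      using L2loc_mult_L1loc[of u u] by (auto intro: L2loc_cmult simp: power2_eq_square)
  qed
  have i: "integrable lborel (\<lambda>x. f x * (h x * \<zeta> x))" "integrable lborel (\<lambda>x. f x * (h x * \<zeta>' x))"
    if "L2loc f" "L2loc h" for f h
    using that \<zeta> by (auto intro: integrable_L2loc_mult_test simp: test_pair_def)
  note s = sq[OF weak_dir_deriv_add[OF v w]] sq[OF v] sq[OF w]
  have "(LBINT x. (v x + w x)\<^sup>2 * \<zeta>' x)
      = (LBINT x. (v x)\<^sup>2 * \<zeta>' x) + (LBINT x. (w x)\<^sup>2 * \<zeta>' x) + 2 * (LBINT x. v x * (w x * \<zeta>' x))"
  proof -
    have "(v x + w x)\<^sup>2 * \<zeta>' x = v x * (v x * \<zeta>' x) + w x * (w x * \<zeta>' x) + 2 * (v x * (w x * \<zeta>' x))" for x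
      by (simp add: power2_eq_square algebra_simps)
    then show ?thesis
      using i(2)[OF L(1,1)] i(2)[OF L(3,3)] i(2)[OF L(1,3)]
      by (simp add: power2_eq_square mult.assoc)
  qed
  moreover have "(LBINT x. (g x + k x) * ((2 * (v x + w x)) * \<zeta> x))
      = (LBINT x. g x * ((2 * v x) * \<zeta> x)) + (LBINT x. k x * ((2 * w x) * \<zeta> x))
       + 2 * (LBINT x. g x * (w x * \<zeta> x)) + 2 * (LBINT x. k x * (v x * \<zeta> x))"
  proof -
    have "(g x + k x) * ((2 * (v x + w x)) * \<zeta> x)
      = g x * ((2 * v x) * \<zeta> x) + k x * ((2 * w x) * \<zeta> x) + 2 * (g x * (w x * \<zeta> x)) + 2 * (k x * (v x * \<zeta> x))" for x
      by (simp add: algebra_simps)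
    then show ?thesis
      using i(1)[OF L(2) L2loc_cmult[OF L(1), of 2]] i(1)[OF L(4) L2loc_cmult[OF L(3), of 2]] i(1)[OF L(2,3)] i(1)[OF L(4,1)]
      by simp
  qed
  ultimately show ?thesis using s by linarith
qed

text \<open>The tangent inequality for |t|^(p+1)/(p+1). It amounts to bounding |a|^p |b|, and this
  is Young's inequality with the conjugate exponents (p+1)/p and p+1.\<close>

lemma power_subgradient:
  fixes a b p :: real assumes "p > 0"
  shows "\<bar>a\<bar> powr (p - 1) * a * (b - a) \<le> \<bar>b\<bar> powr (p + 1) / (p + 1) - \<bar>a\<bar> powr (p + 1) / (p + 1)"
proof (cases "a = 0")
  case False
  have a1: "\<bar>a\<bar> powr (p - 1) * (a * a) = \<bar>a\<bar> powr (p + 1)"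
  proof -
    have "a * a = \<bar>a\<bar> powr 2" using False by (simp add: power2_eq_square)
    then show ?thesis by (simp only: powr_add[symmetric]) (simp add: add.commute)
  qed
  have "\<bar>a\<bar> powr (p - 1) * a * b \<le> \<bar>\<bar>a\<bar> powr (p - 1) * a * b\<bar>" by simp
  also have "\<dots> = \<bar>a\<bar> powr p * \<bar>b\<bar>"
    using powr_add[of "\<bar>a\<bar>" "p - 1" 1] False by (simp add: abs_mult)
  also have "\<dots> \<le> (\<bar>a\<bar> powr p) powr ((p + 1) / p) / ((p + 1) / p) + \<bar>b\<bar> powr (p + 1) / (p + 1)"
    using assms by (intro Youngs_inequality) (auto simp: field_simps)
  also have "(\<bar>a\<bar> powr p) powr ((p + 1) / p) = \<bar>a\<bar> powr (p + 1)"
    using assms by (simp add: powr_powr)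
  finally have "\<bar>a\<bar> powr (p - 1) * a * b \<le> p * \<bar>a\<bar> powr (p + 1) / (p + 1) + \<bar>b\<bar> powr (p + 1) / (p + 1)"
    by (simp add: mult.commute)
  moreover have "p * \<bar>a\<bar> powr (p + 1) / (p + 1) - \<bar>a\<bar> powr (p + 1) = - (\<bar>a\<bar> powr (p + 1) / (p + 1))"
    using assms by (simp add: field_simps)
  ultimately show ?thesis
    using a1 by (simp add: right_diff_distrib mult.assoc)
qed (use assms in simp)

section \<open>The Newtonian potential\<close>

lemma has_integral_inverse_sqrt: "((\<lambda>t. t powr (- 1 / 2)) has_integral 2) {0..1::real}"
  using has_integral_powr_from_0[of "- 1 / 2" 1] by simp

lemma nn_integral_inverse_sqrt:
  "(\<integral>\<^sup>+t. ennreal (\<bar>t\<bar> powr (- 1 / 2)) * indicator {-1..1::real} t \<partial>lborel) < \<infinity>"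
proof -
  let ?f = "\<lambda>t::real. ennreal (\<bar>t\<bar> powr (- 1 / 2))"
  have "(\<integral>\<^sup>+t. ennreal (t powr (- 1 / 2)) * indicator {0..1} t \<partial>(lborel :: real measure)) = ennreal 2"
    by (rule nn_integral_has_integral_lebesgue'[OF _ has_integral_inverse_sqrt]) auto
  moreover have "?f t * indicator {0..1} t = ennreal (t powr (- 1 / 2)) * indicator {0..1} t" for t
    by (auto simp: indicator_def)
  ultimately have 1: "(\<integral>\<^sup>+t. ?f t * indicator {0..1} t \<partial>lborel) = ennreal 2" by simp
  have 2: "(\<integral>\<^sup>+t. ?f t * indicator {-1..0} t \<partial>lborel) = (\<integral>\<^sup>+t. ?f t * indicator {0..1} t \<partial>lborel)"
    by (subst nn_integral_real_affine[of _ "-1" 0])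
      (auto intro!: nn_integral_cong simp: indicator_def)
  have "(\<integral>\<^sup>+t. ?f t * indicator {-1..1} t \<partial>lborel)
      \<le> (\<integral>\<^sup>+t. ?f t * indicator {-1..0} t + ?f t * indicator {0..1} t \<partial>lborel)"
    by (intro nn_integral_mono) (auto simp: indicator_def)
  also have "\<dots> = (\<integral>\<^sup>+t. ?f t * indicator {-1..0} t \<partial>lborel) + (\<integral>\<^sup>+t. ?f t * indicator {0..1} t \<partial>lborel)"
    by (rule nn_integral_add) measurable
  also have "\<dots> < \<infinity>" unfolding 1 2 by (simp add: ennreal_add_less_top)
  finally show ?thesis .
qed

text \<open>As \<open>0 powr a = 0\<close>, the comparison of |z|^(-1/2) with |z_i|^(-1/2) fails on
  the coordinate hyperplanes; these are null sets.\<close>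

lemma AE_coordinates_nonzero: "AE x in lborel. \<forall>b\<in>Basis. (x :: 'a::euclidean_space) \<bullet> b \<noteq> 0"
proof -
  have "AE x in lborel. (x :: 'a) \<bullet> b \<noteq> 0" if "b \<in> Basis" for b
  proof -
    have "{x. x \<bullet> b = 0} \<in> null_sets lebesgue"
      using negligible_standard_hyperplane[OF that, of 0] by (simp add: negligible_iff_null_sets)
    then have "AE x in lebesgue. x \<bullet> b \<noteq> 0"
      by (rule AE_I') auto
    then show ?thesis by (simp add: AE_completion_iff)
  qed
  then show ?thesis by (intro AE_finite_allI) auto
qed

text \<open>On the unit ball \<open>|z| \<ge> |z\<^sub>i|\<close> for each \<open>i\<close>, so that \<open>|z|\<^sup>-\<^sup>3\<^sup>/\<^sup>2\<close> is bounded by the product of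
  the \<open>|z\<^sub>i|\<^sup>-\<^sup>1\<^sup>/\<^sup>2\<close>.\<close>

lemma nn_integral_kernel_ball:
  "(\<integral>\<^sup>+z. ennreal (norm z powr (- 3 / 2)) * indicator (cball 0 1) z \<partial>(lborel :: (real^3) measure)) < \<infinity>"
proof -
  let ?f = "\<lambda>t::real. ennreal (\<bar>t\<bar> powr (- 1 / 2)) * indicator {-1..1::real} t"
  have "(\<integral>\<^sup>+z. ennreal (norm z powr (- 3 / 2)) * indicator (cball 0 1) z \<partial>(lborel :: (real^3) measure))
      \<le> (\<integral>\<^sup>+z. (\<Prod>b\<in>Basis. ?f (z \<bullet> b)) \<partial>(lborel :: (real^3) measure))"
  proof (rule nn_integral_mono_AE)
    show "AE z in (lborel :: (real^3) measure).
        ennreal (norm z powr (- 3 / 2)) * indicator (cball 0 1) z \<le> (\<Prod>b\<in>Basis. ?f (z \<bullet> b))"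
      using AE_coordinates_nonzero
    proof eventually_elim
      case (elim z)
      show ?case
      proof (cases "z \<in> cball 0 1")
        case True
        have z0: "z \<noteq> 0" using elim SOME_Basis by force
        have "ennreal (norm z powr (- 3 / 2)) = ennreal (\<Prod>b\<in>(Basis :: (real^3) set). norm z powr (- 1 / 2))"
          using z0 powr_power[of "norm z" "- 1 / 2" 3] by simp
        also have "\<dots> \<le> ennreal (\<Prod>b\<in>Basis. \<bar>z \<bullet> b\<bar> powr (- 1 / 2))"
          using elim by (intro ennreal_leI prod_mono conjI powr_mono2') (auto simp: Basis_le_norm)
        also have "\<dots> = (\<Prod>b\<in>Basis. ennreal (\<bar>z \<bullet> b\<bar> powr (- 1 / 2)))"
          by (rule prod_ennreal[symmetric]) simp
        also have "\<dots> = (\<Prod>b\<in>Basis. ?f (z \<bullet> b))"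
        proof (rule prod.cong[OF refl])
          fix b :: "real^3" assume "b \<in> Basis"
          then have "\<bar>z \<bullet> b\<bar> \<le> 1" using True Basis_le_norm[of b z] by simp
          then show "ennreal (\<bar>z \<bullet> b\<bar> powr (- 1 / 2)) = ?f (z \<bullet> b)"
            by (auto simp: abs_le_iff)
        qed
        finally show ?thesis using True by simp
      qed simp
    qed
  qed
  also have "\<dots> = (\<Prod>b\<in>(Basis :: (real^3) set). \<integral>\<^sup>+t. ?f t \<partial>lborel)"
    by (rule nn_integral_lborel_prod) auto
  also have "\<dots> < \<infinity>"
    using nn_integral_inverse_sqrt by (simp add: power_less_top_ennreal)
  finally show ?thesis .
qed

section \<open>The Coulomb potential and the energy, without the factor 1/(4 pi)\<close>

definition potential :: "(real^3 \<Rightarrow> real) \<Rightarrow> real^3 \<Rightarrow> real" where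
  "potential u x = (LBINT y. (u y)\<^sup>2 / norm (x - y))"

locale coulomb =
  fixes u :: "real^3 \<Rightarrow> real"
  assumes u_meas [measurable]: "u \<in> borel_measurable borel"
    and u6: "integrable lborel (\<lambda>x. (u x) ^ 6)"
    and energy: "(\<integral>\<^sup>+y. (\<integral>\<^sup>+x. ennreal ((u x)\<^sup>2 * (u y)\<^sup>2 / norm (x - y)) \<partial>lborel) \<partial>lborel) < \<infinity>"
    and nontrivial: "\<not> (AE x in lborel. u x = 0)"
begin

text \<open>By finiteness of the energy u(y)^2 times the potential at y is finite for almost every
  y, and u is nonzero on a set that is not null; at a common point u(y)^2 can be divided
  out.\<close>

lemma ex_finite_potential:
  obtains x0 where "(\<integral>\<^sup>+y. ennreal ((u y)\<^sup>2 / norm (x0 - y)) \<partial>lborel) < \<infinity>"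
proof -
  have "AE y in lborel. (\<integral>\<^sup>+x. ennreal ((u x)\<^sup>2 * (u y)\<^sup>2 / norm (x - y)) \<partial>lborel) \<noteq> \<infinity>"
    using energy by (intro nn_integral_PInf_AE) auto
  with nontrivial obtain y where y: "u y \<noteq> 0"
    and fin: "(\<integral>\<^sup>+x. ennreal ((u x)\<^sup>2 * (u y)\<^sup>2 / norm (x - y)) \<partial>lborel) \<noteq> \<infinity>"
    by (metis (mono_tags, lifting) AE_mp AE_I2)
  have "(\<integral>\<^sup>+x. ennreal ((u x)\<^sup>2 / norm (y - x)) \<partial>lborel)
      = (\<integral>\<^sup>+x. ennreal (1 / (u y)\<^sup>2) * ennreal ((u x)\<^sup>2 * (u y)\<^sup>2 / norm (x - y)) \<partial>lborel)"
    using y by (intro nn_integral_cong) (simp add: ennreal_mult'[symmetric] norm_minus_commute)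
  also have "\<dots> = ennreal (1 / (u y)\<^sup>2) * (\<integral>\<^sup>+x. ennreal ((u x)\<^sup>2 * (u y)\<^sup>2 / norm (x - y)) \<partial>lborel)"
    by (rule nn_integral_cmult) measurable
  also have "\<dots> < \<infinity>" using fin by (simp add: ennreal_mult_less_top top.not_eq_extremum)
  finally show ?thesis using that by blast
qed

text \<open>One point \<open>x0\<close> of finite potential controls all others. Within distance 1
  of x the kernel is absorbed by u^6 and the integrable |z|^(-3/2); farther away |x0 - y| \<le> (1 +
  |x0 - x|) |x - y| compares it with the kernel centred at \<open>x0\<close>.\<close>

lemma kernel_split:
  fixes a :: real assumes "y \<noteq> (x0 :: real^3)"
  shows "a\<^sup>2 / norm (x - y) \<le> a ^ 6 + norm (x - y) powr (- 3 / 2) * indicator (cball 0 1) (y - x)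
    + (1 + norm (x0 - x)) * (a\<^sup>2 / norm (x0 - y))"
proof (cases "norm (x - y) \<le> 1")
  case True
  define r where "r = norm (x - y)"
  \<comment> \<open>Either 1/r \<le> a^4, and then a^2/r \<le> a^6, or a^2 < r^(-1/2), and then
    a^2/r \<le> r^(-3/2). For r = 0 the left side is 0 by the convention on division.\<close>
  have "a\<^sup>2 / r \<le> a ^ 6 + r powr (- 3 / 2)"
  proof (cases "r = 0 \<or> 1 / r \<le> (a\<^sup>2)\<^sup>2")
    case True
    moreover have "a\<^sup>2 / r \<le> a ^ 6" if "1 / r \<le> (a\<^sup>2)\<^sup>2"
    proof -
      have "a\<^sup>2 * (1 / r) \<le> a\<^sup>2 * (a\<^sup>2)\<^sup>2" using that by (intro mult_left_mono) auto
      also have "\<dots> = a ^ 6" by (simp add: power_mult[symmetric] power_add[symmetric])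
      finally show ?thesis by simp
    qed
    ultimately show ?thesis by (auto intro: add_increasing2)
  next
    case False
    then have r: "r > 0" and "(a\<^sup>2)\<^sup>2 < 1 / r" by (auto simp: r_def)
    then have "a\<^sup>2 < sqrt (1 / r)" by (simp add: real_less_rsqrt)
    also have "sqrt (1 / r) = r powr (- 1 / 2)"
      using r by (simp add: powr_half_sqrt[symmetric] powr_minus_divide powr_divide)
    finally have "a\<^sup>2 / r \<le> r powr (- 1 / 2) / r" using r by (intro divide_right_mono) auto
    also have "\<dots> = r powr (- 3 / 2)"
      using r powr_diff[of r "- 1 / 2" 1] by simp
    finally show ?thesis by (simp add: add_increasing)
  qed
  moreover have "0 \<le> (1 + norm (x0 - x)) * (a\<^sup>2 / norm (x0 - y))" by simp
  moreover have "indicator (cball 0 1) (y - x) = (1 :: real)"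
    using True by (simp add: norm_minus_commute)
  ultimately show ?thesis unfolding r_def by (simp only: mult_1_right)
next
  case False
  have "norm (x0 - y) \<le> norm (x0 - x) + norm (x - y)" using norm_triangle_ineq[of "x0 - x" "x - y"] by simp
  also have "\<dots> \<le> norm (x0 - x) * norm (x - y) + norm (x - y)"
    using False mult_left_mono[of 1 "norm (x - y)" "norm (x0 - x)"] by simp
  finally have "norm (x0 - y) \<le> (1 + norm (x0 - x)) * norm (x - y)" by (simp add: algebra_simps)
  then have "1 / norm (x - y) \<le> (1 + norm (x0 - x)) / norm (x0 - y)"
  proof -
    have "norm (x - y) > 0" "norm (x0 - y) > 0" using assms False by auto
    then show ?thesis
      using \<open>norm (x0 - y) \<le> (1 + norm (x0 - x)) * norm (x - y)\<close>
      by (simp add: divide_simps del: zero_less_norm_iff)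
  qed
  then have "a\<^sup>2 * (1 / norm (x - y)) \<le> a\<^sup>2 * ((1 + norm (x0 - x)) / norm (x0 - y))"
    by (intro mult_left_mono) auto
  moreover have "a\<^sup>2 * ((1 + norm (x0 - x)) / norm (x0 - y)) = (1 + norm (x0 - x)) * (a\<^sup>2 / norm (x0 - y))"
    by simp
  moreover have "0 \<le> a ^ 6" by simp
  moreover have "norm (x - y) powr (- 3 / 2) * indicator (cball 0 1) (y - x) = 0"
    using False by (simp add: norm_minus_commute)
  moreover have "a\<^sup>2 * (1 / norm (x - y)) = a\<^sup>2 / norm (x - y)" by simp
  ultimately show ?thesis by linarith
qed

text \<open>Integrating \<open>kernel_split\<close> over y; the growth linear in |x| comes from the
  factor 1 + |x0 - x| of the far part.\<close>

lemma potential_finite: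
  obtains A B where "A \<ge> 0" "B \<ge> 0"
    "\<And>x. (\<integral>\<^sup>+y. ennreal ((u y)\<^sup>2 / norm (x - y)) \<partial>lborel) \<le> ennreal (A + B * norm x)"
proof -
  obtain x0 where x0: "(\<integral>\<^sup>+y. ennreal ((u y)\<^sup>2 / norm (x0 - y)) \<partial>lborel) < \<infinity>"
    using ex_finite_potential by blast
  let ?K = "\<integral>\<^sup>+z. ennreal (norm z powr (- 3 / 2)) * indicator (cball 0 1) z \<partial>(lborel :: (real^3) measure)"
  obtain K where K: "?K = ennreal K" "K \<ge> 0"
    using nn_integral_kernel_ball by (cases ?K) auto
  obtain W where W: "(\<integral>\<^sup>+y. ennreal ((u y)\<^sup>2 / norm (x0 - y)) \<partial>lborel) = ennreal W" "W \<ge> 0"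
    using x0 by (cases "\<integral>\<^sup>+y. ennreal ((u y)\<^sup>2 / norm (x0 - y)) \<partial>lborel") auto
  define U where "U = (LBINT x. (u x) ^ 6)"
  have U: "(\<integral>\<^sup>+x. ennreal ((u x) ^ 6) \<partial>lborel) = ennreal U" "U \<ge> 0"
    unfolding U_def using u6 by (auto intro!: nn_integral_eq_integral integral_nonneg_AE)
  show ?thesis
  proof (rule that)
    show "U + K + (1 + norm x0) * W \<ge> 0" "W \<ge> 0" using U K W by auto
    fix x :: "real^3"
    have shift: "(\<integral>\<^sup>+y. ennreal (norm (x - y) powr (- 3 / 2)) * indicator (cball 0 1) (y - x) \<partial>lborel) = ?K"
    proof -
      have "(\<integral>\<^sup>+y. ennreal (norm (x - y) powr (- 3 / 2)) * indicator (cball 0 1) (y - x) \<partial>lborel)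
          = (\<integral>\<^sup>+y. ennreal (norm (x - y) powr (- 3 / 2)) * indicator (cball 0 1) (y - x) \<partial>(distr lborel borel ((+) x)))"
        by (simp add: lborel_distr_plus)
      also have "\<dots> = (\<integral>\<^sup>+y. ennreal (norm (x - (x + y)) powr (- 3 / 2)) * indicator (cball 0 1) (x + y - x) \<partial>lborel)"
        by (rule nn_integral_distr) measurable
      finally show ?thesis by simp
    qed
    have "(\<integral>\<^sup>+y. ennreal ((u y)\<^sup>2 / norm (x - y)) \<partial>lborel)
        \<le> (\<integral>\<^sup>+y. ennreal ((u y) ^ 6) + ennreal (norm (x - y) powr (- 3 / 2)) * indicator (cball 0 1) (y - x)
             + ennreal (1 + norm (x0 - x)) * ennreal ((u y)\<^sup>2 / norm (x0 - y)) \<partial>lborel)"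
    proof (rule nn_integral_mono_AE)
      show "AE y in lborel. ennreal ((u y)\<^sup>2 / norm (x - y))
        \<le> ennreal ((u y) ^ 6) + ennreal (norm (x - y) powr (- 3 / 2)) * indicator (cball 0 1) (y - x)
             + ennreal (1 + norm (x0 - x)) * ennreal ((u y)\<^sup>2 / norm (x0 - y))"
        using AE_lborel_singleton[of x0]
      proof eventually_elim
        case (elim y)
        have "ennreal ((u y)\<^sup>2 / norm (x - y)) \<le> ennreal ((u y) ^ 6
            + norm (x - y) powr (- 3 / 2) * indicator (cball 0 1) (y - x)
            + (1 + norm (x0 - x)) * ((u y)\<^sup>2 / norm (x0 - y)))"
          using elim by (intro ennreal_leI kernel_split)
        also have "\<dots> = ennreal ((u y) ^ 6) + ennreal (norm (x - y) powr (- 3 / 2)) * indicator (cball 0 1) (y - x)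
             + ennreal (1 + norm (x0 - x)) * ennreal ((u y)\<^sup>2 / norm (x0 - y))"
        proof -
          have "ennreal (norm (x - y) powr (- 3 / 2) * indicator (cball 0 1) (y - x))
              = ennreal (norm (x - y) powr (- 3 / 2)) * indicator (cball 0 1) (y - x)"
            by (simp add: indicator_def)
          moreover have "ennreal ((1 + norm (x0 - x)) * ((u y)\<^sup>2 / norm (x0 - y)))
              = ennreal (1 + norm (x0 - x)) * ennreal ((u y)\<^sup>2 / norm (x0 - y))"
            by (rule ennreal_mult) auto
          ultimately show ?thesis
            by (subst ennreal_plus, simp, simp, subst ennreal_plus) (simp_all add: zero_le_even_power)
        qed
        finally show ?case .
      qed
    qed
    also have "\<dots> = ennreal U + ennreal K + ennreal (1 + norm (x0 - x)) * ennreal W"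
    proof -
      let ?f = "\<lambda>y. ennreal (norm (x - y) powr (- 3 / 2)) * indicator (cball 0 1) (y - x)"
      have "(\<integral>\<^sup>+y. ennreal ((u y) ^ 6) + ?f y + ennreal (1 + norm (x0 - x)) * ennreal ((u y)\<^sup>2 / norm (x0 - y)) \<partial>lborel)
        = (\<integral>\<^sup>+y. ennreal ((u y) ^ 6) + ?f y \<partial>lborel)
          + (\<integral>\<^sup>+y. ennreal (1 + norm (x0 - x)) * ennreal ((u y)\<^sup>2 / norm (x0 - y)) \<partial>lborel)"
        by (rule nn_integral_add) measurable
      also have "(\<integral>\<^sup>+y. ennreal ((u y) ^ 6) + ?f y \<partial>lborel) = (\<integral>\<^sup>+y. ennreal ((u y) ^ 6) \<partial>lborel) + (\<integral>\<^sup>+y. ?f y \<partial>lborel)"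
        by (rule nn_integral_add) measurable
      also have "(\<integral>\<^sup>+y. ennreal (1 + norm (x0 - x)) * ennreal ((u y)\<^sup>2 / norm (x0 - y)) \<partial>lborel)
          = ennreal (1 + norm (x0 - x)) * (\<integral>\<^sup>+y. ennreal ((u y)\<^sup>2 / norm (x0 - y)) \<partial>lborel)"
        by (rule nn_integral_cmult) measurable
      finally show ?thesis by (simp only: U(1) K(1) W(1) shift)
    qed
    also have "\<dots> = ennreal (U + K + (1 + norm (x0 - x)) * W)"
    proof -
      have "ennreal ((1 + norm (x0 - x)) * W) = ennreal (1 + norm (x0 - x)) * ennreal W"
        using W by (intro ennreal_mult) auto
      then show ?thesis
        using U(2) K(2) W(2) by (subst ennreal_plus, simp, simp, subst ennreal_plus) simp_all
    qed
    also have "\<dots> \<le> ennreal (U + K + (1 + norm x0) * W + W * norm x)"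
    proof (rule ennreal_leI)
      have "norm (x0 - x) * W \<le> (norm x0 + norm x) * W"
        using W(2) by (intro mult_right_mono norm_triangle_ineq4)
      then show "U + K + (1 + norm (x0 - x)) * W \<le> U + K + (1 + norm x0) * W + W * norm x"
        by (simp add: algebra_simps)
    qed
    finally show "(\<integral>\<^sup>+y. ennreal ((u y)\<^sup>2 / norm (x - y)) \<partial>lborel)
      \<le> ennreal (U + K + (1 + norm x0) * W + W * norm x)" .
  qed
qed

lemma kernel_integrable: "integrable lborel (\<lambda>y. (u y)\<^sup>2 / norm (x - y))"
proof (rule integrableI_bounded)
  show "(\<integral>\<^sup>+y. ennreal (norm ((u y)\<^sup>2 / norm (x - y))) \<partial>lborel) < \<infinity>"
  proof -
    obtain A B where "(\<integral>\<^sup>+y. ennreal ((u y)\<^sup>2 / norm (x - y)) \<partial>lborel) \<le> ennreal (A + B * norm x)"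
      using potential_finite by blast
    then show ?thesis by (simp add: le_less_trans[OF _ ennreal_less_top])
  qed
qed measurable

lemma nn_integral_potential:
  "(\<integral>\<^sup>+y. ennreal ((u y)\<^sup>2 / norm (x - y)) \<partial>lborel) = ennreal (potential u x)"
  unfolding potential_def by (rule nn_integral_eq_integral[OF kernel_integrable]) auto

lemma potential_nonneg: "potential u x \<ge> 0"
  unfolding potential_def by (intro integral_nonneg_AE) auto

lemma potential_measurable [measurable]: "potential u \<in> borel_measurable borel"
  unfolding potential_def[abs_def] by measurable

lemma potential_locally_bounded: "locally_bounded (potential u)"
  unfolding locally_bounded_def
proof
  fix R
  obtain A B where AB: "A \<ge> 0" "B \<ge> 0"
    "\<And>x. (\<integral>\<^sup>+y. ennreal ((u y)\<^sup>2 / norm (x - y)) \<partial>lborel) \<le> ennreal (A + B * norm x)"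
    using potential_finite by blast
  have "\<bar>potential u x\<bar> \<le> A + B * R" if "x \<in> cball 0 R" for x
  proof -
    have "potential u x \<le> A + B * norm x"
      using AB(3)[of x] AB(1,2) unfolding nn_integral_potential by (subst (asm) ennreal_le_iff) auto
    also have "\<dots> \<le> A + B * R" using that AB(2) by (simp add: mult_left_mono)
    finally show ?thesis using potential_nonneg[of x] by simp
  qed
  then show "\<exists>M. \<forall>x\<in>cball 0 R. \<bar>potential u x\<bar> \<le> M" by blast
qed

text \<open>Tonelli and Fubini for the kernel. Every double integral below is dominated through it,
  with the single integral against \<open>potential u\<close> as the only condition to
  check.\<close>

lemma potential_weighted:
  assumes [measurable]: "f \<in> borel_measurable borel" and "integrable lborel (\<lambda>x. f x * potential u x)"
  shows "integrable lborel2 (\<lambda>(x, y). f x * ((u y)\<^sup>2 / norm (x - y)))"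
    and "(\<integral>(x, y). f x * ((u y)\<^sup>2 / norm (x - y)) \<partial>lborel2) = (LBINT x. f x * potential u x)"
proof -
  show i: "integrable lborel2 (\<lambda>(x, y). f x * ((u y)\<^sup>2 / norm (x - y)))"
  proof (rule lborel_pair.Fubini_integrable)
    have "(LBINT y. norm (f x * ((u y)\<^sup>2 / norm (x - y)))) = \<bar>f x * potential u x\<bar>" for x
      unfolding potential_def by (simp add: abs_mult integral_nonneg_AE del: times_divide_eq_right)
    then show "integrable lborel (\<lambda>x. LBINT y. norm (case (x, y) of (x, y) \<Rightarrow> f x * ((u y)\<^sup>2 / norm (x - y))))"
      using assms(2) by simp
    show "AE x in lborel. integrable lborel (\<lambda>y. case (x, y) of (x, y) \<Rightarrow> f x * ((u y)\<^sup>2 / norm (x - y)))"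
      using kernel_integrable by (simp del: times_divide_eq_right)
  qed measurable
  from lborel_pair.integral_fst'[OF i]
  show "(\<integral>(x, y). f x * ((u y)\<^sup>2 / norm (x - y)) \<partial>lborel2) = (LBINT x. f x * potential u x)"
    by (simp add: potential_def del: times_divide_eq_right)
qed

lemma energy_integrable: "integrable lborel (\<lambda>x. (u x)\<^sup>2 * potential u x)"
proof (rule integrableI_bounded)
  have "(\<integral>\<^sup>+x. ennreal (norm ((u x)\<^sup>2 * potential u x)) \<partial>lborel)
      = (\<integral>\<^sup>+y. (\<integral>\<^sup>+x. ennreal ((u x)\<^sup>2 * (u y)\<^sup>2 / norm (x - y)) \<partial>lborel) \<partial>lborel)"
  proof (rule nn_integral_cong)
    fix y
    have "(\<integral>\<^sup>+x. ennreal ((u x)\<^sup>2 * (u y)\<^sup>2 / norm (x - y)) \<partial>lborel)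
        = (\<integral>\<^sup>+x. ennreal ((u y)\<^sup>2) * ennreal ((u x)\<^sup>2 / norm (y - x)) \<partial>lborel)"
      by (intro nn_integral_cong) (simp add: ennreal_mult'[symmetric] norm_minus_commute mult_ac)
    also have "\<dots> = ennreal ((u y)\<^sup>2) * ennreal (potential u y)"
      by (subst nn_integral_cmult) (simp_all add: nn_integral_potential)
    finally show "ennreal (norm ((u y)\<^sup>2 * potential u y)) = (\<integral>\<^sup>+x. ennreal ((u x)\<^sup>2 * (u y)\<^sup>2 / norm (x - y)) \<partial>lborel)"
      by (simp add: ennreal_mult' potential_nonneg abs_mult)
  qed
  then show "(\<integral>\<^sup>+x. ennreal (norm ((u x)\<^sup>2 * potential u x)) \<partial>lborel) < \<infinity>"
    using energy by simp
qed measurable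

text \<open>The energy without the factor 1/(4 pi) of phi_u; the Coulomb term of the equation is
  therefore \<open>D / (4 * pi)\<close> in both identities.\<close>

definition "D = (LBINT x. (u x)\<^sup>2 * potential u x)"

lemma D_nonneg: "D \<ge> 0"
  unfolding D_def by (intro integral_nonneg_AE) (auto simp: potential_nonneg)

text \<open>Two points of the R-ball are at distance at most 2 R, so for x in the ball the mass m of
  u^2 there is at most 2 R times the potential at x. Integrating this against u^2 over the ball
  gives m^2 on the left and the energy on the right.\<close>

lemma mass_bound:
  assumes uL: "L2loc u" and "R > 0"
  shows "(LBINT x. indicator (cball 0 R) x * (u x)\<^sup>2)\<^sup>2 \<le> 2 * R * D"
proof -
  define m where "m = (LBINT x. indicator (cball 0 R) x * (u x)\<^sup>2)"
  have i: "integrable lborel (\<lambda>x. indicator (cball 0 R) x * (u x)\<^sup>2)"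
    using uL by (simp add: L2loc_def)
  have le: "m \<le> 2 * R * potential u x" if x: "x \<in> cball 0 R" for x
  proof -
    have "m \<le> (LBINT y. 2 * R * ((u y)\<^sup>2 / norm (x - y)))"
      unfolding m_def
    proof (rule integral_mono_AE[OF i])
      show "integrable lborel (\<lambda>y. 2 * R * ((u y)\<^sup>2 / norm (x - y)))"
        by (intro integrable_mult_right kernel_integrable)
      show "AE y in lborel. indicator (cball 0 R) y * (u y)\<^sup>2 \<le> 2 * R * ((u y)\<^sup>2 / norm (x - y))"
        using AE_lborel_singleton[of x]
      proof eventually_elim
        case (elim y)
        show ?case
        proof (cases "y \<in> cball 0 R")
          case True
          then have "norm (x - y) \<le> 2 * R" using x norm_triangle_ineq4[of x y] by simp
          then have "(u y)\<^sup>2 * norm (x - y) \<le> (u y)\<^sup>2 * (2 * R)" by (intro mult_left_mono) auto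
          then show ?thesis using True elim by (simp add: field_simps)
        next
          case False
          then show ?thesis using \<open>R > 0\<close> by simp
        qed
      qed
    qed
    then show ?thesis by (simp add: potential_def del: times_divide_eq_right)
  qed
  have "m * m = (LBINT x. m * (indicator (cball 0 R) x * (u x)\<^sup>2))"
    using i by (simp add: m_def)
  also have "\<dots> \<le> (LBINT x. 2 * R * ((u x)\<^sup>2 * potential u x))"
  proof (rule integral_mono)
    show "integrable lborel (\<lambda>x. m * (indicator (cball 0 R) x * (u x)\<^sup>2))"
      using i by simp
    show "integrable lborel (\<lambda>x. 2 * R * ((u x)\<^sup>2 * potential u x))"
      using energy_integrable by simp
    show "m * (indicator (cball 0 R) x * (u x)\<^sup>2) \<le> 2 * R * ((u x)\<^sup>2 * potential u x)" for x
    proof (cases "x \<in> cball 0 R")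
      case True
      then show ?thesis
        using mult_right_mono[OF le[OF True], of "(u x)\<^sup>2"] by (simp add: mult_ac)
    next
      case False
      then show ?thesis using \<open>R > 0\<close> potential_nonneg[of x] by simp
    qed
  qed
  also have "\<dots> = 2 * R * D" using energy_integrable by (simp add: D_def)
  finally show ?thesis by (simp add: m_def power2_eq_square)
qed

lemma D_pos:
  assumes uL: "L2loc u" shows "D > 0"
proof (rule ccontr)
  assume "\<not> D > 0"
  then have D0: "D = 0" using D_nonneg by simp
  have "AE x in lborel. indicator (cball 0 (real (Suc n))) x * (u x)\<^sup>2 = 0" for n
  proof -
    have "(LBINT x. indicator (cball 0 (real (Suc n))) x * (u x)\<^sup>2) = 0"
      using mass_bound[OF uL, of "real (Suc n)"] D0 by simp
    moreover have "integrable lborel (\<lambda>x. indicator (cball 0 (real (Suc n))) x * (u x)\<^sup>2)"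
      using uL unfolding L2loc_def by blast
    ultimately show ?thesis
      by (subst (asm) integral_nonneg_eq_0_iff_AE) auto
  qed
  then have "AE x in lborel. \<forall>n. indicator (cball 0 (real (Suc n))) x * (u x)\<^sup>2 = 0"
    unfolding AE_all_countable by blast
  then have "AE x in lborel. u x = 0"
  proof eventually_elim
    case (elim x)
    obtain n where "norm x \<le> real n" using real_arch_simple by blast
    then show ?case using elim[rule_format, of n] by (simp add: indicator_def)
  qed
  with nontrivial show False by blast
qed

end

section \<open>The radial vector field and its cutoffs\<close>

lemma test_pair_mult:
  assumes \<zeta>: "test_pair e \<zeta> \<zeta>'" and a: "continuous_on UNIV a" "continuous_on UNIV a'"
    and D: "\<And>x s. ((\<lambda>s. a (x + s *\<^sub>R e)) has_real_derivative a' (x + s *\<^sub>R e)) (at s)"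
  shows "test_pair e (\<lambda>x. a x * \<zeta> x) (\<lambda>x. a' x * \<zeta> x + a x * \<zeta>' x)"
  using \<zeta> a D unfolding test_pair_def
  by (auto intro!: continuous_intros bounded_support_add bounded_support_mult derivative_eq_intros)

text \<open>The derivative along \<open>e\<close> of the j-th component of the cut-off radial field,
  \<open>x $ j * cutoff R x\<close>.\<close>

definition field_deriv :: "real \<Rightarrow> real^'n::finite \<Rightarrow> 'n \<Rightarrow> real^'n \<Rightarrow> real" where
  "field_deriv R e j x = e $ j * cutoff R x + x $ j * cutoff_deriv R e x"

lemma field_test_pair:
  assumes "R > 0" shows "test_pair e (\<lambda>x. x $ j * cutoff R x) (field_deriv R e j)"
proof -
  have "((\<lambda>s. (x + s *\<^sub>R e) $ j) has_real_derivative e $ j) (at s)" for x s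
    by (auto intro!: derivative_eq_intros)
  from test_pair_mult[OF cutoff_test_pair[OF assms] _ _ this] show ?thesis
    unfolding field_deriv_def[abs_def] by (simp add: continuous_intros)
qed

text \<open>The first bound is scale invariant and keeps the derivative of the field bounded
  uniformly in R; the second decays like 1/R and makes the error in the Nehari identity
  vanish.\<close>

lemma cutoff_deriv_bounds:
  fixes x e :: "'a::euclidean_space"
  assumes "R > 0"
  shows "norm x * \<bar>cutoff_deriv R e x\<bar> \<le> 4 * norm e" "\<bar>cutoff_deriv R e x\<bar> \<le> 4 / R * norm e"
proof -
  define m where "m = max 0 (1 - (norm x)\<^sup>2 / R\<^sup>2)"
  have m: "0 \<le> m" "m \<le> 1" by (auto simp: m_def)
  have le: "\<bar>cutoff_deriv R e x\<bar> \<le> 4 * (norm x * norm e) / R\<^sup>2 * m"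
    unfolding cutoff_deriv_def m_def[symmetric] using m Cauchy_Schwarz_ineq2[of x e]
    by (auto simp: abs_mult intro!: mult_right_mono divide_right_mono)
  show "norm x * \<bar>cutoff_deriv R e x\<bar> \<le> 4 * norm e"
  proof (cases "norm x \<le> R")
    case True
    then have "(norm x)\<^sup>2 / R\<^sup>2 * m \<le> 1 * 1"
      using assms m by (intro mult_mono) (auto simp: divide_le_eq power_mono)
    have "norm x * \<bar>cutoff_deriv R e x\<bar> \<le> norm x * (4 * (norm x * norm e) / R\<^sup>2 * m)"
      using le by (rule mult_left_mono) simp
    also have "\<dots> = 4 * norm e * ((norm x)\<^sup>2 / R\<^sup>2 * m)" by (simp add: power2_eq_square)
    also have "\<dots> \<le> 4 * norm e * 1" using \<open>(norm x)\<^sup>2 / R\<^sup>2 * m \<le> 1 * 1\<close> by (intro mult_left_mono) auto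
    finally show ?thesis by simp
  next
    case False
    then show ?thesis using cutoff_eq_0(2)[OF assms, of x e] by simp
  qed
  show "\<bar>cutoff_deriv R e x\<bar> \<le> 4 / R * norm e"
  proof (cases "norm x \<le> R")
    case True
    have "4 * (norm x * norm e) / R\<^sup>2 * m \<le> 4 * (R * norm e) / R\<^sup>2 * 1"
      using True m assms by (intro mult_mono divide_right_mono mult_left_mono mult_right_mono) auto
    also have "\<dots> = 4 / R * norm e" using assms by (simp add: power2_eq_square)
    finally show ?thesis using le by linarith
  next
    case False
    then show ?thesis using cutoff_eq_0(2)[OF assms, of x e] assms by simp
  qed
qed

text \<open>5 = 1 + 4: the cutoff itself is at most 1, and its derivative times |x| is at most 4.
  The independence of R provides the majorants for R -> \<infinity>.\<close>

lemma field_deriv_bound: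
  assumes "R > 0" shows "\<bar>field_deriv R e j x\<bar> \<le> 5 * norm e"
proof -
  have "\<bar>e $ j * cutoff R x\<bar> \<le> norm e * 1"
    unfolding abs_mult using component_le_norm_cart[of e j] cutoff_bounds[of R x]
    by (intro mult_mono) auto
  moreover have "\<bar>x $ j * cutoff_deriv R e x\<bar> \<le> norm x * \<bar>cutoff_deriv R e x\<bar>"
    unfolding abs_mult using component_le_norm_cart[of x j] by (rule mult_right_mono) simp
  ultimately show ?thesis
    using cutoff_deriv_bounds(1)[OF assms, of x e] unfolding field_deriv_def by linarith
qed

lemma field_lipschitz:
  fixes x y :: "real^'n::finite"
  assumes "R > 0" shows "\<bar>x $ j * cutoff R x - y $ j * cutoff R y\<bar> \<le> 5 * norm (x - y)"
proof -
  let ?f = "\<lambda>s. (y + s *\<^sub>R (x - y)) $ j * cutoff R (y + s *\<^sub>R (x - y))"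
  have "norm (?f 1 - ?f 0) \<le> 5 * norm (x - y) * norm (1 - 0 :: real)"
  proof (rule field_differentiable_bound[of UNIV])
    show "(?f has_field_derivative field_deriv R (x - y) j (y + s *\<^sub>R (x - y))) (at s within UNIV)" for s
      using field_test_pair[OF assms, of "x - y" j] by (simp add: test_pair_def)
    show "norm (field_deriv R (x - y) j (y + s *\<^sub>R (x - y))) \<le> 5 * norm (x - y)" for s
      using field_deriv_bound[OF assms] by simp
  qed auto
  then show ?thesis by simp
qed

lemma cutoff_tendsto:
  "(\<lambda>n. cutoff (real (Suc n)) x) \<longlonglongrightarrow> 1" "(\<lambda>n. cutoff_deriv (real (Suc n)) e x) \<longlonglongrightarrow> 0"
proof -
  have inv: "(\<lambda>n. c / (real (Suc n))\<^sup>2) \<longlonglongrightarrow> 0" for c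
  proof -
    have "(\<lambda>n. c * (inverse (real (Suc n)))\<^sup>2) \<longlonglongrightarrow> c * 0\<^sup>2"
      by (intro tendsto_intros LIMSEQ_inverse_real_of_nat)
    then show ?thesis by (simp add: divide_inverse power_inverse)
  qed
  have "(\<lambda>n. (max 0 (1 - (norm x)\<^sup>2 / (real (Suc n))\<^sup>2))\<^sup>2) \<longlonglongrightarrow> (max 0 (1 - 0))\<^sup>2"
    by (intro tendsto_intros inv)
  then show "(\<lambda>n. cutoff (real (Suc n)) x) \<longlonglongrightarrow> 1" by (simp add: cutoff_def)
  have "(\<lambda>n. (- 4 * (x \<bullet> e)) / (real (Suc n))\<^sup>2 * max 0 (1 - (norm x)\<^sup>2 / (real (Suc n))\<^sup>2)) \<longlonglongrightarrow> 0 * max 0 (1 - 0)"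
    by (intro tendsto_intros inv)
  then show "(\<lambda>n. cutoff_deriv (real (Suc n)) e x) \<longlonglongrightarrow> 0" by (simp add: cutoff_deriv_def)
qed

lemma field_deriv_tendsto: "(\<lambda>n. field_deriv (real (Suc n)) e j x) \<longlonglongrightarrow> e $ j"
proof -
  have "(\<lambda>n. field_deriv (real (Suc n)) e j x) \<longlonglongrightarrow> e $ j * 1 + x $ j * 0"
    unfolding field_deriv_def by (intro tendsto_intros cutoff_tendsto)
  then show ?thesis by simp
qed

lemma cutoff_measurable [measurable]: "cutoff R \<in> borel_measurable borel"
  unfolding cutoff_def[abs_def] by measurable

lemma cutoff_deriv_measurable [measurable]: "cutoff_deriv R e \<in> borel_measurable borel"
  unfolding cutoff_deriv_def[abs_def] by measurable

lemma field_deriv_measurable [measurable]: "field_deriv R e j \<in> borel_measurable borel"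
  unfolding field_deriv_def[abs_def] by measurable

lemma integral_cutoff_tendsto:
  fixes h :: "real^'n::finite \<Rightarrow> real"
  assumes "integrable lborel h"
  shows "(\<lambda>n. LBINT x. h x * cutoff (real (Suc n)) x) \<longlonglongrightarrow> (LBINT x. h x)"
proof (rule integral_dominated_convergence)
  have [measurable]: "h \<in> borel_measurable borel" using assms by (simp add: integrable_iff_bounded)
  show "h \<in> borel_measurable lborel" "(\<lambda>x. h x * cutoff (real (Suc n)) x) \<in> borel_measurable lborel" for n
    by measurable
  show "integrable lborel (\<lambda>x. \<bar>h x\<bar>)" using assms by simp
  show "AE x in lborel. (\<lambda>n. h x * cutoff (real (Suc n)) x) \<longlonglongrightarrow> h x"
  proof (rule AE_I2)
    fix x
    have "(\<lambda>n. h x * cutoff (real (Suc n)) x) \<longlonglongrightarrow> h x * 1"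
      by (intro tendsto_intros cutoff_tendsto)
    then show "(\<lambda>n. h x * cutoff (real (Suc n)) x) \<longlonglongrightarrow> h x" by simp
  qed
  show "AE x in lborel. norm (h x * cutoff (real (Suc n)) x) \<le> \<bar>h x\<bar>" for n
  proof (rule AE_I2)
    fix x
    show "norm (h x * cutoff (real (Suc n)) x) \<le> \<bar>h x\<bar>"
      using mult_left_le[of "cutoff (real (Suc n)) x" "\<bar>h x\<bar>"] cutoff_bounds[of "real (Suc n)" x]
      by (simp add: abs_mult del: of_nat_Suc)
  qed
qed

lemma integral_field_deriv_tendsto:
  fixes h :: "real^'n::finite \<Rightarrow> real"
  assumes "integrable lborel h"
  shows "(\<lambda>n. LBINT x. h x * field_deriv (real (Suc n)) e j x) \<longlonglongrightarrow> e $ j * (LBINT x. h x)"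
proof -
  have [measurable]: "h \<in> borel_measurable borel" using assms by (simp add: integrable_iff_bounded)
  have "(\<lambda>n. LBINT x. h x * field_deriv (real (Suc n)) e j x) \<longlonglongrightarrow> (LBINT x. h x * e $ j)"
  proof (rule integral_dominated_convergence)
    show "integrable lborel (\<lambda>x. \<bar>h x\<bar> * (5 * norm e))" using assms by simp
    show "AE x in lborel. (\<lambda>n. h x * field_deriv (real (Suc n)) e j x) \<longlonglongrightarrow> h x * e $ j"
      by (intro AE_I2 tendsto_intros field_deriv_tendsto)
    show "AE x in lborel. norm (h x * field_deriv (real (Suc n)) e j x) \<le> \<bar>h x\<bar> * (5 * norm e)" for n
      by (intro AE_I2) (simp add: abs_mult mult_left_mono field_deriv_bound del: of_nat_Suc)
  qed measurable
  then show ?thesis by (simp add: mult.commute)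
qed

section \<open>Regularised Coulomb kernel\<close>

text \<open>Bounded by 1/d and below 1/|z|, so that the energy dominates uniformly in d. Its
  derivative along e is -(z . e) times its cube, which is the origin of the third powers
  below.\<close>

definition ker :: "real \<Rightarrow> 'a::euclidean_space \<Rightarrow> real" where
  "ker d z = 1 / sqrt ((norm z)\<^sup>2 + d\<^sup>2)"

lemma ker_bounds:
  assumes "d > 0"
  shows "ker d z > 0" "norm z * ker d z \<le> 1" "ker d z \<le> 1 / d" "z \<noteq> 0 \<Longrightarrow> ker d z \<le> 1 / norm z"
proof -
  have pos: "sqrt ((norm z)\<^sup>2 + d\<^sup>2) > 0" using assms by (simp add: add_nonneg_pos)
  then show "ker d z > 0" by (simp add: ker_def)
  have z: "norm z \<le> sqrt ((norm z)\<^sup>2 + d\<^sup>2)" by (rule real_le_rsqrt) simp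
  then show "norm z * ker d z \<le> 1" using pos by (simp add: ker_def)
  have "d \<le> sqrt ((norm z)\<^sup>2 + d\<^sup>2)" by (rule real_le_rsqrt) simp
  then show "ker d z \<le> 1 / d" using assms pos unfolding ker_def by (intro divide_left_mono) auto
  show "ker d z \<le> 1 / norm z" if "z \<noteq> 0"
    using z pos that unfolding ker_def by (intro divide_left_mono) auto
qed

lemma ker_measurable [measurable]: "ker d \<in> borel_measurable borel"
  unfolding ker_def[abs_def] by measurable

lemma ker_continuous: "d > 0 \<Longrightarrow> continuous_on UNIV (ker d)"
  unfolding ker_def[abs_def]
  by (intro continuous_intros) (auto simp: add_nonneg_eq_0_iff)

lemma ker_has_derivative:
  assumes "d > 0"
  shows "((\<lambda>s. ker d (z + s *\<^sub>R e)) has_real_derivative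
    - ((z + s *\<^sub>R e) \<bullet> e) * ker d (z + s *\<^sub>R e) ^ 3) (at s)"
proof -
  let ?q = "\<lambda>s. z \<bullet> z + 2 * s * (z \<bullet> e) + s * s * (e \<bullet> e) + d\<^sup>2"
  have q: "?q s = (norm (z + s *\<^sub>R e))\<^sup>2 + d\<^sup>2" for s
    by (simp add: power2_norm_eq_inner inner_add_left inner_add_right inner_commute)
  have pos: "?q s > 0" for s unfolding q using assms by (simp add: add_nonneg_pos)
  have "((\<lambda>s. inverse (sqrt (?q s))) has_real_derivative
      - (inverse (sqrt (?q s)) ^ 2 * (inverse (sqrt (?q s)) / 2 * (2 * (z \<bullet> e) + 2 * s * (e \<bullet> e))))) (at s)"
    using pos[of s] real_sqrt_gt_zero[OF pos[of s]]
    by (auto intro!: derivative_eq_intros simp: power2_eq_square)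
  then have "((\<lambda>s. ker d (z + s *\<^sub>R e)) has_real_derivative
      - (inverse (sqrt (?q s)) ^ 2 * (inverse (sqrt (?q s)) / 2 * (2 * (z \<bullet> e) + 2 * s * (e \<bullet> e))))) (at s)"
    unfolding q ker_def by (simp add: inverse_eq_divide)
  also have "- (inverse (sqrt (?q s)) ^ 2 * (inverse (sqrt (?q s)) / 2 * (2 * (z \<bullet> e) + 2 * s * (e \<bullet> e))))
      = - ((z + s *\<^sub>R e) \<bullet> e) * inverse (sqrt (?q s)) ^ 3"
  proof -
    have "- (r\<^sup>2 * (r / 2 * (2 * a + 2 * s * b))) = - (a + s * b) * r ^ 3" for r a b :: real
      by (simp add: power2_eq_square power3_eq_cube algebra_simps)
    then show ?thesis by (simp only: inner_add_left inner_scaleR_left)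
  qed
  also have "inverse (sqrt (?q s)) = ker d (z + s *\<^sub>R e)"
    unfolding q ker_def by (simp add: inverse_eq_divide)
  finally show ?thesis .
qed

lemma ker_tendsto:
  assumes "z \<noteq> 0" shows "(\<lambda>n. ker (inverse (real (Suc n))) z) \<longlonglongrightarrow> 1 / norm z"
proof -
  have "(\<lambda>n. 1 / sqrt ((norm z)\<^sup>2 + (inverse (real (Suc n)))\<^sup>2)) \<longlonglongrightarrow> 1 / sqrt ((norm z)\<^sup>2 + 0\<^sup>2)"
    using assms by (intro tendsto_intros LIMSEQ_inverse_real_of_nat) auto
  then show ?thesis by (simp add: ker_def)
qed

lemma AE_pair_neq: "AE z in lborel2. fst z \<noteq> (snd z :: 'a::euclidean_space)"
proof (rule lborel_pair.AE_pair_measure)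
  show "{z \<in> space lborel2. fst z \<noteq> (snd z :: 'a)} \<in> sets lborel2"
    by measurable
  show "AE x in lborel. AE y in lborel. fst (x, y) \<noteq> (snd (x, y) :: 'a)"
  proof (rule AE_I2)
    fix x :: 'a show "AE y in lborel. fst (x, y) \<noteq> snd (x, y)"
      using AE_lborel_singleton[of x] by eventually_elim auto
  qed
qed

section \<open>Nehari and Pohozaev identities\<close>

context coulomb
begin

text \<open>Dominated convergence with majorant |C| |f(x)| u(y)^2 / |x - y|. Bounds and limits are
  asked off the diagonal, a null set. The lemma serves both d -> 0 and R -> \<infinity>.\<close>

lemma weighted_kernel_limit:
  fixes g :: "nat \<Rightarrow> real^3 \<Rightarrow> real^3 \<Rightarrow> real" and g0 :: "real^3 \<Rightarrow> real^3 \<Rightarrow> real"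
  assumes f [measurable]: "f \<in> borel_measurable borel" and fi: "integrable lborel (\<lambda>x. f x * potential u x)"
    and [measurable]: "\<And>n. (\<lambda>(x, y). g n x y) \<in> borel_measurable (borel \<Otimes>\<^sub>M borel)"
      "(\<lambda>(x, y). g0 x y) \<in> borel_measurable (borel \<Otimes>\<^sub>M borel)"
    and bound: "\<And>n x y. x \<noteq> y \<Longrightarrow> \<bar>g n x y\<bar> \<le> C / norm (x - y)"
    and lim: "\<And>x y. x \<noteq> y \<Longrightarrow> (\<lambda>n. g n x y) \<longlonglongrightarrow> g0 x y"
  shows "integrable lborel2 (\<lambda>(x, y). f x * (g n x y * (u y)\<^sup>2))"
    and "(\<lambda>n. \<integral>(x, y). f x * (g n x y * (u y)\<^sup>2) \<partial>lborel2)
      \<longlonglongrightarrow> (\<integral>(x, y). f x * (g0 x y * (u y)\<^sup>2) \<partial>lborel2)"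
proof -
  let ?w = "\<lambda>(x, y). \<bar>C\<bar> * \<bar>f x * ((u y)\<^sup>2 / norm (x - y))\<bar>"
  have m: "(\<lambda>(x, y). f x * (g0 x y * (u y)\<^sup>2)) \<in> borel_measurable lborel2"
    "(\<lambda>(x, y). f x * (g n x y * (u y)\<^sup>2)) \<in> borel_measurable lborel2" for n
    by measurable
  have w: "integrable lborel2 ?w"
    using integrable_mult_right[OF integrable_abs[OF potential_weighted(1)[OF f fi]], of "\<bar>C\<bar>"]
    by (simp add: case_prod_unfold)
  have l: "AE z in lborel2. (\<lambda>n. case z of (x, y) \<Rightarrow> f x * (g n x y * (u y)\<^sup>2))
      \<longlonglongrightarrow> (case z of (x, y) \<Rightarrow> f x * (g0 x y * (u y)\<^sup>2))"
    using AE_pair_neq by eventually_elim (auto intro!: tendsto_intros lim simp: case_prod_beta)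
  have b: "AE z in lborel2. norm (case z of (x, y) \<Rightarrow> f x * (g n x y * (u y)\<^sup>2)) \<le> ?w z" for n
    using AE_pair_neq
  proof eventually_elim
    case (elim z)
    obtain x y where z: "z = (x, y)" by (cases z)
    then have "\<bar>g n x y\<bar> \<le> C / norm (x - y)" using bound elim by auto
    also have "\<dots> \<le> \<bar>C\<bar> / norm (x - y)" by (intro divide_right_mono) auto
    finally have "\<bar>f x\<bar> * (\<bar>g n x y\<bar> * (u y)\<^sup>2) \<le> \<bar>f x\<bar> * (\<bar>C\<bar> / norm (x - y) * (u y)\<^sup>2)"
      by (intro mult_left_mono mult_right_mono) auto
    then show ?case by (simp add: z abs_mult mult_ac)
  qed
  show "integrable lborel2 (\<lambda>(x, y). f x * (g n x y * (u y)\<^sup>2))"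
    by (rule integrable_dominated_convergence2[OF m w l b])
  show "(\<lambda>n. \<integral>(x, y). f x * (g n x y * (u y)\<^sup>2) \<partial>lborel2)
      \<longlonglongrightarrow> (\<integral>(x, y). f x * (g0 x y * (u y)\<^sup>2) \<partial>lborel2)"
    by (rule integral_dominated_convergence[OF m w l b])
qed

lemma weighted_kernel_integrable:
  fixes g :: "real^3 \<Rightarrow> real^3 \<Rightarrow> real"
  assumes "f \<in> borel_measurable borel" "integrable lborel (\<lambda>x. f x * potential u x)"
    and "(\<lambda>(x, y). g x y) \<in> borel_measurable (borel \<Otimes>\<^sub>M borel)"
    and "\<And>x y. x \<noteq> y \<Longrightarrow> \<bar>g x y\<bar> \<le> C / norm (x - y)"
  shows "integrable lborel2 (\<lambda>(x, y). f x * (g x y * (u y)\<^sup>2))"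
  by (rule weighted_kernel_limit(1)[where g = "\<lambda>_. g" and ?g0.0 = g, OF assms(1-3,3,4) tendsto_const])

end

text \<open>\<open>G\<close> is the gradient and \<open>H i j\<close> the derivative of
  \<open>G i\<close> in direction j. The equation is assumed pointwise almost everywhere, so that it
  can be tested with functions built from \<open>G\<close>, which are not smooth. Global square
  integrability of \<open>G\<close> comes from D^(1,2); the second derivatives are controlled only
  locally.\<close>

locale pohozaev = coulomb u for u :: "real^3 \<Rightarrow> real" +
  fixes G :: "3 \<Rightarrow> real^3 \<Rightarrow> real" and H :: "3 \<Rightarrow> 3 \<Rightarrow> real^3 \<Rightarrow> real" and p \<mu> :: real
  assumes du: "\<And>i. weak_dir_deriv (axis i 1) u (G i)"
    and dG: "\<And>i j. weak_dir_deriv (axis j 1) (G i) (H i j)"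
    and H_sym: "\<And>i j. AE x in lborel. H i j x = H j i x"
    and G2: "\<And>i. integrable lborel (\<lambda>x. (G i x)\<^sup>2)"
    and eq: "AE x in lborel. - (\<Sum>i\<in>UNIV. H i i x) + potential u x / (4 * pi) * u x
       = \<mu> * (\<bar>u x\<bar> powr (p - 1) * u x)"
    and p: "p \<ge> 5" and mu: "\<mu> > 0"
begin

lemma L2loc_uGH: "L2loc u" "L2loc (G i)" "L2loc (H i j)"
  using du dG by (auto simp: weak_dir_deriv_def)

lemmas uGH_meas [measurable] = L2loc_uGH[THEN L2loc_measurable]

definition "A = (\<Sum>i\<in>UNIV. LBINT x. (G i x)\<^sup>2)"

lemma L2loc_nonlinearity: "L2loc (\<lambda>x. \<bar>u x\<bar> powr (p - 1) * u x)"
proof (rule L2loc_AE_eq)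
  let ?r = "\<lambda>x. 1 / \<mu> * ((\<Sum>i\<in>UNIV. (-1) * H i i x) + 1 / (4 * pi) * (u x * potential u x))"
  show "L2loc ?r"
    by (intro L2loc_cmult L2loc_add L2loc_sum L2loc_uGH L2loc_mult_locally_bounded
        potential_measurable potential_locally_bounded)
  show "AE x in lborel. ?r x = \<bar>u x\<bar> powr (p - 1) * u x"
    using eq by eventually_elim (use mu in \<open>auto simp: field_simps sum_negf\<close>)
qed measurable

lemma tested_equation:
  assumes w: "L2loc w" "bounded_support w"
  shows "- (\<Sum>i\<in>UNIV. LBINT x. H i i x * w x)
      + (LBINT x. potential u x * u x * w x) / (4 * pi)
    = \<mu> * (LBINT x. \<bar>u x\<bar> powr (p - 1) * u x * w x)"
proof -
  note [measurable] = w(1)[THEN L2loc_measurable]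
  have i1: "integrable lborel (\<lambda>x. H i i x * w x)" for i
    by (intro integrable_L2loc_mult L2loc_uGH w)
  have i2: "integrable lborel (\<lambda>x. potential u x * u x * w x)"
    by (intro integrable_L2loc_mult L2loc_uGH w L2loc_mult_locally_bounded
        potential_measurable potential_locally_bounded)
  have i3: "integrable lborel (\<lambda>x. \<bar>u x\<bar> powr (p - 1) * u x * w x)"
    by (intro integrable_L2loc_mult L2loc_nonlinearity w)
  have "- (\<Sum>i\<in>UNIV. LBINT x. H i i x * w x) + (LBINT x. potential u x * u x * w x) / (4 * pi)
     = (LBINT x. - (\<Sum>i\<in>UNIV. H i i x * w x) + potential u x * u x * w x / (4 * pi))"
    using i1 i2 by (simp add: Bochner_Integration.integral_sum Bochner_Integration.integrable_sum)
  also have "\<dots> = (LBINT x. \<mu> * (\<bar>u x\<bar> powr (p - 1) * u x * w x))"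
  proof (rule integral_cong_AE)
    show "AE x in lborel. - (\<Sum>i\<in>UNIV. H i i x * w x) + potential u x * u x * w x / (4 * pi)
        = \<mu> * (\<bar>u x\<bar> powr (p - 1) * u x * w x)"
      using eq
    proof eventually_elim
      case (elim x)
      have "\<mu> * (\<bar>u x\<bar> powr (p - 1) * u x * w x) = (\<mu> * (\<bar>u x\<bar> powr (p - 1) * u x)) * w x" by simp
      also have "\<dots> = (- (\<Sum>i\<in>UNIV. H i i x) + potential u x / (4 * pi) * u x) * w x"
        by (simp only: elim)
      also have "\<dots> = - (\<Sum>i\<in>UNIV. H i i x * w x) + potential u x * u x * w x / (4 * pi)"
        by (simp add: left_diff_distrib sum_distrib_right)
      finally show ?case by (rule sym)
    qed
  qed measurable
  also have "\<dots> = \<mu> * (LBINT x. \<bar>u x\<bar> powr (p - 1) * u x * w x)"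
    by simp
  finally show ?thesis .
qed

lemma nonlinearity_mult: "\<bar>u x\<bar> powr (p - 1) * u x * u x = \<bar>u x\<bar> powr (p + 1)"
proof (cases "u x = 0")
  case False
  have "u x * u x = \<bar>u x\<bar> powr 2" using False by (simp add: power2_eq_square)
  then have "\<bar>u x\<bar> powr (p - 1) * u x * u x = \<bar>u x\<bar> powr (p - 1) * \<bar>u x\<bar> powr 2" by simp
  then show ?thesis by (simp only: powr_add[symmetric]) (simp add: add.commute)
qed simp

lemma nehari_local:
  assumes "R > 0"
  shows "(\<Sum>i\<in>UNIV. LBINT x. (G i x)\<^sup>2 * cutoff R x)
      + (\<Sum>i\<in>UNIV. LBINT x. G i x * (u x * cutoff_deriv R (axis i 1) x))
      + (LBINT x. (u x)\<^sup>2 * potential u x * cutoff R x) / (4 * pi)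
    = \<mu> * (LBINT x. \<bar>u x\<bar> powr (p + 1) * cutoff R x)"
proof -
  have c: "continuous_on UNIV (cutoff R)" "bounded_support (cutoff R)"
    using cutoff_test_pair[OF assms, of 0] by (auto simp: test_pair_def)
  have w: "L2loc (\<lambda>x. u x * cutoff R x)" "bounded_support (\<lambda>x. u x * cutoff R x)"
    using c by (auto intro!: L2loc_mult_locally_bounded(1) L2loc_uGH locally_bounded_continuous bounded_support_mult(2))
  have "- (LBINT x. H i i x * (u x * cutoff R x))
      = (LBINT x. (G i x)\<^sup>2 * cutoff R x) + (LBINT x. G i x * (u x * cutoff_deriv R (axis i 1) x))" for i
    using product_rule[OF dG[of i i] du[of i] cutoff_test_pair[OF assms]]
    by (simp add: power2_eq_square mult.assoc)
  moreover have "(LBINT x. potential u x * u x * (u x * cutoff R x)) = (LBINT x. (u x)\<^sup>2 * potential u x * cutoff R x)"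
    by (simp add: power2_eq_square mult_ac)
  moreover have "(LBINT x. \<bar>u x\<bar> powr (p - 1) * u x * (u x * cutoff R x)) = (LBINT x. \<bar>u x\<bar> powr (p + 1) * cutoff R x)"
    by (simp add: nonlinearity_mult[symmetric] mult_ac)
  ultimately show ?thesis
    using tested_equation[OF w] by (simp add: sum.distrib sum_negf[symmetric])
qed

text \<open>The derivative of the cutoff is O(1/R), while \<open>mass_bound\<close> lets the L^2
  norm of u on the R-ball grow only like R^(1/4).\<close>

lemma nehari_error:
  "(\<lambda>n. LBINT x. G i x * (u x * cutoff_deriv (real (Suc n)) (axis i 1) x)) \<longlonglongrightarrow> 0"
proof -
  define a where "a = (LBINT x. (G i x)\<^sup>2)"
  have bound: "\<bar>LBINT x. G i x * (u x * cutoff_deriv R (axis i 1) x)\<bar>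
      \<le> a * (1 / sqrt R) + 16 * sqrt (2 * D) * (1 / R)" if "R > 0" for R
  proof -
    let ?g = "\<lambda>x. u x * cutoff_deriv R (axis i 1) x"
    have c: "continuous_on UNIV (cutoff_deriv R (axis i 1) :: real^3 \<Rightarrow> real)"
      using cutoff_test_pair[OF that, of "axis i 1 :: real^3"] by (simp add: test_pair_def)
    have "L2loc ?g"
      using c by (auto intro!: L2loc_mult_locally_bounded(1) L2loc_uGH locally_bounded_continuous)
    moreover have "?g x = 0" if "norm x > R" for x
      using cutoff_eq_0(2)[OF \<open>R > 0\<close>, of x "axis i 1"] that by simp
    ultimately have g: "L2loc ?g" "\<And>x. norm x > R \<Longrightarrow> ?g x = 0" by auto
    have "(LBINT x. (?g x)\<^sup>2) \<le> (LBINT x. (4 / R)\<^sup>2 * (indicator (cball 0 R) x * (u x)\<^sup>2))"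
    proof (rule integral_mono)
      show "integrable lborel (\<lambda>x. (?g x)\<^sup>2)"
        using g by (intro L2loc_integrable_square bounded_supportI)
      show "integrable lborel (\<lambda>x. (4 / R)\<^sup>2 * (indicator (cball 0 R) x * (u x)\<^sup>2))"
        using L2loc_uGH(1) by (intro integrable_mult_right) (simp add: L2loc_def)
      show "(?g x)\<^sup>2 \<le> (4 / R)\<^sup>2 * (indicator (cball 0 R) x * (u x)\<^sup>2)" for x
      proof (cases "norm x > R")
        case False
        have "\<bar>cutoff_deriv R (axis i 1) x\<bar> \<le> \<bar>4 / R\<bar>"
          using cutoff_deriv_bounds(2)[OF that, of "axis i 1" x] that by (simp add: norm_axis_1)
        then have "(cutoff_deriv R (axis i 1) x)\<^sup>2 \<le> (4 / R)\<^sup>2" by (simp only: abs_le_square_iff)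
        then have "(u x)\<^sup>2 * (cutoff_deriv R (axis i 1) x)\<^sup>2 \<le> (u x)\<^sup>2 * (4 / R)\<^sup>2"
          by (rule mult_left_mono) simp
        then show ?thesis using False by (simp add: power_mult_distrib mult.commute)
      next
        case True
        then show ?thesis using g(2)[OF True] by simp
      qed
    qed
    also have "\<dots> = (4 / R)\<^sup>2 * (LBINT x. indicator (cball 0 R) x * (u x)\<^sup>2)" by simp
    also have "\<dots> \<le> (4 / R)\<^sup>2 * (sqrt R * sqrt (2 * D))"
    proof (rule mult_left_mono)
      have "(LBINT x. indicator (cball 0 R) x * (u x)\<^sup>2) \<le> sqrt (2 * R * D)"
        by (rule real_le_rsqrt[OF mass_bound[OF L2loc_uGH(1) that]])
      then show "(LBINT x. indicator (cball 0 R) x * (u x)\<^sup>2) \<le> sqrt R * sqrt (2 * D)"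
        by (simp add: real_sqrt_mult mult_ac)
    qed simp
    finally have g2: "(LBINT x. (?g x)\<^sup>2) \<le> (4 / R)\<^sup>2 * (sqrt R * sqrt (2 * D))" .
    have Ga: "(LBINT x. indicator (cball 0 R) x * (G i x)\<^sup>2) \<le> a"
      unfolding a_def using G2 L2loc_uGH(2)[of i]
      by (intro integral_mono) (auto simp: L2loc_def indicator_def)
    \<comment> \<open>The weight is d = 1/sqrt R. The gradient term is then a/sqrt R, and the other
      term, of order R^(-3/2) before division by d, becomes O(1/R).\<close>
    have "\<bar>LBINT x. G i x * ?g x\<bar>
        \<le> 1 / sqrt R * (LBINT x. indicator (cball 0 R) x * (G i x)\<^sup>2) + (LBINT x. (?g x)\<^sup>2) / (1 / sqrt R)"
      using that by (intro L2_integral_bound L2loc_uGH g) auto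
    also have "\<dots> \<le> 1 / sqrt R * a + (4 / R)\<^sup>2 * (sqrt R * sqrt (2 * D)) / (1 / sqrt R)"
      using that Ga g2 by (intro add_mono mult_left_mono divide_right_mono) auto
    also have "(4 / R)\<^sup>2 * (sqrt R * sqrt (2 * D)) / (1 / sqrt R) = 16 * sqrt (2 * D) * (1 / R)"
    proof -
      have "(4 / R)\<^sup>2 * (sqrt R * sqrt (2 * D)) / (1 / sqrt R) = 16 * sqrt (2 * D) * (sqrt R * sqrt R) / R\<^sup>2"
        by (simp add: power_divide)
      also have "\<dots> = 16 * sqrt (2 * D) * (1 / R)" using that by (simp add: power2_eq_square)
      finally show ?thesis .
    qed
    finally show ?thesis by (simp add: mult.commute)
  qed
  have "(\<lambda>n. a * sqrt (inverse (real (Suc n))) + 16 * sqrt (2 * D) * inverse (real (Suc n)))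
      \<longlonglongrightarrow> a * sqrt 0 + 16 * sqrt (2 * D) * 0"
    by (intro tendsto_intros LIMSEQ_inverse_real_of_nat)
  then have "(\<lambda>n. a * (1 / sqrt (real (Suc n))) + 16 * sqrt (2 * D) * (1 / real (Suc n))) \<longlonglongrightarrow> 0"
    by (simp add: real_sqrt_divide inverse_eq_divide del: of_nat_Suc)
  then show ?thesis
    by (rule Lim_null_comparison[rotated]) (use bound in \<open>auto simp del: of_nat_Suc intro!: always_eventually\<close>)
qed

lemma cutoff_mono: "mono (\<lambda>n. cutoff (real (Suc n)) x)"
proof (rule monoI)
  fix m n :: nat assume "m \<le> n"
  then have "(norm x)\<^sup>2 / (real (Suc n))\<^sup>2 \<le> (norm x)\<^sup>2 / (real (Suc m))\<^sup>2"
    by (intro divide_left_mono power_mono) auto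
  then show "cutoff (real (Suc m)) x \<le> cutoff (real (Suc n)) x"
    unfolding cutoff_def by (intro power_mono) auto
qed

text \<open>Each other term of the local identity converges, so the integrals of the cut-off powers
  have a finite limit. As \<open>cutoff\<close> increases with R, monotone convergence yields the
  integrability of |u|^(p+1) and the identity together.\<close>

lemma nehari:
  "integrable lborel (\<lambda>x. \<bar>u x\<bar> powr (p + 1))"
  "\<mu> * (LBINT x. \<bar>u x\<bar> powr (p + 1)) = A + D / (4 * pi)"
proof -
  let ?f = "\<lambda>n x. \<bar>u x\<bar> powr (p + 1) * cutoff (real (Suc n)) x"
  have "(\<lambda>n. ((\<Sum>i\<in>UNIV. LBINT x. (G i x)\<^sup>2 * cutoff (real (Suc n)) x)
      + (\<Sum>i\<in>UNIV. LBINT x. G i x * (u x * cutoff_deriv (real (Suc n)) (axis i 1) x))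
      + (LBINT x. (u x)\<^sup>2 * potential u x * cutoff (real (Suc n)) x) / (4 * pi)) / \<mu>)
    \<longlonglongrightarrow> ((\<Sum>i\<in>UNIV. LBINT x. (G i x)\<^sup>2) + (\<Sum>i\<in>(UNIV :: 3 set). 0)
      + (LBINT x. (u x)\<^sup>2 * potential u x) / (4 * pi)) / \<mu>"
    using mu by (intro tendsto_intros integral_cutoff_tendsto G2 energy_integrable nehari_error) auto
  then have lim: "(\<lambda>n. LBINT x. ?f n x) \<longlonglongrightarrow> (A + D / (4 * pi)) / \<mu>"
    using mu by (simp add: nehari_local A_def D_def del: of_nat_Suc)
  have i: "integrable lborel (?f n)" for n
  proof -
    have c: "continuous_on UNIV (cutoff (real (Suc n)) :: real^3 \<Rightarrow> real)" "bounded_support (cutoff (real (Suc n)) :: real^3 \<Rightarrow> real)"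
      using cutoff_test_pair[of "real (Suc n)" "0 :: real^3"] by (auto simp: test_pair_def)
    from integrable_L2loc_mult_test[OF L2loc_nonlinearity L2loc_uGH(1) this]
    show ?thesis by (simp add: nonlinearity_mult[symmetric] mult.assoc)
  qed
  have mono: "AE x in lborel. mono (\<lambda>n. ?f n x)"
    using monoD[OF cutoff_mono] by (intro AE_I2 monoI mult_left_mono) auto
  have ptw: "AE x in lborel. (\<lambda>n. ?f n x) \<longlonglongrightarrow> \<bar>u x\<bar> powr (p + 1)"
  proof (rule AE_I2)
    fix x
    have "(\<lambda>n. ?f n x) \<longlonglongrightarrow> \<bar>u x\<bar> powr (p + 1) * 1"
      by (intro tendsto_mult tendsto_const cutoff_tendsto)
    then show "(\<lambda>n. ?f n x) \<longlonglongrightarrow> \<bar>u x\<bar> powr (p + 1)" by simp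
  qed
  have meas: "(\<lambda>x. \<bar>u x\<bar> powr (p + 1)) \<in> borel_measurable lborel" by measurable
  show "integrable lborel (\<lambda>x. \<bar>u x\<bar> powr (p + 1))"
    by (rule integrable_monotone_convergence[OF i mono ptw lim meas])
  show "\<mu> * (LBINT x. \<bar>u x\<bar> powr (p + 1)) = A + D / (4 * pi)"
    using integral_monotone_convergence[OF i mono ptw lim meas] mu by simp
qed

end

lemma borel_measurable_vec_nth [measurable (raw)]:
  fixes f :: "'a \<Rightarrow> real^'n::finite"
  assumes "f \<in> borel_measurable M" shows "(\<lambda>x. f x $ i) \<in> borel_measurable M"
proof -
  have "(\<lambda>y :: real^'n. y $ i) \<in> borel_measurable borel"
    by (intro borel_measurable_continuous_onI continuous_intros)
  from measurable_compose[OF assms this] show ?thesis .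
qed

section \<open>The Coulomb term tested with the cut-off radial derivative\<close>

context pohozaev
begin

lemma field_continuous_support:
  assumes "R > 0"
  shows "continuous_on UNIV (\<lambda>x :: real^3. x $ j * cutoff R x)" "bounded_support (\<lambda>x :: real^3. x $ j * cutoff R x)"
    "continuous_on UNIV (field_deriv R e j :: real^3 \<Rightarrow> real)" "bounded_support (field_deriv R e j :: real^3 \<Rightarrow> real)"
  using field_test_pair[OF assms, of e j] by (auto simp: test_pair_def)

text \<open>At fixed y the regularised kernel times a component of the field is an admissible test
  function of x; this is the product rule for u times u.\<close>

lemma regularised_identity:
  assumes "R > 0" "d > 0"
  shows "(LBINT x. u x * (u x * (- ((x - y) $ j) * ker d (x - y) ^ 3 * (x $ j * cutoff R x)
      + ker d (x - y) * field_deriv R (axis j 1) j x)))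
    = - 2 * (LBINT x. G j x * (u x * (ker d (x - y) * (x $ j * cutoff R x))))"
proof -
  have ker_shift: "continuous_on UNIV (\<lambda>x. ker d (x - y))"
    by (rule continuous_on_compose2[OF ker_continuous[OF assms(2)]]) (auto intro: continuous_intros)
  have "test_pair (axis j 1) (\<lambda>x. ker d (x - y) * (x $ j * cutoff R x))
    (\<lambda>x. (- ((x - y) \<bullet> axis j 1) * ker d (x - y) ^ 3) * (x $ j * cutoff R x)
       + ker d (x - y) * field_deriv R (axis j 1) j x)"
  proof (rule test_pair_mult[OF field_test_pair[OF assms(1)] ker_shift])
    show "continuous_on UNIV (\<lambda>x. - ((x - y) \<bullet> axis j 1) * ker d (x - y) ^ 3)"
      by (intro continuous_intros ker_shift)
    show "((\<lambda>s. ker d (x + s *\<^sub>R axis j 1 - y)) has_real_derivative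
        - ((x + s *\<^sub>R axis j 1 - y) \<bullet> axis j 1) * ker d (x + s *\<^sub>R axis j 1 - y) ^ 3) (at s)" for x s
      using ker_has_derivative[OF assms(2), of "x - y" "axis j 1" s] by (simp add: algebra_simps)
  qed
  from product_rule[OF du[of j] du[of j] this] show ?thesis
    by (simp add: inner_axis)
qed

lemma weight_integrable:
  assumes "R > 0"
  shows "integrable lborel (\<lambda>x. G j x * (u x * (x $ j * cutoff R x)) * potential u x)"
  using integrable_L2loc_mult_test[OF L2loc_mult_locally_bounded(2)[OF L2loc_uGH(2)[of j]
        potential_measurable potential_locally_bounded] L2loc_uGH(1) field_continuous_support(1,2)[OF assms, of j]]
  by (simp add: mult_ac)

lemma ker_commute: "ker d (x - y) = ker d (y - x)"
  by (simp add: norm_minus_commute ker_def)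

text \<open>(X(x) - X(y)) . (x - y) for the cut-off field X. It replaces X(x) . (x - y) after
  symmetrisation and vanishes to second order on the diagonal.\<close>

definition field_diff :: "real \<Rightarrow> real^3 \<Rightarrow> real^3 \<Rightarrow> real" where
  "field_diff R x y = (\<Sum>j\<in>UNIV. (x $ j * cutoff R x - y $ j * cutoff R y) * (x - y) $ j)"

lemma field_diff_measurable [measurable]:
  "(\<lambda>(x, y). field_diff R x y) \<in> borel_measurable (borel \<Otimes>\<^sub>M borel)"
  unfolding field_diff_def by measurable

lemma field_diff_bound:
  assumes "R > 0" shows "\<bar>field_diff R x y\<bar> \<le> 15 * (norm (x - y))\<^sup>2"
proof -
  have "\<bar>field_diff R x y\<bar> \<le> (\<Sum>j\<in>(UNIV :: 3 set). 5 * norm (x - y) * norm (x - y))"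
    unfolding field_diff_def
  proof (rule order_trans[OF sum_abs], rule sum_mono)
    fix j :: 3
    show "\<bar>(x $ j * cutoff R x - y $ j * cutoff R y) * (x - y) $ j\<bar> \<le> 5 * norm (x - y) * norm (x - y)"
      unfolding abs_mult by (intro mult_mono field_lipschitz assms component_le_norm_cart) auto
  qed
  then show ?thesis by (simp add: power2_eq_square)
qed

text \<open>The three pieces of the integration by parts at regularisation d, paired with u(y)^2: in
  \<open>kernel_term\<close> the derivative falls on the kernel, already symmetrised, in
  \<open>div_term\<close> on the field, and in \<open>grad_term\<close> on u.\<close>

definition "kernel_term d R = (\<integral>(x, y). (u x)\<^sup>2 * (ker d (x - y) ^ 3 * field_diff R x y * (u y)\<^sup>2) \<partial>lborel2)"

definition "div_term d R j = (\<integral>(x, y). (u x)\<^sup>2 * (ker d (x - y) * field_deriv R (axis j 1) j x * (u y)\<^sup>2) \<partial>lborel2)"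

definition "grad_term d R j = (\<integral>(x, y). (G j x * (u x * (x $ j * cutoff R x))) * (ker d (x - y) * (u y)\<^sup>2) \<partial>lborel2)"

text \<open>The gradient of the kernel is only integrable against the field after symmetrising in
  \<open>x\<close> and \<open>y\<close>, where the Lipschitz bound on the field cancels one power of \<open>|x - y|\<close>.\<close>

lemma regularised_sum:
  assumes R: "R > 0" and d: "d > 0"
  shows "- 1 / 2 * kernel_term d R + (\<Sum>j\<in>UNIV. div_term d R j)
     = - 2 * (\<Sum>j\<in>UNIV. grad_term d R j)"
proof -
  define F1 where "F1 j x y = (u x)\<^sup>2 * (ker d (x - y) * field_deriv R (axis j 1) j x * (u y)\<^sup>2)" for j x y
  define F2 where "F2 j x y = (u x)\<^sup>2 * (ker d (x - y) ^ 3 * ((x - y) $ j * (x $ j * cutoff R x)) * (u y)\<^sup>2)" for j x y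
  define F3 where "F3 j x y = (G j x * (u x * (x $ j * cutoff R x))) * (ker d (x - y) * (u y)\<^sup>2)" for j x y
  note en = energy_integrable
  have u2: "(\<lambda>x. (u x)\<^sup>2) \<in> borel_measurable borel" by measurable
  have fd: "\<bar>field_deriv R (axis j 1) j x\<bar> \<le> 5" for j and x :: "real^3"
    using field_deriv_bound[OF R, of "axis j 1" j x] by (simp add: norm_axis_1)
  have i1: "integrable lborel2 (\<lambda>(x, y). F1 j x y)" for j
    unfolding F1_def
  proof (rule weighted_kernel_integrable[OF u2 en, where C = 5])
    show "\<bar>ker d (x - y) * field_deriv R (axis j 1) j x\<bar> \<le> 5 / norm (x - y)" if "x \<noteq> y" for x y :: "real^3"
    proof -
      have "ker d (x - y) * \<bar>field_deriv R (axis j 1) j x\<bar> \<le> 1 / norm (x - y) * 5"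
        using ker_bounds(1,4)[OF d, of "x - y"] that fd by (intro mult_mono) auto
      then show ?thesis using ker_bounds(1)[OF d, of "x - y"] by (simp add: abs_mult)
    qed
  qed measurable
  \<comment> \<open>The constant M/d blows up as d -> 0. This bound only justifies Fubini and the
    exchange of variables at fixed d; the uniform bound is available after symmetrisation.\<close>
  have i2: "integrable lborel2 (\<lambda>(x, y). F2 j x y)" for j
  proof -
    obtain M where M: "\<And>x :: real^3. \<bar>x $ j * cutoff R x\<bar> \<le> M"
      using bounded_support_locally_bounded[OF field_continuous_support(2)[OF R] locally_bounded_continuous[OF field_continuous_support(1)[OF R]]]
      by blast
    show ?thesis
      unfolding F2_def
    proof (rule weighted_kernel_integrable[OF u2 en, where C = "M / d"])
      fix x y :: "real^3" assume "x \<noteq> y"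
      let ?k = "ker d (x - y)"
      have k: "?k > 0" "norm (x - y) * ?k \<le> 1" "?k \<le> 1 / d" "?k \<le> 1 / norm (x - y)"
        using ker_bounds[OF d, of "x - y"] \<open>x \<noteq> y\<close> by auto
      have "\<bar>?k ^ 3 * ((x - y) $ j * (x $ j * cutoff R x))\<bar>
          = ?k * ?k * (\<bar>(x - y) $ j\<bar> * ?k) * \<bar>x $ j * cutoff R x\<bar>"
        using k(1) by (simp add: abs_mult power3_eq_cube)
      also have "\<dots> \<le> 1 / norm (x - y) * (1 / d) * 1 * M"
      proof -
        have "\<bar>(x - y) $ j\<bar> * ?k \<le> norm (x - y) * ?k"
          using k(1) by (intro mult_right_mono component_le_norm_cart) auto
        then have "\<bar>(x - y) $ j\<bar> * ?k \<le> 1" using k(2) by linarith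
        then show ?thesis using k M d by (intro mult_mono mult_nonneg_nonneg) auto
      qed
      finally show "\<bar>?k ^ 3 * ((x - y) $ j * (x $ j * cutoff R x))\<bar> \<le> M / d / norm (x - y)"
        by (simp add: mult.commute)
    qed measurable
  qed
  have i3: "integrable lborel2 (\<lambda>(x, y). F3 j x y)" for j
    unfolding F3_def
    by (rule weighted_kernel_integrable[OF _ weight_integrable[OF R], where C = 1])
      (simp_all add: abs_of_pos[OF ker_bounds(1)[OF d]] ker_bounds(4)[OF d])
  have each: "(\<integral>(x, y). F1 j x y \<partial>lborel2) - (\<integral>(x, y). F2 j x y \<partial>lborel2)
      = - 2 * (\<integral>(x, y). F3 j x y \<partial>lborel2)" for j
  proof -
    have "(\<integral>(x, y). F1 j x y \<partial>lborel2) - (\<integral>(x, y). F2 j x y \<partial>lborel2)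
        = (\<integral>(x, y). F1 j x y - F2 j x y \<partial>lborel2)"
      using Bochner_Integration.integral_diff[OF i1[of j] i2[of j]] by (simp add: case_prod_unfold)
    also have "\<dots> = (LBINT y. (LBINT x. F1 j x y - F2 j x y))"
      using Bochner_Integration.integrable_diff[OF i1[of j] i2[of j]]
      by (intro lborel_pair.integral_snd[symmetric]) (simp add: case_prod_unfold)
    also have "\<dots> = (LBINT y. - 2 * (LBINT x. F3 j x y))"
    proof (rule Bochner_Integration.integral_cong[OF refl])
      fix y
      have "(LBINT x. F1 j x y - F2 j x y)
        = (LBINT x. u x * (u x * (- ((x - y) $ j) * ker d (x - y) ^ 3 * (x $ j * cutoff R x)
              + ker d (x - y) * field_deriv R (axis j 1) j x)) * (u y)\<^sup>2)"
        by (rule Bochner_Integration.integral_cong[OF refl])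
          (simp add: F1_def F2_def power2_eq_square algebra_simps)
      also have "\<dots> = - 2 * (LBINT x. G j x * (u x * (ker d (x - y) * (x $ j * cutoff R x)))) * (u y)\<^sup>2"
        by (simp only: integral_mult_left_zero regularised_identity[OF R d])
      also have "\<dots> = - 2 * (LBINT x. G j x * (u x * (ker d (x - y) * (x $ j * cutoff R x))) * (u y)\<^sup>2)"
        by (simp only: integral_mult_left_zero)
      also have "\<dots> = - 2 * (LBINT x. F3 j x y)"
        by (simp add: F3_def mult_ac)
      finally show "(LBINT x. F1 j x y - F2 j x y) = - 2 * (LBINT x. F3 j x y)" .
    qed
    also have "\<dots> = - 2 * (\<integral>(x, y). F3 j x y \<partial>lborel2)"
      using lborel_pair.integral_snd[OF i3[of j]] by (simp only: integral_mult_right_zero)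
    finally show ?thesis .
  qed
  \<comment> \<open>Exchanging x and y preserves the kernel and reverses the sign of x - y, so
    adding the two versions replaces the field by its difference.\<close>
  have sym: "2 * (\<Sum>j\<in>UNIV. \<integral>(x, y). F2 j x y \<partial>lborel2)
      = kernel_term d R"
  proof -
    have sw: "(\<integral>(x, y). F2 j y x \<partial>lborel2) = (\<integral>(x, y). F2 j x y \<partial>lborel2)"
      "integrable lborel2 (\<lambda>(x, y). F2 j y x)" for j
      using lborel_pair.integral_product_swap[of "\<lambda>(x, y). F2 j x y"] lborel_pair.integrable_product_swap[OF i2[of j]]
        borel_measurable_integrable[OF i2[of j]] by simp_all
    have "2 * (\<Sum>j\<in>UNIV. \<integral>(x, y). F2 j x y \<partial>lborel2)
        = (\<Sum>j\<in>UNIV. (\<integral>(x, y). F2 j x y \<partial>lborel2) + (\<integral>(x, y). F2 j y x \<partial>lborel2))"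
      unfolding sw(1) by (simp add: sum_distrib_left)
    also have "\<dots> = (\<Sum>j\<in>UNIV. \<integral>z. (case z of (x, y) \<Rightarrow> F2 j x y) + (case z of (x, y) \<Rightarrow> F2 j y x) \<partial>lborel2)"
      using i2 sw(2) by simp
    also have "\<dots> = (\<integral>z. (\<Sum>j\<in>UNIV. (case z of (x, y) \<Rightarrow> F2 j x y) + (case z of (x, y) \<Rightarrow> F2 j y x)) \<partial>lborel2)"
      using i2 sw(2) by (intro Bochner_Integration.integral_sum[symmetric]) simp
    also have "\<dots> = kernel_term d R"
      unfolding kernel_term_def
    proof (rule Bochner_Integration.integral_cong[OF refl])
      fix z :: "(real^3) \<times> (real^3)"
      obtain x y where z: "z = (x, y)" by (cases z)
      have "F2 j x y + F2 j y x = (u x)\<^sup>2 * ker d (x - y) ^ 3 * (u y)\<^sup>2 * ((x $ j * cutoff R x - y $ j * cutoff R y) * (x - y) $ j)" for j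
        unfolding F2_def ker_commute[of d y x] by (simp add: algebra_simps)
      then show "(\<Sum>j\<in>UNIV. (case z of (x, y) \<Rightarrow> F2 j x y) + (case z of (x, y) \<Rightarrow> F2 j y x))
        = (case z of (x, y) \<Rightarrow> (u x)\<^sup>2 * (ker d (x - y) ^ 3 * field_diff R x y * (u y)\<^sup>2))"
        by (simp add: z field_diff_def sum_distrib_left[symmetric])
    qed
    finally show ?thesis .
  qed
  have "(\<Sum>j\<in>UNIV. (\<integral>(x, y). F1 j x y \<partial>lborel2) - (\<integral>(x, y). F2 j x y \<partial>lborel2))
      = (\<Sum>j\<in>UNIV. - 2 * (\<integral>(x, y). F3 j x y \<partial>lborel2))"
    using each by (rule sum.cong[OF refl])
  then have "(\<Sum>j\<in>UNIV. \<integral>(x, y). F1 j x y \<partial>lborel2) - (\<Sum>j\<in>UNIV. \<integral>(x, y). F2 j x y \<partial>lborel2)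
      = - 2 * (\<Sum>j\<in>UNIV. \<integral>(x, y). F3 j x y \<partial>lborel2)"
    by (simp only: sum_subtractf sum_distrib_left)
  with sym show ?thesis
    unfolding F1_def F3_def div_term_def grad_term_def by linarith
qed

text \<open>The limit of \<open>kernel_term d R\<close> as d -> 0, with the cube of the regularised
  kernel replaced by |x - y|^(-3).\<close>

definition "J R = (\<integral>(x, y). (u x)\<^sup>2 * (field_diff R x y / norm (x - y) ^ 3 * (u y)\<^sup>2) \<partial>lborel2)"

text \<open>The limit d -> 0 of \<open>regularised_sum\<close>. In the divergence and gradient terms
  the inner integral over y becomes \<open>potential u\<close>; the symmetrised term remains a
  double integral.\<close>

lemma coulomb_identity:
  assumes R: "R > 0"
  shows "- 1 / 2 * J R + (\<Sum>j\<in>UNIV. LBINT x. (u x)\<^sup>2 * potential u x * field_deriv R (axis j 1) j x)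
     = - 2 * (\<Sum>j\<in>UNIV. LBINT x. G j x * (u x * (x $ j * cutoff R x)) * potential u x)"
proof -
  define d where "d n = inverse (real (Suc n))" for n
  have d: "d n > 0" for n by (simp add: d_def)
  have kl: "(\<lambda>n. ker (d n) (x - y)) \<longlonglongrightarrow> 1 / norm (x - y)" if "x \<noteq> y" for x y :: "real^3"
    unfolding d_def using that by (intro ker_tendsto) simp
  have kb: "0 < ker (d n) (x - y)" "ker (d n) (x - y) \<le> 1 / norm (x - y)" if "x \<noteq> y" for n and x y :: "real^3"
    using ker_bounds(1,4)[OF d[of n], of "x - y"] that by auto
  have u2: "(\<lambda>x. (u x)\<^sup>2) \<in> borel_measurable borel" by measurable
  have fd: "\<bar>field_deriv R (axis j 1) j x\<bar> \<le> 5" for j and x :: "real^3"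
    using field_deriv_bound[OF R, of "axis j 1" j x] by (simp add: norm_axis_1)
  have L2: "(\<lambda>n. kernel_term (d n) R) \<longlonglongrightarrow> J R"
    unfolding J_def kernel_term_def
  proof (rule weighted_kernel_limit(2)[OF u2 energy_integrable, where C = 15])
    fix x y :: "real^3" assume xy: "x \<noteq> y"
    \<comment> \<open>The cube of the kernel is at most |x - y|^(-3) and the field difference at
      most 15 |x - y|^2, where 15 is three components with Lipschitz constant 5 each.\<close>
    show "\<bar>ker (d n) (x - y) ^ 3 * field_diff R x y\<bar> \<le> 15 / norm (x - y)" for n
    proof -
      have "\<bar>ker (d n) (x - y) ^ 3 * field_diff R x y\<bar> = ker (d n) (x - y) ^ 3 * \<bar>field_diff R x y\<bar>"
        by (simp add: abs_mult power_abs abs_of_pos[OF kb(1)[OF xy]])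
      also have "\<dots> \<le> (1 / norm (x - y)) ^ 3 * (15 * (norm (x - y))\<^sup>2)"
        using kb[OF xy, of n] by (intro mult_mono power_mono field_diff_bound R) auto
      also have "\<dots> = 15 / norm (x - y)"
        using xy by (simp add: power2_eq_square power3_eq_cube)
      finally show ?thesis .
    qed
    have "(\<lambda>n. ker (d n) (x - y) ^ 3 * field_diff R x y) \<longlonglongrightarrow> (1 / norm (x - y)) ^ 3 * field_diff R x y"
      by (intro tendsto_intros kl xy)
    then show "(\<lambda>n. ker (d n) (x - y) ^ 3 * field_diff R x y) \<longlonglongrightarrow> field_diff R x y / norm (x - y) ^ 3"
      by (simp add: power_divide)
  qed measurable
  have L1: "(\<lambda>n. div_term (d n) R j)
      \<longlonglongrightarrow> (LBINT x. (u x)\<^sup>2 * potential u x * field_deriv R (axis j 1) j x)" for j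
  proof -
    let ?f = "\<lambda>x. (u x)\<^sup>2 * field_deriv R (axis j 1) j x"
    have "(\<lambda>n. div_term (d n) R j)
      \<longlonglongrightarrow> (\<integral>(x, y). (u x)\<^sup>2 * (1 / norm (x - y) * field_deriv R (axis j 1) j x * (u y)\<^sup>2) \<partial>lborel2)"
      unfolding div_term_def
    proof (rule weighted_kernel_limit(2)[OF u2 energy_integrable, where C = 5])
      fix x y :: "real^3" assume xy: "x \<noteq> y"
      show "\<bar>ker (d n) (x - y) * field_deriv R (axis j 1) j x\<bar> \<le> 5 / norm (x - y)" for n
      proof -
        have "ker (d n) (x - y) * \<bar>field_deriv R (axis j 1) j x\<bar> \<le> 1 / norm (x - y) * 5"
          using kb[OF xy, of n] fd by (intro mult_mono) auto
        then show ?thesis using kb(1)[OF xy, of n] by (simp add: abs_mult)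
      qed
      show "(\<lambda>n. ker (d n) (x - y) * field_deriv R (axis j 1) j x) \<longlonglongrightarrow> 1 / norm (x - y) * field_deriv R (axis j 1) j x"
        by (intro tendsto_intros kl xy)
    qed measurable
    also have "(\<integral>(x, y). (u x)\<^sup>2 * (1 / norm (x - y) * field_deriv R (axis j 1) j x * (u y)\<^sup>2) \<partial>lborel2)
      = (\<integral>(x, y). ?f x * ((u y)\<^sup>2 / norm (x - y)) \<partial>lborel2)"
      by (intro Bochner_Integration.integral_cong refl) (simp add: case_prod_unfold)
    also have "\<dots> = (LBINT x. ?f x * potential u x)"
    proof (rule potential_weighted(2))
      have "integrable lborel (\<lambda>x. u x * potential u x * (u x * field_deriv R (axis j 1) j x))"
        by (intro integrable_L2loc_mult_test L2loc_mult_locally_bounded(1) L2loc_uGH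
            potential_measurable potential_locally_bounded field_continuous_support R)
      then show "integrable lborel (\<lambda>x. ?f x * potential u x)"
        by (simp add: power2_eq_square mult_ac)
    qed measurable
    finally show ?thesis by (simp add: mult_ac)
  qed
  have L3: "(\<lambda>n. grad_term (d n) R j)
      \<longlonglongrightarrow> (LBINT x. G j x * (u x * (x $ j * cutoff R x)) * potential u x)" for j
  proof -
    have m: "(\<lambda>x. G j x * (u x * (x $ j * cutoff R x))) \<in> borel_measurable borel" by measurable
    have "(\<lambda>n. grad_term (d n) R j)
      \<longlonglongrightarrow> (\<integral>(x, y). (G j x * (u x * (x $ j * cutoff R x))) * (1 / norm (x - y) * (u y)\<^sup>2) \<partial>lborel2)"
      unfolding grad_term_def
      by (rule weighted_kernel_limit(2)[OF m weight_integrable[OF R], where C = 1])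
        (use kl kb in \<open>auto simp: abs_of_pos\<close>)
    also have "(\<integral>(x, y). (G j x * (u x * (x $ j * cutoff R x))) * (1 / norm (x - y) * (u y)\<^sup>2) \<partial>lborel2)
      = (LBINT x. G j x * (u x * (x $ j * cutoff R x)) * potential u x)"
      using potential_weighted(2)[OF m weight_integrable[OF R]] by simp
    finally show ?thesis .
  qed
  have "(\<lambda>n. - 1 / 2 * kernel_term (d n) R + (\<Sum>j\<in>UNIV. div_term (d n) R j))
    \<longlonglongrightarrow> - 1 / 2 * J R + (\<Sum>j\<in>UNIV. LBINT x. (u x)\<^sup>2 * potential u x * field_deriv R (axis j 1) j x)"
    by (intro tendsto_intros L1 L2)
  moreover have "(\<lambda>n. - 2 * (\<Sum>j\<in>UNIV. grad_term (d n) R j))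
    \<longlonglongrightarrow> - 2 * (\<Sum>j\<in>UNIV. LBINT x. G j x * (u x * (x $ j * cutoff R x)) * potential u x)"
    by (intro tendsto_intros L3)
  ultimately show ?thesis
    unfolding regularised_sum[OF R d] by (rule LIMSEQ_unique)
qed

text \<open>For R -> \<infinity> the field becomes the identity and \<open>field_diff\<close>
  becomes |x - y|^2, so the kernel reverts to 1/|x - y|; the bound 15/|x - y| does not involve
  R.\<close>

lemma J_tendsto: "(\<lambda>n. J (real (Suc n))) \<longlonglongrightarrow> D"
proof -
  have u2: "(\<lambda>x. (u x)\<^sup>2) \<in> borel_measurable borel" by measurable
  have "(\<lambda>n. J (real (Suc n))) \<longlonglongrightarrow> (\<integral>(x, y). (u x)\<^sup>2 * (1 / norm (x - y) * (u y)\<^sup>2) \<partial>lborel2)"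
    unfolding J_def
  proof (rule weighted_kernel_limit(2)[OF u2 energy_integrable, where C = 15])
    fix x y :: "real^3" assume xy: "x \<noteq> y"
    show "\<bar>field_diff (real (Suc n)) x y / norm (x - y) ^ 3\<bar> \<le> 15 / norm (x - y)" for n
    proof -
      have "\<bar>field_diff (real (Suc n)) x y\<bar> / norm (x - y) ^ 3 \<le> 15 * (norm (x - y))\<^sup>2 / norm (x - y) ^ 3"
        by (intro divide_right_mono field_diff_bound) auto
      also have "\<dots> = 15 / norm (x - y)" using xy by (simp add: power2_eq_square power3_eq_cube)
      finally show ?thesis by (simp add: abs_divide del: of_nat_Suc)
    qed
    have "(\<lambda>n. field_diff (real (Suc n)) x y / norm (x - y) ^ 3)
        \<longlonglongrightarrow> (\<Sum>j\<in>UNIV. (x $ j * 1 - y $ j * 1) * (x - y) $ j) / norm (x - y) ^ 3"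
      unfolding field_diff_def using xy by (intro tendsto_intros cutoff_tendsto) auto
    also have "(\<Sum>j\<in>UNIV. (x $ j * 1 - y $ j * 1) * (x - y) $ j) = (norm (x - y))\<^sup>2"
      by (simp add: power2_norm_eq_inner inner_vec_def)
    also have "(norm (x - y))\<^sup>2 / norm (x - y) ^ 3 = 1 / norm (x - y)"
      using xy by (simp add: power2_eq_square power3_eq_cube)
    finally show "(\<lambda>n. field_diff (real (Suc n)) x y / norm (x - y) ^ 3) \<longlonglongrightarrow> 1 / norm (x - y)" .
  qed measurable
  also have "(\<integral>(x, y). (u x)\<^sup>2 * (1 / norm (x - y) * (u y)\<^sup>2) \<partial>lborel2) = D"
    using potential_weighted(2)[OF u2 energy_integrable] by (simp add: D_def)
  finally show ?thesis .
qed

section \<open>The Pohozaev identity and the contradiction\<close>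

lemma pohozaev_local:
  assumes R: "R > 0"
  shows "(\<Sum>i\<in>UNIV. \<Sum>j\<in>UNIV. (LBINT x. G i x * G j x * field_deriv R (axis i 1) j x)
        - (LBINT x. (G i x)\<^sup>2 * field_deriv R (axis j 1) j x) / 2)
      + (\<Sum>j\<in>UNIV. LBINT x. G j x * (u x * (x $ j * cutoff R x)) * potential u x) / (4 * pi)
    = - (\<mu> / (p + 1)) * (\<Sum>j\<in>UNIV. LBINT x. \<bar>u x\<bar> powr (p + 1) * field_deriv R (axis j 1) j x)"
proof -
  let ?z = "\<lambda>j x. x $ j * cutoff R x :: real"
  let ?w = "\<lambda>j x. G j x * ?z j x"
  have w: "L2loc (?w j)" "bounded_support (?w j)" for j
    using field_continuous_support(1,2)[OF R, of j]
    by (auto intro!: L2loc_mult_locally_bounded(1) L2loc_uGH locally_bounded_continuous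
        bounded_support_mult(2) borel_measurable_continuous_onI)
  \<comment> \<open>The product rule for G_i G_j along i trades H_ii G_j for H_ji G_i. By symmetry
    of the Hessian this is H_ij G_i, half the derivative of G_i^2 along j, and a second product rule
    removes it.\<close>
  have second: "- (LBINT x. H i i x * ?w j x)
      = (LBINT x. G i x * G j x * field_deriv R (axis i 1) j x)
        - (LBINT x. (G i x)\<^sup>2 * field_deriv R (axis j 1) j x) / 2" for i j
  proof -
    have "(LBINT x. G i x * (G j x * field_deriv R (axis i 1) j x))
        = - (LBINT x. H i i x * (G j x * ?z j x)) - (LBINT x. H j i x * (G i x * ?z j x))"
      by (rule product_rule[OF dG dG field_test_pair[OF R]])
    moreover have "(LBINT x. G i x * (G i x * field_deriv R (axis j 1) j x))
        = - (LBINT x. H i j x * (G i x * ?z j x)) - (LBINT x. H i j x * (G i x * ?z j x))"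
      by (rule product_rule[OF dG dG field_test_pair[OF R]])
    moreover have "(LBINT x. H j i x * (G i x * ?z j x)) = (LBINT x. H i j x * (G i x * ?z j x))"
      by (rule integral_cong_AE) (use H_sym[of i j] in auto)
    ultimately show ?thesis by (simp add: power2_eq_square mult.assoc)
  qed
  \<comment> \<open>The radial test function pairs f(u) with G_j, which is the derivative of the
    convex power |u|^(p+1)/(p+1); \<open>L2loc_nonlinearity\<close> is what makes the chain rule
    applicable.\<close>
  have nonlin: "(LBINT x. \<bar>u x\<bar> powr (p - 1) * u x * ?w j x)
      = - (LBINT x. \<bar>u x\<bar> powr (p + 1) * field_deriv R (axis j 1) j x) / (p + 1)" for j
  proof -
    have "(LBINT x. \<bar>u x\<bar> powr (p + 1) / (p + 1) * field_deriv R (axis j 1) j x)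
        = - (LBINT x. G j x * (\<bar>u x\<bar> powr (p - 1) * u x * ?z j x))"
    proof (rule convex_chain_rule[where F = "\<lambda>t. \<bar>t\<bar> powr (p + 1) / (p + 1)"
          and f = "\<lambda>t. \<bar>t\<bar> powr (p - 1) * t", OF du _ L2loc_nonlinearity _ field_test_pair[OF R]])
      show "\<bar>a\<bar> powr (p - 1) * a * (b - a) \<le> \<bar>b\<bar> powr (p + 1) / (p + 1) - \<bar>a\<bar> powr (p + 1) / (p + 1)" for a b
        using p by (intro power_subgradient) simp
      have "L1loc (\<lambda>x. \<bar>u x\<bar> powr (p - 1) * u x * (1 / (p + 1) * u x))"
        by (intro L2loc_mult_L1loc L2loc_nonlinearity L2loc_cmult L2loc_uGH)
      then show "L1loc (\<lambda>x. \<bar>u x\<bar> powr (p + 1) / (p + 1))"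
        by (simp add: nonlinearity_mult[symmetric])
    qed
    then show ?thesis by (simp add: mult_ac)
  qed
  have each: "(\<Sum>i\<in>UNIV. (LBINT x. G i x * G j x * field_deriv R (axis i 1) j x)
        - (LBINT x. (G i x)\<^sup>2 * field_deriv R (axis j 1) j x) / 2)
      + (LBINT x. G j x * (u x * (x $ j * cutoff R x)) * potential u x) / (4 * pi)
    = - (\<mu> / (p + 1)) * (LBINT x. \<bar>u x\<bar> powr (p + 1) * field_deriv R (axis j 1) j x)" for j
    using tested_equation[OF w, of j] unfolding nonlin sum_negf[symmetric] second
    by (simp add: mult_ac)
  have "(\<Sum>j\<in>UNIV. (\<Sum>i\<in>UNIV. (LBINT x. G i x * G j x * field_deriv R (axis i 1) j x)
        - (LBINT x. (G i x)\<^sup>2 * field_deriv R (axis j 1) j x) / 2)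
      + (LBINT x. G j x * (u x * (x $ j * cutoff R x)) * potential u x) / (4 * pi))
    = (\<Sum>j\<in>UNIV. - (\<mu> / (p + 1)) * (LBINT x. \<bar>u x\<bar> powr (p + 1) * field_deriv R (axis j 1) j x))"
    using each by (rule sum.cong[OF refl])
  then show ?thesis
    by (subst sum.swap) (simp add: sum.distrib sum_divide_distrib sum_distrib_left)
qed

text \<open>The limit R -> \<infinity>, in which \<open>field_deriv\<close> along the i-th axis
  tends to the Kronecker delta. All integrands are globally integrable by now, the power of u
  through \<open>nehari\<close>.\<close>

lemma pohozaev_identity:
  "A / 2 + 5 / 4 * (D / (4 * pi)) = 3 * \<mu> / (p + 1) * (LBINT x. \<bar>u x\<bar> powr (p + 1))"
proof -
  define B where "B = (LBINT x. \<bar>u x\<bar> powr (p + 1))"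
  have GG: "integrable lborel (\<lambda>x. G i x * G j x)" for i j
  proof (rule Bochner_Integration.integrable_bound)
    show "integrable lborel (\<lambda>x. (G i x)\<^sup>2 + (G j x)\<^sup>2)" using G2 by simp
    show "AE x in lborel. norm (G i x * G j x) \<le> norm ((G i x)\<^sup>2 + (G j x)\<^sup>2)"
      using abs_mult_weighted_bound[of 1] by (intro AE_I2) simp
  qed measurable
  let ?R = "\<lambda>n. real (Suc n)"
  have T1: "(\<lambda>n. \<Sum>i\<in>UNIV. \<Sum>j\<in>UNIV. (LBINT x. G i x * G j x * field_deriv (?R n) (axis i 1) j x)
        - (LBINT x. (G i x)\<^sup>2 * field_deriv (?R n) (axis j 1) j x) / 2)
    \<longlonglongrightarrow> (\<Sum>i\<in>UNIV. \<Sum>j\<in>UNIV. axis i 1 $ j * (LBINT x. G i x * G j x)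
        - axis j 1 $ j * (LBINT x. (G i x)\<^sup>2) / 2)"
    by (intro tendsto_intros integral_field_deriv_tendsto GG G2) auto
  \<comment> \<open>The delta leaves A from the products G_i G_j and 3 A/2 from the divergence: A -
    3 A/2 = - A/2.\<close>
  have T1v: "(\<Sum>i\<in>UNIV. \<Sum>j\<in>UNIV. axis i 1 $ j * (LBINT x. G i x * G j x)
        - axis j 1 $ j * (LBINT x. (G i x)\<^sup>2) / 2) = - A / 2"
  proof -
    have "(\<Sum>j\<in>UNIV. axis i 1 $ j * (LBINT x. G i x * G j x) - axis j 1 $ j * (LBINT x. (G i x)\<^sup>2) / 2)
        = - (LBINT x. (G i x)\<^sup>2) / 2" for i
    proof -
      have "(\<Sum>j\<in>UNIV. axis i 1 $ j * (LBINT x. G i x * G j x))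
          = (\<Sum>j\<in>UNIV. if j = i then LBINT x. G i x * G j x else 0)"
        by (rule sum.cong) (auto simp: axis_def)
      then show ?thesis by (simp add: sum_subtractf power2_eq_square)
    qed
    then show ?thesis by (simp add: A_def sum_negf sum_divide_distrib)
  qed
  have T2: "(\<lambda>n. (\<Sum>j\<in>UNIV. LBINT x. G j x * (u x * (x $ j * cutoff (?R n) x)) * potential u x) / (4 * pi))
      \<longlonglongrightarrow> - 5 / 4 * (D / (4 * pi))"
  proof -
    have "(\<lambda>n. - 1 / 2 * (- 1 / 2 * J (?R n)
        + (\<Sum>j\<in>UNIV. LBINT x. (u x)\<^sup>2 * potential u x * field_deriv (?R n) (axis j 1) j x)) / (4 * pi))
      \<longlonglongrightarrow> - 1 / 2 * (- 1 / 2 * D + (\<Sum>j\<in>(UNIV :: 3 set). axis j 1 $ j * (LBINT x. (u x)\<^sup>2 * potential u x))) / (4 * pi)"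
      by (intro tendsto_intros J_tendsto integral_field_deriv_tendsto energy_integrable) auto
    \<comment> \<open>The divergence contributes 3 D and the symmetrised kernel - D/2; times - 1/2
      this is - 5/4 D.\<close>
    moreover have val: "- 1 / 2 * (- 1 / 2 * D + (\<Sum>j\<in>(UNIV :: 3 set). axis j 1 $ j * (LBINT x. (u x)\<^sup>2 * potential u x))) / (4 * pi)
        = - 5 / 4 * (D / (4 * pi))"
      unfolding D_def[symmetric] by (simp add: field_simps)
    ultimately have "(\<lambda>n. - 1 / 2 * (- 1 / 2 * J (?R n)
        + (\<Sum>j\<in>UNIV. LBINT x. (u x)\<^sup>2 * potential u x * field_deriv (?R n) (axis j 1) j x)) / (4 * pi))
      \<longlonglongrightarrow> - 5 / 4 * (D / (4 * pi))"
      by (simp only: val)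
    moreover have "- 1 / 2 * (- 1 / 2 * J (?R n)
        + (\<Sum>j\<in>UNIV. LBINT x. (u x)\<^sup>2 * potential u x * field_deriv (?R n) (axis j 1) j x))
      = (\<Sum>j\<in>UNIV. LBINT x. G j x * (u x * (x $ j * cutoff (?R n) x)) * potential u x)" for n
      by (simp only: coulomb_identity[OF of_nat_0_less_iff[THEN iffD2, OF zero_less_Suc]])
    ultimately show ?thesis by (simp only:)
  qed
  have T3: "(\<lambda>n. - (\<mu> / (p + 1)) * (\<Sum>j\<in>UNIV. LBINT x. \<bar>u x\<bar> powr (p + 1) * field_deriv (?R n) (axis j 1) j x))
      \<longlonglongrightarrow> - (\<mu> / (p + 1)) * (\<Sum>j\<in>(UNIV :: 3 set). axis j 1 $ j * B)"
    unfolding B_def by (intro tendsto_intros integral_field_deriv_tendsto nehari)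
  have "- A / 2 + - 5 / 4 * (D / (4 * pi)) = - (\<mu> / (p + 1)) * (\<Sum>j\<in>(UNIV :: 3 set). axis j 1 $ j * B)"
    using tendsto_add[OF T1[unfolded T1v] T2] T3
    by (simp only: pohozaev_local[OF of_nat_0_less_iff[THEN iffD2, OF zero_less_Suc]] LIMSEQ_unique)
  then show ?thesis unfolding B_def[symmetric] by (simp add: field_simps)
qed

text \<open>Eliminating the power term, A/2 + 5/4 d = 3/(p+1) (A + d) \<le> (A + d)/2, so 3/4 d
  \<le> 0. The strict positivity of d decides, which is why p = 5 is included.\<close>

lemma contradiction: False
proof -
  define d where "d = D / (4 * pi)"
  define k where "k = 3 / (p + 1) * (A + d)"
  have "d > 0" unfolding d_def using D_pos[OF L2loc_uGH(1)] by simp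
  have "A \<ge> 0" unfolding A_def by (intro sum_nonneg integral_nonneg_AE) auto
  have "3 / (p + 1) \<le> 1 / 2" using p by (simp add: field_simps)
  then have "k \<le> 1 / 2 * (A + d)"
    unfolding k_def using \<open>d > 0\<close> \<open>A \<ge> 0\<close> by (intro mult_right_mono) auto
  moreover have "A / 2 + 5 / 4 * d = k"
    using pohozaev_identity nehari(2) by (simp add: k_def d_def mult.assoc)
  ultimately show False using \<open>d > 0\<close> by (simp add: distrib_left)
qed

end

section \<open>Borel representatives\<close>

text \<open>The definitions of the problem integrate over \<open>lebesgue\<close>, the analysis
  above over \<open>lborel\<close>. Passing to a Borel representative changes neither integrals nor
  integrability.\<close>

lemma lebesgue_borel_transfer:
  fixes f :: "'a::euclidean_space \<Rightarrow> real"
  assumes "f \<in> borel_measurable lebesgue" "g \<in> borel_measurable borel" "AE x in lborel. f x = g x"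
  shows "integral\<^sup>L lebesgue f = integral\<^sup>L lborel g"
    and "integrable lebesgue f \<longleftrightarrow> integrable lborel g"
proof -
  have ae: "AE x in lebesgue. f x = g x" using assms(3) by (simp add: AE_completion_iff)
  have g: "g \<in> borel_measurable lebesgue" using assms(2) by (simp add: measurable_completion)
  show "integral\<^sup>L lebesgue f = integral\<^sup>L lborel g"
    using integral_cong_AE[OF assms(1) g ae] assms(2) by (simp add: integral_completion)
  show "integrable lebesgue f \<longleftrightarrow> integrable lborel g"
    using integrable_cong_AE[OF assms(1) g ae] assms(2) by (simp add: integrable_completion)
qed

lemma borel_representative:
  assumes "f \<in> borel_measurable lebesgue"
  obtains g :: "'a::euclidean_space \<Rightarrow> real"
  where "g \<in> borel_measurable borel" "AE x in lborel. f x = g x"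
  using completion_ex_borel_measurable_real[OF assms] by auto

lemma L_loc_2_L2loc:
  assumes f: "f \<in> L_loc 2" and g: "g \<in> borel_measurable borel" "AE x in lborel. f x = g x"
  shows "L2loc g"
  unfolding L2loc_def
proof (intro conjI allI)
  show "g \<in> borel_measurable borel" by (rule g)
  note [measurable] = g(1)
  fix R
  have [measurable]: "f \<in> borel_measurable lebesgue" using f by (simp add: L_loc_def)
  have "integrable lebesgue (\<lambda>x. indicator (cball 0 R) x *\<^sub>R \<bar>f x\<bar> powr 2)"
    using f by (simp add: L_loc_def set_integrable_def)
  also have "(\<lambda>x. indicator (cball 0 R) x *\<^sub>R \<bar>f x\<bar> powr 2) = (\<lambda>x. indicator (cball 0 R) x * (f x)\<^sup>2)"
    by simp
  finally have "integrable lebesgue (\<lambda>x. indicator (cball 0 R) x * (f x)\<^sup>2)" .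
  moreover have "(\<lambda>x. indicator (cball 0 R) x * (f x)\<^sup>2) \<in> borel_measurable lebesgue"
    by (intro borel_measurable_times borel_measurable_power borel_measurable_indicator)
      (auto simp: f)
  moreover have "AE x in lborel. indicator (cball 0 R) x * (f x)\<^sup>2 = indicator (cball 0 R) x * (g x)\<^sup>2"
    using g(2) by eventually_elim simp
  ultimately show "integrable lborel (\<lambda>x. indicator (cball 0 R) x * (g x)\<^sup>2)"
    by (subst (asm) lebesgue_borel_transfer(2)) auto
qed

lemma L_loc_1_set_integrable:
  assumes f: "f \<in> L_loc 1" and g: "g \<in> borel_measurable borel" "AE x in lborel. f x = g x" and K: "compact K"
  shows "set_integrable lborel K g"
proof -
  note [measurable] = g(1)
  have [measurable]: "K \<in> sets borel" using K by (rule borel_compact)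
  have fm: "f \<in> borel_measurable lebesgue" using f by (simp add: L_loc_def)
  have "integrable lebesgue (\<lambda>x. indicator K x *\<^sub>R \<bar>f x\<bar> powr 1)"
    using f K by (simp add: L_loc_def set_integrable_def)
  moreover have "(\<lambda>x. indicator K x *\<^sub>R \<bar>f x\<bar> powr 1) \<in> borel_measurable lebesgue"
    using calculation by (rule borel_measurable_integrable)
  moreover have "AE x in lborel. indicator K x *\<^sub>R \<bar>f x\<bar> powr 1 = indicator K x * \<bar>g x\<bar>"
    using g(2) by eventually_elim (simp add: powr_one)
  ultimately have "integrable lborel (\<lambda>x. indicator K x * \<bar>g x\<bar>)"
    by (subst (asm) lebesgue_borel_transfer(2)) auto
  then have "integrable lborel (\<lambda>x. indicator K x * g x)"
    by (rule Bochner_Integration.integrable_bound) (auto simp: abs_mult)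
  then show ?thesis by (simp add: set_integrable_def)
qed

lemma test_function_partial_continuous:
  assumes "\<psi> \<in> test_functions" shows "continuous_on UNIV (partial_deriv i \<psi>)"
proof -
  have "C_k (Suc 0) \<psi>" using assms by (simp only: test_functions_def mem_Collect_eq)
  then show ?thesis by simp
qed

lemma weak_partial_borel:
  assumes w: "weak_partial i u g" and u: "u' \<in> borel_measurable borel" "AE x in lborel. u x = u' x"
    and g: "g' \<in> borel_measurable borel" "AE x in lborel. g x = g' x" and \<psi>: "\<psi> \<in> test_functions"
  shows "(LBINT x. u' x * partial_deriv i \<psi> x) = - (LBINT x. g' x * \<psi> x)"
proof -
  note [measurable] = u(1) g(1)
  have [measurable]: "\<psi> \<in> borel_measurable borel" "partial_deriv i \<psi> \<in> borel_measurable borel"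
    using test_function_continuous[OF \<psi>] test_function_partial_continuous[OF \<psi>]
    by (auto intro: borel_measurable_continuous_onI)
  have m: "u \<in> borel_measurable lebesgue" "g \<in> borel_measurable lebesgue"
    "\<psi> \<in> borel_measurable lebesgue" "partial_deriv i \<psi> \<in> borel_measurable lebesgue"
    using w by (auto simp: weak_partial_def L_loc_def measurable_completion)
  have "(\<integral>x. u x * partial_deriv i \<psi> x \<partial>lebesgue) = (LBINT x. u' x * partial_deriv i \<psi> x)"
    by (rule lebesgue_borel_transfer(1)) (use m u(2) in auto)
  moreover have "(\<integral>x. g x * \<psi> x \<partial>lebesgue) = (LBINT x. g' x * \<psi> x)"
    by (rule lebesgue_borel_transfer(1)) (use m g(2) in auto)
  ultimately show ?thesis using w \<psi> by (simp add: weak_partial_def)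
qed

lemma integrable_continuous_support:
  assumes "f \<in> borel_measurable borel" "\<And>K. compact K \<Longrightarrow> set_integrable lborel K f"
    and "continuous_on UNIV \<psi>" "bounded_support \<psi>"
  shows "integrable lborel (\<lambda>x. f x * \<psi> x)"
proof (rule integrable_L1loc_mult)
  show "L1loc f"
    using assms(1,2) by (auto simp: L1loc_def set_integrable_def)
qed (use assms in \<open>auto intro: locally_bounded_continuous borel_measurable_continuous_onI\<close>)

lemma test_function_bounded_support': "\<psi> \<in> test_functions \<Longrightarrow> bounded_support \<psi>"
  by (metis test_function_bounded_support bounded_supportI)

lemma weak_partial_representative:
  assumes "weak_partial i u g"
  obtains u' where "u' \<in> borel_measurable borel" "AE x in lborel. u x = u' x"
proof -
  have "u \<in> borel_measurable lebesgue" using assms by (simp add: weak_partial_def L_loc_def)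
  then show ?thesis using borel_representative that by blast
qed

lemma AE_eq_if_tested:
  fixes f g :: "real^'n::finite \<Rightarrow> real"
  assumes [measurable]: "f \<in> borel_measurable borel" "g \<in> borel_measurable borel"
    and int: "\<And>K. compact K \<Longrightarrow> set_integrable lborel K f" "\<And>K. compact K \<Longrightarrow> set_integrable lborel K g"
    and eq: "\<And>\<psi>. \<psi> \<in> box_bumps \<Longrightarrow> (LBINT x. f x * \<psi> x) = (LBINT x. g x * \<psi> x)"
  shows "AE x in lborel. f x = g x"
proof -
  have "AE x in lborel. f x - g x = 0"
  proof (rule fundamental_lemma)
    show "set_integrable lborel K (\<lambda>x. f x - g x)" if "compact K" for K
      using int that by (intro set_integral_diff)
    fix \<psi> :: "real^'n \<Rightarrow> real" assume b: "\<psi> \<in> box_bumps"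
    note \<psi> = box_bumps_test[OF b]
    have "integrable lborel (\<lambda>x. f x * \<psi> x)" "integrable lborel (\<lambda>x. g x * \<psi> x)"
      using int by (auto intro!: integrable_continuous_support test_function_continuous[OF \<psi>]
          test_function_bounded_support'[OF \<psi>])
    then show "(LBINT x. (f x - g x) * \<psi> x) = 0"
      using eq[OF b] by (simp add: left_diff_distrib)
  qed measurable
  then show ?thesis by eventually_elim simp
qed

text \<open>Reconciles the gradients that D^(1,2), H^2_loc and the weak formulation each supply by a
  separate existential quantifier.\<close>

lemma weak_partial_unique:
  assumes w: "weak_partial i u g" "weak_partial i u h"
    and g: "g' \<in> borel_measurable borel" "AE x in lborel. g x = g' x"
    and h: "h' \<in> borel_measurable borel" "AE x in lborel. h x = h' x"
  shows "AE x in lborel. g' x = h' x"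
proof -
  obtain u' where u: "u' \<in> borel_measurable borel" "AE x in lborel. u x = u' x"
    using weak_partial_representative[OF w(1)] by blast
  show ?thesis
  proof (rule AE_eq_if_tested[OF g(1) h(1)])
    fix \<psi> :: "real^'a \<Rightarrow> real" assume "\<psi> \<in> box_bumps"
    then have \<psi>: "\<psi> \<in> test_functions" by (rule box_bumps_test)
    show "(LBINT x. g' x * \<psi> x) = (LBINT x. h' x * \<psi> x)"
      using weak_partial_borel[OF w(1) u g \<psi>] weak_partial_borel[OF w(2) u h \<psi>] by simp
  qed (use w g h in \<open>auto intro: L_loc_1_set_integrable simp: weak_partial_def\<close>)
qed

text \<open>The weak formulation only asserts integrability of the nonlinearity against test
  functions. A box bump bounded below on K by a positive constant turns this into integrability over
  K.\<close>

lemma set_integrable_if_tested: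
  fixes f :: "real^'n::finite \<Rightarrow> real"
  assumes f [measurable]: "f \<in> borel_measurable borel"
    and int: "\<And>\<psi>. \<psi> \<in> box_bumps \<Longrightarrow> integrable lborel (\<lambda>x. f x * \<psi> x)" and K: "compact K"
  shows "set_integrable lborel K f"
proof -
  obtain M where M: "\<And>x. x \<in> K \<Longrightarrow> norm x \<le> M"
    using compact_imp_bounded[OF K] by (auto simp: bounded_iff)
  \<comment> \<open>The margin 1 around the bound M keeps both flat factors at arguments at least 1
    on K, so each is at least exp(-1) and every coordinate contributes at least exp(-2).\<close>
  define \<psi> :: "real^'n \<Rightarrow> real" where "\<psi> = tensor (\<lambda>i. bump 1 ((vec (- (M + 1)) :: real^'n) $ i) ((vec (M + 1) :: real^'n) $ i))"
  define c where "c = exp (- 2 :: real) ^ CARD('n)"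
  have "c > 0" by (simp add: c_def)
  have "\<psi> \<in> box_bumps" unfolding \<psi>_def box_bumps_def by blast
  have lower: "c \<le> \<psi> x" if "x \<in> K" for x
  proof -
    have "exp (- 2) \<le> bump 1 (- (M + 1)) (M + 1) (x $ i)" for i
    proof -
      have x: "\<bar>x $ i\<bar> \<le> M" using M[OF that] component_le_norm_cart[of x i] by linarith
      have fl: "exp (- 1) \<le> flat 1 t" if "t \<ge> 1" for t
        using that by (simp add: flat_def)
      have "exp (- 2) = exp (- 1) * exp (- 1 :: real)" by (simp add: exp_add[symmetric])
      also have "\<dots> \<le> bump 1 (- (M + 1)) (M + 1) (x $ i)"
        unfolding bump_def using x by (intro mult_mono fl) (auto simp: flat_1_bounds)
      finally show ?thesis .
    qed
    then have "(\<Prod>i\<in>(UNIV :: 'n set). exp (- 2)) \<le> \<psi> x"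
      unfolding \<psi>_def tensor_def by (intro prod_mono) auto
    then show ?thesis by (simp add: c_def)
  qed
  have [measurable]: "K \<in> sets borel" using K by (rule borel_compact)
  have "integrable lborel (\<lambda>x. 1 / c * (f x * \<psi> x))"
    by (intro integrable_mult_right int \<open>\<psi> \<in> box_bumps\<close>)
  then have "integrable lborel (\<lambda>x. indicator K x * f x)"
  proof (rule Bochner_Integration.integrable_bound)
    have "\<bar>f x\<bar> \<le> \<bar>1 / c * (f x * \<psi> x)\<bar>" if "x \<in> K" for x
    proof -
      have "\<bar>f x\<bar> * c \<le> \<bar>f x\<bar> * \<bar>\<psi> x\<bar>"
        using lower[OF that] by (intro mult_left_mono) auto
      then show ?thesis using \<open>c > 0\<close> by (simp add: abs_mult pos_le_divide_eq)
    qed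
    then show "AE x in lborel. norm (indicator K x * f x) \<le> norm (1 / c * (f x * \<psi> x))"
      by (intro AE_I2) (auto simp: indicator_def)
  qed measurable
  then show ?thesis by (simp add: set_integrable_def)
qed

text \<open>Both derivatives are moved onto a box bump, where they commute by
  \<open>partial_deriv_box_bump_commute\<close>.\<close>

lemma weak_second_derivatives_symmetric:
  assumes u: "weak_partial i u g" "weak_partial j u h" "weak_partial j g k" "weak_partial i h l"
    and g: "g' \<in> borel_measurable borel" "AE x in lborel. g x = g' x"
    and h: "h' \<in> borel_measurable borel" "AE x in lborel. h x = h' x"
    and k: "k' \<in> borel_measurable borel" "AE x in lborel. k x = k' x"
    and l: "l' \<in> borel_measurable borel" "AE x in lborel. l x = l' x"
  shows "AE x in lborel. k' x = l' x"
proof -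
  obtain u' where u': "u' \<in> borel_measurable borel" "AE x in lborel. u x = u' x"
    using weak_partial_representative[OF u(1)] by blast
  show ?thesis
  proof (rule AE_eq_if_tested[OF k(1) l(1)])
    fix \<psi> :: "real^'a \<Rightarrow> real" assume b: "\<psi> \<in> box_bumps"
    note \<psi> = box_bumps_test[OF b] and d\<psi> = partial_deriv_box_bump_test[OF b]
    have "(LBINT x. k' x * \<psi> x) = (LBINT x. u' x * partial_deriv i (partial_deriv j \<psi>) x)"
      using weak_partial_borel[OF u(3) g k \<psi>] weak_partial_borel[OF u(1) u' g d\<psi>[of j]] by simp
    also have "\<dots> = (LBINT x. l' x * \<psi> x)"
      using weak_partial_borel[OF u(4) h l \<psi>] weak_partial_borel[OF u(2) u' h d\<psi>[of i]]
      by (simp add: partial_deriv_box_bump_commute[OF b, of i j])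
    finally show "(LBINT x. k' x * \<psi> x) = (LBINT x. l' x * \<psi> x)" .
  qed (use u k l in \<open>auto intro: L_loc_1_set_integrable simp: weak_partial_def\<close>)
qed

text \<open>Valid at every x and not merely almost everywhere, since u enters only under the
  integral. This is where the factor 1/(4 pi) is split off.\<close>

lemma phi_eq_potential:
  fixes u :: "real^3 \<Rightarrow> real"
  assumes u: "u \<in> borel_measurable lebesgue" and u' [measurable]: "u' \<in> borel_measurable borel"
    and ae: "AE x in lborel. u x = u' x"
  shows "phi u x = potential u' x / (4 * pi)"
proof -
  have "phi u x = (\<integral>y. 1 / (4 * pi * norm (x - y)) * (u y)\<^sup>2 \<partial>lebesgue)"
    by (simp add: phi_def convolution_def)
  also have "\<dots> = (LBINT y. 1 / (4 * pi) * ((u' y)\<^sup>2 / norm (x - y)))"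
  proof (rule lebesgue_borel_transfer(1))
    have "(\<lambda>y. 1 / (4 * pi * norm (x - y))) \<in> borel_measurable lborel" by measurable
    then have "(\<lambda>y. 1 / (4 * pi * norm (x - y))) \<in> borel_measurable lebesgue"
      by (rule measurable_completion)
    then show "(\<lambda>y. 1 / (4 * pi * norm (x - y)) * (u y)\<^sup>2) \<in> borel_measurable lebesgue"
      by (intro borel_measurable_times borel_measurable_power u)
    show "AE y in lborel. 1 / (4 * pi * norm (x - y)) * (u y)\<^sup>2 = 1 / (4 * pi) * ((u' y)\<^sup>2 / norm (x - y))"
      using ae by eventually_elim simp
  qed measurable
  also have "\<dots> = potential u' x / (4 * pi)"
    unfolding potential_def by (simp only: integral_mult_right_zero) simp
  finally show ?thesis .
qed

section \<open>From a weak solution to the equation almost everywhere\<close>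

theorem corollary2p6:
  fixes p \<mu> :: real
  assumes "p \<ge> 5" and "\<mu> > 0"
  shows "\<not> (\<exists>u. u \<in> E_space \<inter> H2_loc \<and> weak_solution p \<mu> u \<and>
                 \<not> (AE x in lebesgue. u x = 0))"
proof
  assume "\<exists>u. u \<in> E_space \<inter> H2_loc \<and> weak_solution p \<mu> u \<and> \<not> (AE x in lebesgue. u x = 0)"
  then obtain u where uE: "u \<in> E_space" and uH: "u \<in> H2_loc" and sol: "weak_solution p \<mu> u"
    and nt: "\<not> (AE x in lebesgue. u x = 0)" by auto
  obtain G1 where G1: "weak_grad u G1" "\<And>i. (\<lambda>x. G1 x $ i) \<in> L_space 2" and u6: "u \<in> L_space 6"
    using uE by (auto simp: E_space_def D12_def)
  obtain G2 H where G2: "weak_grad u G2" "\<And>i. (\<lambda>x. G2 x $ i) \<in> L_loc 2"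
    and H: "\<And>i j. weak_partial j (\<lambda>x. G2 x $ i) (H i j)" "\<And>i j. H i j \<in> L_loc 2" and u2: "u \<in> L_loc 2"
    using uH unfolding H2_loc_def by blast
  obtain G3 where G3: "weak_grad u G3" and eqn: "\<And>\<psi>. \<psi> \<in> test_functions \<Longrightarrow>
     integrable lebesgue (\<lambda>x. G3 x \<bullet> grad \<psi> x) \<and>
     integrable lebesgue (\<lambda>x. phi u x * u x * \<psi> x) \<and>
     integrable lebesgue (\<lambda>x. \<bar>u x\<bar> powr (p - 1) * u x * \<psi> x) \<and>
     (\<integral>x. G3 x \<bullet> grad \<psi> x \<partial>lebesgue) + (\<integral>x. phi u x * u x * \<psi> x \<partial>lebesgue)
       = \<mu> * (\<integral>x. \<bar>u x\<bar> powr (p - 1) * u x * \<psi> x \<partial>lebesgue)"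
    using sol by (auto simp: weak_solution_def)
  have um: "u \<in> borel_measurable lebesgue" using u2 by (simp add: L_loc_def)
  obtain v where v: "v \<in> borel_measurable borel" "AE x in lborel. u x = v x"
    using borel_representative[OF um] by blast
  have G2m: "(\<lambda>x. G2 x $ i) \<in> borel_measurable lebesgue" for i
    using G2(2)[of i] by (simp add: L_loc_def)
  have "\<forall>i. \<exists>g. g \<in> borel_measurable borel \<and> (AE x in lborel. G2 x $ i = g x)"
    using borel_representative[OF G2m] by blast
  then obtain g where g: "\<And>i. g i \<in> borel_measurable borel" "\<And>i. AE x in lborel. G2 x $ i = g i x"
    by metis
  have "\<forall>i j. \<exists>h. h \<in> borel_measurable borel \<and> (AE x in lborel. H i j x = h x)"
  proof (intro allI)
    fix i j
    have "H i j \<in> borel_measurable lebesgue" using H(2)[of i j] by (simp add: L_loc_def)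
    then show "\<exists>h. h \<in> borel_measurable borel \<and> (AE x in lborel. H i j x = h x)"
      using borel_representative by blast
  qed
  then obtain h where h: "\<And>i j. h i j \<in> borel_measurable borel" "\<And>i j. AE x in lborel. H i j x = h i j x"
    by metis
  note [measurable] = v(1) g(1) h(1)
  \<comment> \<open>Applied to \<open>G3\<close> in the weak formulation and to \<open>G1\<close>
    for the global L^2 bound; \<open>G2\<close>, which has second derivatives, fixes the
    representative \<open>g\<close>.\<close>
  have G_ae: "AE x in lborel. G x $ i = g i x" if "weak_grad u G" for G i
  proof -
    have w: "weak_partial i u (\<lambda>x. G x $ i)" "weak_partial i u (\<lambda>x. G2 x $ i)"
      using that G2(1) by (auto simp: weak_grad_def)
    then have "(\<lambda>x. G x $ i) \<in> borel_measurable lebesgue" by (simp add: weak_partial_def L_loc_def)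
    then obtain g' where g': "g' \<in> borel_measurable borel" "AE x in lborel. G x $ i = g' x"
      using borel_representative by blast
    from g'(2) weak_partial_unique[OF w g' g(1)[of i] g(2)[of i]]
    show ?thesis by eventually_elim simp
  qed
  have vL: "L2loc v" using u2 v by (rule L_loc_2_L2loc)
  have gL: "L2loc (g i)" for i using G2(2) g by (rule L_loc_2_L2loc)
  have hL: "L2loc (h i j)" for i j using H(2) h by (rule L_loc_2_L2loc)
  have wu: "weak_partial i u (\<lambda>x. G2 x $ i)" for i using G2(1) by (simp add: weak_grad_def)
  \<comment> \<open>Interpreted ahead of the equation: the local boundedness of the potential puts
    \<open>P\<close> below into \<open>L2loc\<close>, on which the derivation of the pointwise
    equation relies.\<close>
  interpret coulomb v
  proof
    show "v \<in> borel_measurable borel" by (rule v)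
    have "integrable lebesgue (\<lambda>x. \<bar>u x\<bar> powr 6)" using u6 by (simp add: L_space_def)
    moreover have "(\<lambda>x. \<bar>u x\<bar> powr 6) \<in> borel_measurable lebesgue"
      using calculation by (rule borel_measurable_integrable)
    moreover have "AE x in lborel. \<bar>u x\<bar> powr 6 = (v x) ^ 6"
      using v(2)
    proof eventually_elim
      case (elim x)
      then show ?case by (cases "v x = 0") (simp_all add: power_even_abs)
    qed
    ultimately show "integrable lborel (\<lambda>x. (v x) ^ 6)"
      by (subst (asm) lebesgue_borel_transfer(2)) auto
    have inner: "(\<integral>\<^sup>+x. ennreal ((u x)\<^sup>2 * c / norm (x - y)) \<partial>lebesgue)
        = (\<integral>\<^sup>+x. ennreal ((v x)\<^sup>2 * c / norm (x - y)) \<partial>lborel)" for c y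
      unfolding nn_integral_completion
      by (rule nn_integral_cong_AE) (use v(2) in eventually_elim, simp)
    have "(\<integral>\<^sup>+y. (\<integral>\<^sup>+x. ennreal ((v x)\<^sup>2 * (v y)\<^sup>2 / norm (x - y)) \<partial>lborel) \<partial>lborel)
        = (\<integral>\<^sup>+y. (\<integral>\<^sup>+x. ennreal ((u x)\<^sup>2 * (u y)\<^sup>2 / norm (x - y)) \<partial>lebesgue) \<partial>lebesgue)"
      unfolding inner unfolding nn_integral_completion
      by (rule nn_integral_cong_AE) (use v(2) in eventually_elim, simp)
    then show "(\<integral>\<^sup>+y. (\<integral>\<^sup>+x. ennreal ((v x)\<^sup>2 * (v y)\<^sup>2 / norm (x - y)) \<partial>lborel) \<partial>lborel) < \<infinity>"
      using uE by (simp add: E_space_def)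
    show "\<not> (AE x in lborel. v x = 0)"
    proof
      assume "AE x in lborel. v x = 0"
      with v(2) have "AE x in lborel. u x = 0" by eventually_elim simp
      then show False using nt by (simp add: AE_completion_iff)
    qed
  qed
  define f where "f x = \<bar>v x\<bar> powr (p - 1) * v x" for x
  have [measurable]: "f \<in> borel_measurable borel" unfolding f_def[abs_def] by measurable

  have f_ae: "AE x in lborel. \<bar>u x\<bar> powr (p - 1) * u x * \<psi> x = f x * \<psi> x" for \<psi>
    using v(2) by eventually_elim (simp add: f_def)
  \<comment> \<open>Local integrability is all that the fundamental lemma asks. Local square
    integrability of \<open>f\<close> is read off from the equation afterwards, inside
    \<open>pohozaev\<close>.\<close>
  have fK: "set_integrable lborel K f" if "compact K" for K
  proof (rule set_integrable_if_tested[OF _ _ that])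
    fix \<psi> :: "real^3 \<Rightarrow> real" assume "\<psi> \<in> box_bumps"
    then have \<psi>: "\<psi> \<in> test_functions" by (rule box_bumps_test)
    have [measurable]: "\<psi> \<in> borel_measurable borel"
      by (intro borel_measurable_continuous_onI test_function_continuous \<psi>)
    have i: "integrable lebesgue (\<lambda>x. \<bar>u x\<bar> powr (p - 1) * u x * \<psi> x)" using eqn[OF \<psi>] by blast
    show "integrable lborel (\<lambda>x. f x * \<psi> x)"
      using lebesgue_borel_transfer(2)[OF borel_measurable_integrable[OF i] _ f_ae] i by simp
  qed measurable
  define P where "P x = potential v x / (4 * pi) * v x" for x
  have PL: "L2loc P"
    unfolding P_def[abs_def]
    using L2loc_cmult[OF L2loc_mult_locally_bounded(2)[OF vL potential_measurable potential_locally_bounded], of "1 / (4 * pi)"]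
    by simp
  note [measurable] = L2loc_measurable[OF PL]
  \<comment> \<open>Integrating by parts once more, now from \<open>G2\<close> to \<open>H\<close>,
    gives the strong form. The sign is written as \<open>- 1 *\<close> so that
    \<open>L2loc_cmult\<close> and \<open>L2loc_sum\<close> apply as they stand.\<close>
  have pde: "AE x in lborel. (\<Sum>i\<in>UNIV. - 1 * h i i x) + P x - \<mu> * f x = 0"
  proof (rule fundamental_lemma)
    show "set_integrable lborel K (\<lambda>x. (\<Sum>i\<in>UNIV. - 1 * h i i x) + P x - \<mu> * f x)" if "compact K" for K
      using that
      by (intro set_integral_diff L2loc_set_integrable L2loc_add L2loc_sum L2loc_cmult hL PL
          set_integrable_mult_right fK)
    fix \<psi> :: "real^3 \<Rightarrow> real" assume "\<psi> \<in> box_bumps"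
    then have \<psi>: "\<psi> \<in> test_functions" by (rule box_bumps_test)
    have \<psi>c: "continuous_on UNIV \<psi>" "bounded_support \<psi>"
      using test_function_continuous[OF \<psi>] test_function_bounded_support'[OF \<psi>] by auto
    have \<psi>L: "L2loc \<psi>" using \<psi>c by (intro L2loc_continuous)
    have dc: "continuous_on UNIV (partial_deriv i \<psi>)" for i
      by (rule test_function_partial_continuous[OF \<psi>])
    have db: "bounded_support (partial_deriv i \<psi>)" for i
      by (rule test_function_bounded_support'[OF partial_deriv_box_bump_test[OF \<open>\<psi> \<in> box_bumps\<close>]])
    have [measurable]: "\<psi> \<in> borel_measurable borel" "partial_deriv i \<psi> \<in> borel_measurable borel" for i
      using \<psi>c dc by (auto intro: borel_measurable_continuous_onI)
    have i1: "integrable lborel (\<lambda>x. h i i x * \<psi> x)" "integrable lborel (\<lambda>x. P x * \<psi> x)" for i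
      by (intro integrable_L2loc_mult hL PL \<psi>L \<psi>c)+
    have i2: "integrable lborel (\<lambda>x. f x * \<psi> x)"
      by (rule integrable_continuous_support[OF _ fK \<psi>c]) measurable
    have "(\<integral>x. G3 x \<bullet> grad \<psi> x \<partial>lebesgue) = (LBINT x. (\<Sum>i\<in>UNIV. g i x * partial_deriv i \<psi> x))"
    proof (rule lebesgue_borel_transfer(1))
      show "(\<lambda>x. G3 x \<bullet> grad \<psi> x) \<in> borel_measurable lebesgue"
        using eqn[OF \<psi>] borel_measurable_integrable by blast
      have "AE x in lborel. \<forall>i. G3 x $ i = g i x"
        using G_ae[OF G3] by (simp add: AE_all_countable)
      then show "AE x in lborel. G3 x \<bullet> grad \<psi> x = (\<Sum>i\<in>UNIV. g i x * partial_deriv i \<psi> x)"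
        by eventually_elim (simp add: inner_vec_def grad_def)
    qed measurable
    also have "\<dots> = (\<Sum>i\<in>UNIV. LBINT x. g i x * partial_deriv i \<psi> x)"
      by (intro Bochner_Integration.integral_sum integrable_L2loc_mult gL L2loc_continuous dc db)
    also have "\<dots> = (\<Sum>i\<in>UNIV. - (LBINT x. h i i x * \<psi> x))"
      using weak_partial_borel[OF H(1) g h \<psi>] by (intro sum.cong) auto
    finally have e1: "(\<integral>x. G3 x \<bullet> grad \<psi> x \<partial>lebesgue) = (\<Sum>i\<in>UNIV. - (LBINT x. h i i x * \<psi> x))" .
    have e2: "(\<integral>x. phi u x * u x * \<psi> x \<partial>lebesgue) = (LBINT x. P x * \<psi> x)"
    proof (rule lebesgue_borel_transfer(1))
      show "(\<lambda>x. phi u x * u x * \<psi> x) \<in> borel_measurable lebesgue"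
        using eqn[OF \<psi>] borel_measurable_integrable by blast
      show "AE x in lborel. phi u x * u x * \<psi> x = P x * \<psi> x"
        using v(2) by eventually_elim (simp add: P_def phi_eq_potential[OF um v])
    qed measurable
    have e3: "(\<integral>x. \<bar>u x\<bar> powr (p - 1) * u x * \<psi> x \<partial>lebesgue) = (LBINT x. f x * \<psi> x)"
    proof (rule lebesgue_borel_transfer(1)[OF _ _ f_ae])
      show "(\<lambda>x. \<bar>u x\<bar> powr (p - 1) * u x * \<psi> x) \<in> borel_measurable lebesgue"
        using eqn[OF \<psi>] borel_measurable_integrable by blast
    qed measurable
    have "(LBINT x. ((\<Sum>i\<in>UNIV. - 1 * h i i x) + P x - \<mu> * f x) * \<psi> x)
        = (LBINT x. (\<Sum>i\<in>UNIV. - (h i i x * \<psi> x)) + P x * \<psi> x - \<mu> * (f x * \<psi> x))"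
      by (rule Bochner_Integration.integral_cong[OF refl])
        (simp add: left_diff_distrib distrib_right sum_distrib_right sum_negf)
    also have "\<dots> = (\<Sum>i\<in>UNIV. - (LBINT x. h i i x * \<psi> x)) + (LBINT x. P x * \<psi> x)
        - \<mu> * (LBINT x. f x * \<psi> x)"
      using i1 i2 by (simp add: Bochner_Integration.integral_sum Bochner_Integration.integrable_sum sum_negf)
    also have "\<dots> = 0" using eqn[OF \<psi>] e1 e2 e3 by simp
    finally show "(LBINT x. ((\<Sum>i\<in>UNIV. - 1 * h i i x) + P x - \<mu> * f x) * \<psi> x) = 0" .
  qed measurable
  \<comment> \<open>The weak identities are passed on for box bumps only, which is all that
    \<open>weak_dir_derivI\<close> requires; the global L^2 bound on the gradient is transferred
    from \<open>G1\<close> to \<open>g\<close>.\<close>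
  interpret pohozaev v g h p \<mu>
  proof
    show "weak_dir_deriv (axis i 1) v (g i)" for i
      using weak_partial_borel[OF wu v g box_bumps_test] by (rule weak_dir_derivI[OF vL gL])
    show "weak_dir_deriv (axis j 1) (g i) (h i j)" for i j
      using weak_partial_borel[OF H(1) g h box_bumps_test] by (rule weak_dir_derivI[OF gL hL])
    show "AE x in lborel. h i j x = h j i x" for i j
      by (rule weak_second_derivatives_symmetric[OF wu wu H(1) H(1) g g h h])
    show "integrable lborel (\<lambda>x. (g i x)\<^sup>2)" for i
    proof -
      have "integrable lebesgue (\<lambda>x. \<bar>G1 x $ i\<bar> powr 2)" using G1(2)[of i] by (simp add: L_space_def)
      moreover have "(\<lambda>x. \<bar>G1 x $ i\<bar> powr 2) \<in> borel_measurable lebesgue"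
        using calculation by (rule borel_measurable_integrable)
      moreover have "AE x in lborel. \<bar>G1 x $ i\<bar> powr 2 = (g i x)\<^sup>2"
        using G_ae[OF G1(1), of i] by eventually_elim simp
      ultimately show ?thesis
        by (subst (asm) lebesgue_borel_transfer(2)) auto
    qed
    show "AE x in lborel. - (\<Sum>i\<in>UNIV. h i i x) + potential v x / (4 * pi) * v x
        = \<mu> * (\<bar>v x\<bar> powr (p - 1) * v x)"
      using pde by eventually_elim (simp add: P_def f_def sum_negf)
  qed (use assms in auto)
  show False by (rule contradiction)
qed

end
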